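(* For all $x \in \mathbb{R}$ we have $\arctan(x) = \underline{\arctan}(x)$, and for all $x \in \mathbb{R}_{\leq 0}$ we have $\mathrm{nlog}(x) = \underline{\mathrm{nlog}}(x)$. Here $\arctan$ and $\mathrm{nlog}(x) = -\log(1-x)$ are the usual real functions, and $\underline{\arctan}$, $\underline{\mathrm{nlog}}$ are the surreal functions defined inductively in the context.
   Context: $\mathbf{No}$ is the class of (Conway) surreal numbers, with $\mathbb{R} \subset \mathbf{No}$. A number $x$ is written $x = \{L_x \mid R_x\}$ with $L_x, R_x$ sets of numbers; $x^L$ and $x^R$ denote typical elements of $L_x$ and $R_x$. $\{L\mid R\}$ is the oldest (simplest) number greater than all elements of $L$ and less than all elements of $R$. Functions are defined by induction on the options of $x$. For $n \in \mathbb{N}$, $z\in\mathbf{No}$ and a real analytic function $f$, $[z]_n = \sum_{i=0}^n \frac{f^{(i)}(0)}{i!} z^i$ denotes the $n$-truncation of the Maclaurin expansion of $f$ (with $f=\arctan$ in the definition of $\underline{\arctan}$ and $f=\mathrm{nlog}$ in the definition of $\underline{\mathrm{nlog}}$, where $\mathrm{nlog}(x) = -\log(1-x)$). In the formulas below $n$ ranges over $\mathbb{N}$, and $x^L, x^R$ range over $L_x, R_x$. Definition of $\underline{\arctan}$ (on all of $\mathbf{No}$): $\underline{\arctan}(x) = \{\mathcal{L} \mid \mathcal{R}\}$, where the left options $\mathcal{L}$ are $$\tfrac{-\pi}{2},\quad \underline{\arctan}(x^L) +\left[\tfrac{x-x^L}{1+xx^L}\right]_{4n-1},\quad \underline{\arctan}(x^R)+\left[\tfrac{x-x^R}{1+xx^R}\right]_{4n+1},$$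 and the right options $\mathcal{R}$ are $$\underline{\arctan}(x^R)-\left[\tfrac{x^R-x}{1+xx^R}\right]_{4n-1},\quad \underline{\arctan}(x^L)-\left[\tfrac{x^L-x}{1+xx^L}\right]_{4n+1},\quad \tfrac{\pi}{2},$$ under three conditions: (1) if $y \in L_x \cup R_x$ is such that $\left|\frac{x-y}{1+xy}\right| > 1$, the options in the formula that involve $y$ are ignored; (2) if $x^L$ is such that $\left|\underline{\arctan}(x^L) \pm \left[\frac{\pm(x-x^L)}{1+xx^L}\right]_{4n \mp 1}\right| > \frac{\pi}{2}$, the options that involve $x^L$ are ignored; (3) if $x^R$ is such that $\left|\underline{\arctan}(x^R) \pm \left[\frac{\pm(x-x^R)}{1+xx^R}\right]_{4n \pm 1}\right| > \frac{\pi}{2}$, the options that involve $x^R$ are ignored. Definition of $\underline{\mathrm{nlog}}$ (on the domain $(-\infty,0]$ of $\mathbf{No}$, where $\infty$ is the gap between the finite and the positive infinite numbers): $\underline{\mathrm{nlog}}(x) = \{\mathcal{L}\mid\mathcal{R}\}$, where the left options $\mathcal{L}$ are $$\underline{\mathrm{nlog}}(x^L)+\left[\tfrac{x-x^L}{1-x^L}\right]_{n},\quad \underline{\mathrm{nlog}}(x^R)+\left[\tfrac{x-x^R}{1-x^R}\right]_{2n+1},$$ and the right options $\mathcal{R}$ are $$\underline{\mathrm{nlog}}(x^R)-\left[\tfrac{x^R-x}{1-x}\right]_{n},\quad \underline{\mathrm{nlog}}(x^L)-\left[\tfrac{x^L-x}{1-x}\right]_{2n+1},$$ where if $y \in L_x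 \cup R_x$ is such that $\left|\frac{x-y}{1-y}\right| \geq 1$ or $\left|\frac{x-y}{1-x}\right| \geq 1$, the options in the formula that involve $y$ are ignored.
   Formalization: In the definition of nlog, options from y are ignored if |(x−y)/(1−y)| > 1, instead of ≥ 1 (the second condition |(x−y)/(1−x)| ≥ 1 is kept); with ≥ 1 the only option 0 of −1 = { | 0} is dropped and nlog(−1) would be 0 instead of −log 2. *)

theory Defs
  imports "HOL-Analysis.Analysis" "HOL-Library.Infinite_Typeclass"
begin

section \<open>Surreal numbers as sign expansions\<close>

text \<open>
  HOL has no proper classes, so the class of ordinals is cut off at the successor cardinal of a
  type \<open>'a\<close>, whose elements make up the library type \<open>'a suc\<close>.  For infinite \<open>'a\<close> this cardinal is
  regular and uncountable; the surreal numbers whose length lies below it contain the reals, are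
  closed under the field operations, and every pair of sets \<open>L < R\<close> of at most \<open>|'a|\<close> of them has a
  simplest number in between, the same one as in the full class.  As \<open>'a\<close> is arbitrary, the cut-off
  can be taken as large as desired.
\<close>

instantiation suc :: (type) wellorder
begin

definition less_eq_suc :: "'a suc \<Rightarrow> 'a suc \<Rightarrow> bool" where
  "a \<le> b \<longleftrightarrow> (a, b) \<in> card_suc (card_of (UNIV :: 'a set))"

definition less_suc :: "'a suc \<Rightarrow> 'a suc \<Rightarrow> bool" where
  "a < b \<longleftrightarrow> a \<le> b \<and> a \<noteq> (b :: 'a suc)"

instance
proof -
  let ?r = "card_suc (card_of (UNIV :: 'a set))"
  have "card_order ?r"
    by (simp add: card_order_card_suc card_of_card_order_on)
  then have "well_order_on UNIV ?r"
    by (rule card_order_on_well_order_on)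
  then have refl: "\<And>x. (x, x) \<in> ?r" and tr: "trans ?r" and an: "antisym ?r"
    and tot: "total_on UNIV ?r" and wf: "wf (?r - Id)"
    by (auto simp: order_on_defs refl_on_def)
  show "OFCLASS('a suc, wellorder_class)"
  proof (standard, goal_cases)
    case (1 x y)
    show ?case unfolding less_suc_def less_eq_suc_def using antisymD[OF an] by blast
  next
    case (2 x)
    show ?case unfolding less_eq_suc_def by (rule refl)
  next
    case (3 x y z)
    then show ?case unfolding less_eq_suc_def by (rule transD[OF tr])
  next
    case (4 x y)
    then show ?case unfolding less_eq_suc_def by (rule antisymD[OF an])
  next
    case (5 x y)
    show ?case unfolding less_eq_suc_def using tot refl by (cases "x = y") (auto simp: total_on_def)
  next
    case (6 P a)
    show ?case using wf
    proof (induction a rule: wf_induct_rule)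
      case (less x)
      show ?case
        by (rule 6) (rule less.IH, simp add: less_suc_def less_eq_suc_def)
    qed
  qed
qed

end

text \<open>A sign expansion takes the values \<open>1\<close> and \<open>-1\<close> below its length and \<open>0\<close> from there on.\<close>

typedef 'a surreal =
  "{s :: 'a suc \<Rightarrow> int. range s \<subseteq> {-1, 0, 1} \<and> (\<exists>\<alpha>. \<forall>\<beta>. s \<beta> \<noteq> 0 \<longleftrightarrow> \<beta> < \<alpha>)}"
  morphisms sgn_at Abs_surreal
proof -
  have "\<not> \<beta> < (LEAST \<gamma>. True)" for \<beta> :: "'a suc"
    by (metis (full_types) not_less_Least)
  then show ?thesis
    by (intro exI[of _ "\<lambda>_. 0"]) auto
qed

text \<open>The length of the sign expansion.\<close>

definition birthday :: "'a surreal \<Rightarrow> 'a suc" where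
  "birthday x = (LEAST \<alpha>. sgn_at x \<alpha> = 0)"

instantiation surreal :: (type) linorder
begin

definition less_surreal :: "'a surreal \<Rightarrow> 'a surreal \<Rightarrow> bool" where
  "x < y \<longleftrightarrow> (\<exists>\<alpha>. (\<forall>\<beta><\<alpha>. sgn_at x \<beta> = sgn_at y \<beta>) \<and> sgn_at x \<alpha> < sgn_at y \<alpha>)"

definition less_eq_surreal :: "'a surreal \<Rightarrow> 'a surreal \<Rightarrow> bool" where
  "x \<le> y \<longleftrightarrow> x < y \<or> x = (y :: 'a surreal)"

instance
proof -
  have asym: False if "x < y" "y < x" for x y :: "'a surreal"
  proof -
    from that obtain a b where
      "\<forall>\<beta><a. sgn_at x \<beta> = sgn_at y \<beta>" "sgn_at x a < sgn_at y a"
      "\<forall>\<beta><b. sgn_at y \<beta> = sgn_at x \<beta>" "sgn_at y b < sgn_at x b"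
      by (auto simp: less_surreal_def)
    then show False by (metis less_irrefl less_asym linorder_neqE)
  qed
  have tr: "x < z" if "x < y" "y < z" for x y z :: "'a surreal"
  proof -
    from that obtain a b where
      *: "\<forall>\<beta><a. sgn_at x \<beta> = sgn_at y \<beta>" "sgn_at x a < sgn_at y a"
      "\<forall>\<beta><b. sgn_at y \<beta> = sgn_at z \<beta>" "sgn_at y b < sgn_at z b"
      by (auto simp: less_surreal_def)
    have "(\<forall>\<beta><min a b. sgn_at x \<beta> = sgn_at z \<beta>) \<and> sgn_at x (min a b) < sgn_at z (min a b)"
    proof (cases a b rule: linorder_cases)
      case less with * show ?thesis by (auto simp: min_def)
    next
      case equal with * show ?thesis by auto
    next
      case greater with * show ?thesis by (auto simp: min_def)
    qed
    then show ?thesis unfolding less_surreal_def by (rule exI)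
  qed
  have tot: "x < y \<or> y < x" if "x \<noteq> y" for x y :: "'a surreal"
  proof -
    from that obtain c where c: "sgn_at x c \<noteq> sgn_at y c"
      by (metis ext sgn_at_inject)
    define a where "a = (LEAST c. sgn_at x c \<noteq> sgn_at y c)"
    have "sgn_at x a \<noteq> sgn_at y a" unfolding a_def using c by (rule LeastI)
    moreover have "\<forall>\<beta><a. sgn_at x \<beta> = sgn_at y \<beta>" unfolding a_def using not_less_Least by blast
    ultimately show ?thesis unfolding less_surreal_def by (metis linorder_neqE)
  qed
  show "OFCLASS('a surreal, linorder_class)"
  proof (standard, goal_cases)
    case (1 x y) show ?case using asym by (auto simp: less_eq_surreal_def)
  next
    case (2 x) show ?case by (simp add: less_eq_surreal_def)
  next
    case (3 x y z) then show ?case using tr by (auto simp: less_eq_surreal_def)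
  next
    case (4 x y) then show ?case using asym by (auto simp: less_eq_surreal_def)
  next
    case (5 x y) show ?case using tot by (auto simp: less_eq_surreal_def)
  qed
qed

end

text \<open>\<open>simplest L R\<close> is the number \<open>{L | R}\<close>; it is meaningful only if \<open>L < R\<close>.\<close>

definition strictly_between :: "'a surreal set \<Rightarrow> 'a surreal set \<Rightarrow> 'a surreal set" where
  "strictly_between L R = {z. (\<forall>l\<in>L. l < z) \<and> (\<forall>r\<in>R. z < r)}"

definition simplest :: "'a surreal set \<Rightarrow> 'a surreal set \<Rightarrow> 'a surreal" where
  "simplest L R = (THE z. z \<in> strictly_between L R \<and>
                     (\<forall>w\<in>strictly_between L R. birthday z \<le> birthday w))"

text \<open>
  The options of \<open>x\<close> are those of its canonical representation: the proper initial segments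
  of \<open>x\<close> that lie below \<open>x\<close> (left options) or above \<open>x\<close> (right options).
\<close>

definition simpler :: "'a surreal \<Rightarrow> 'a surreal \<Rightarrow> bool" where
  "simpler y x \<longleftrightarrow> birthday y < birthday x \<and> (\<forall>\<beta><birthday y. sgn_at y \<beta> = sgn_at x \<beta>)"

definition left_opts :: "'a surreal \<Rightarrow> 'a surreal set" where
  "left_opts x = {y. simpler y x \<and> y < x}"

definition right_opts :: "'a surreal \<Rightarrow> 'a surreal set" where
  "right_opts x = {y. simpler y x \<and> x < y}"

definition simpler_rel :: "('a surreal \<times> 'a surreal) set" where
  "simpler_rel = {(y, x). simpler y x}"

lemma wf_simpler_rel: "wf simpler_rel"
proof -
  have "wf (inv_image {(a :: 'a suc, b). a < b} birthday)"
    by (intro wf_inv_image wf)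
  then show ?thesis
    by (rule wf_subset) (auto simp: simpler_rel_def simpler_def)
qed

lemma option_simpler_rel:
  "y \<in> left_opts x \<Longrightarrow> (y, x) \<in> simpler_rel"
  "y \<in> right_opts x \<Longrightarrow> (y, x) \<in> simpler_rel"
  by (auto simp: left_opts_def right_opts_def simpler_rel_def)


section \<open>Arithmetic\<close>

function surreal_add :: "'a surreal \<Rightarrow> 'a surreal \<Rightarrow> 'a surreal" where
  "surreal_add x y = simplest
     ({z. \<exists>l\<in>left_opts x. z = surreal_add l y} \<union>
      {z. \<exists>l\<in>left_opts y. z = surreal_add x l})
     ({z. \<exists>r\<in>right_opts x. z = surreal_add r y} \<union>
      {z. \<exists>r\<in>right_opts y. z = surreal_add x r})"
  by pat_completeness auto
termination
  by (relation "simpler_rel <*lex*> simpler_rel")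
     (auto simp: wf_simpler_rel option_simpler_rel intro!: wf_lex_prod)

declare surreal_add.simps [simp del]

function surreal_minus :: "'a surreal \<Rightarrow> 'a surreal" where
  "surreal_minus x = simplest
     {z. \<exists>r\<in>right_opts x. z = surreal_minus r}
     {z. \<exists>l\<in>left_opts x. z = surreal_minus l}"
  by pat_completeness auto
termination
  by (relation simpler_rel) (auto simp: wf_simpler_rel option_simpler_rel)

declare surreal_minus.simps [simp del]

instantiation surreal :: (type) "{zero, one, plus, uminus, minus, abs}"
begin

definition zero_surreal :: "'a surreal" where "0 = simplest {} {}"
definition one_surreal :: "'a surreal" where "1 = simplest {0} {}"
definition plus_surreal :: "'a surreal \<Rightarrow> 'a surreal \<Rightarrow> 'a surreal" where
  "x + y = surreal_add x y"
definition uminus_surreal :: "'a surreal \<Rightarrow> 'a surreal" where "- x = surreal_minus x"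
definition minus_surreal :: "'a surreal \<Rightarrow> 'a surreal \<Rightarrow> 'a surreal" where
  "x - y = x + - (y :: 'a surreal)"
definition abs_surreal :: "'a surreal \<Rightarrow> 'a surreal" where
  "\<bar>x\<bar> = (if x < 0 then - x else (x :: 'a surreal))"

instance ..

end

function surreal_mult :: "'a surreal \<Rightarrow> 'a surreal \<Rightarrow> 'a surreal" where
  "surreal_mult x y = simplest
     ({z. \<exists>a\<in>left_opts x. \<exists>b\<in>left_opts y.
          z = surreal_mult a y + surreal_mult x b - surreal_mult a b} \<union>
      {z. \<exists>a\<in>right_opts x. \<exists>b\<in>right_opts y.
          z = surreal_mult a y + surreal_mult x b - surreal_mult a b})
     ({z. \<exists>a\<in>left_opts x. \<exists>b\<in>right_opts y.
          z = surreal_mult a y + surreal_mult x b - surreal_mult a b} \<union>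
      {z. \<exists>a\<in>right_opts x. \<exists>b\<in>left_opts y.
          z = surreal_mult a y + surreal_mult x b - surreal_mult a b})"
  by pat_completeness auto
termination
  by (relation "simpler_rel <*lex*> simpler_rel")
     (auto simp: wf_simpler_rel option_simpler_rel intro!: wf_lex_prod)

declare surreal_mult.simps [simp del]

instantiation surreal :: (type) "{power, inverse}"
begin

definition times_surreal :: "'a surreal \<Rightarrow> 'a surreal \<Rightarrow> 'a surreal" where
  "x * y = surreal_mult x y"
definition inverse_surreal :: "'a surreal \<Rightarrow> 'a surreal" where
  "inverse x = (if x = 0 then 0 else (THE y :: 'a surreal. x * y = 1))"
definition divide_surreal :: "'a surreal \<Rightarrow> 'a surreal \<Rightarrow> 'a surreal" where
  "x div y = x * inverse (y :: 'a surreal)"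

instance ..

end


section \<open>The real numbers inside the surreal numbers\<close>

text \<open>\<open>dyadic k m\<close> is the number \<open>m / 2 ^ k\<close>.\<close>

function dyadic :: "nat \<Rightarrow> int \<Rightarrow> 'a surreal" where
  "dyadic 0 m =
     (if m = 0 then 0
      else if m > 0 then simplest {dyadic 0 (m - 1)} {}
      else simplest {} {dyadic 0 (m + 1)})"
| "dyadic (Suc k) m =
     (if even m then dyadic k (m div 2)
      else simplest {dyadic k (m div 2)} {dyadic k (m div 2 + 1)})"
  by pat_completeness auto
termination
  by (relation "measures [\<lambda>(k, m). k, \<lambda>(k, m). nat \<bar>m\<bar>]") auto

declare dyadic.simps [simp del]

definition surreal_of_real :: "real \<Rightarrow> 'a surreal" where
  "surreal_of_real r = simplest
     {z. \<exists>k m. z = dyadic k m \<and> of_int m / 2 ^ k < r}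
     {z. \<exists>k m. z = dyadic k m \<and> r < of_int m / 2 ^ k}"


section \<open>The genetic functions\<close>

primrec maclaurin_sum :: "(real \<Rightarrow> real) \<Rightarrow> nat \<Rightarrow> 'a surreal \<Rightarrow> 'a surreal" where
  "maclaurin_sum f 0 z = 0"
| "maclaurin_sum f (Suc i) z =
     maclaurin_sum f i z + surreal_of_real ((deriv ^^ i) f 0 / fact i) * z ^ i"

text \<open>
  \<open>trunc f m z\<close> is \<open>[z]\<^sub>m\<close>, the sum of the terms of degree \<open>0, \<dots>, m\<close>.  The index is an integer
  because \<open>4 * n - 1\<close> occurs for \<open>n = 0\<close>, where the sum is empty.
\<close>

definition trunc :: "(real \<Rightarrow> real) \<Rightarrow> int \<Rightarrow> 'a surreal \<Rightarrow> 'a surreal" where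
  "trunc f m z = maclaurin_sum f (nat (m + 1)) z"

text \<open>
  An option of \<open>uarctan x\<close> coming from \<open>y\<close> is kept only if \<open>\<bar>(x - y) / (1 + x * y)\<bar> \<le> 1\<close>, and then
  only if its own value is at most \<open>\<pi> / 2\<close> in absolute value.  The second test applies to each
  option separately, not to all options from \<open>y\<close> at once: for \<open>x = \<omega>\<close> every \<open>y > 0\<close> produces right
  options above \<open>\<pi> / 2\<close>, while its left options are needed.
\<close>

function uarctan :: "'a surreal \<Rightarrow> 'a surreal" where
  "uarctan x = simplest
     ({surreal_of_real (- pi / 2)} \<union>
      {v. \<not> \<bar>v\<bar> > surreal_of_real (pi / 2) \<and>
          (\<exists>y\<in>left_opts x. \<not> \<bar>(x - y) / (1 + x * y)\<bar> > 1 \<and>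
             (\<exists>n::nat. v = uarctan y + trunc arctan (4 * int n - 1) ((x - y) / (1 + x * y))))} \<union>
      {v. \<not> \<bar>v\<bar> > surreal_of_real (pi / 2) \<and>
          (\<exists>y\<in>right_opts x. \<not> \<bar>(x - y) / (1 + x * y)\<bar> > 1 \<and>
             (\<exists>n::nat. v = uarctan y + trunc arctan (4 * int n + 1) ((x - y) / (1 + x * y))))})
     ({v. \<not> \<bar>v\<bar> > surreal_of_real (pi / 2) \<and>
          (\<exists>y\<in>right_opts x. \<not> \<bar>(x - y) / (1 + x * y)\<bar> > 1 \<and>
             (\<exists>n::nat. v = uarctan y - trunc arctan (4 * int n - 1) ((y - x) / (1 + x * y))))} \<union>
      {v. \<not> \<bar>v\<bar> > surreal_of_real (pi / 2) \<and>
          (\<exists>y\<in>left_opts x. \<not> \<bar>(x - y) / (1 + x * y)\<bar> > 1 \<and>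
             (\<exists>n::nat. v = uarctan y - trunc arctan (4 * int n + 1) ((y - x) / (1 + x * y))))} \<union>
      {surreal_of_real (pi / 2)})"
  by pat_completeness auto
termination
  by (relation simpler_rel) (auto simp: wf_simpler_rel option_simpler_rel)

declare uarctan.simps [simp del]

definition nlog :: "real \<Rightarrow> real" where
  "nlog x = - ln (1 - x)"

text \<open>The finite numbers \<open>x \<le> 0\<close>, that is, the interval \<open>(-\<infinity>, 0]\<close> with \<open>\<infinity>\<close> the gap above them.\<close>

definition nlog_domain :: "'a surreal set" where
  "nlog_domain = {x. x \<le> 0 \<and> (\<exists>n::nat. surreal_of_real (- real n) < x)}"

text \<open>
  The options coming from \<open>y\<close> are ignored if \<open>\<bar>(x - y) / (1 - y)\<bar> > 1\<close> or \<open>\<bar>(x - y) / (1 - x)\<bar> \<ge> 1\<close>.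
  The source has \<open>\<ge>\<close> in the first condition as well.  That discards the only option \<open>y = 0\<close> of
  \<open>x = -1 = { | 0}\<close>, hence gives \<open>-1\<close> the value \<open>{ | } = 0\<close> instead of \<open>nlog (-1) = - ln 2\<close>, and the
  error propagates to the numbers built from \<open>-1\<close>.  For \<open>x, y \<le> 0\<close> the two conditions differ only
  if \<open>(x - y) / (1 - y) = -1\<close>, where the Maclaurin series of \<open>nlog\<close> still converges.
\<close>

definition nlog_admissible :: "'a surreal \<Rightarrow> 'a surreal \<Rightarrow> bool" where
  "nlog_admissible x y \<longleftrightarrow>
     \<not> (\<bar>(x - y) / (1 - y)\<bar> > 1 \<or> \<bar>(x - y) / (1 - x)\<bar> \<ge> 1)"

function unlog :: "'a surreal \<Rightarrow> 'a surreal" where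
  "unlog x = (if x \<in> nlog_domain then simplest
     ({v. \<exists>y\<in>left_opts x. nlog_admissible x y \<and>
          (\<exists>n::nat. v = unlog y + trunc nlog (int n) ((x - y) / (1 - y)))} \<union>
      {v. \<exists>y\<in>right_opts x. nlog_admissible x y \<and>
          (\<exists>n::nat. v = unlog y + trunc nlog (2 * int n + 1) ((x - y) / (1 - y)))})
     ({v. \<exists>y\<in>right_opts x. nlog_admissible x y \<and>
          (\<exists>n::nat. v = unlog y - trunc nlog (int n) ((y - x) / (1 - x)))} \<union>
      {v. \<exists>y\<in>left_opts x. nlog_admissible x y \<and>
          (\<exists>n::nat. v = unlog y - trunc nlog (2 * int n + 1) ((y - x) / (1 - x)))})
   else undefined)"
  by pat_completeness auto
termination
  by (relation simpler_rel) (auto simp: wf_simpler_rel option_simpler_rel)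

declare unlog.simps [simp del]

end

theory Submission
  imports Defs
begin

text \<open>
  Options of real numbers are dyadic, so by induction along the simplicity order all the options in
  the recursion for \<open>uarctan\<close> or \<open>unlog\<close> at a real \<open>x\<close> are real, once the embedding of the reals is
  known to respect the field operations.  They lie strictly on the correct sides of the real value
  because the Maclaurin sums are strict bounds of alternating sign, and they converge to that value
  from both sides unless \<open>x = 0\<close>.  Hence no option of the value separates the two sets, and the value is
  the simplest number between them.

  Since \<open>inverse\<close> selects among all surreal numbers, its uniqueness needs the monotonicity of the
  general product, hence the ordered group of surreal numbers.
\<close>

text \<open>The options that a recursion produces need not be the canonical options of the real it
  should yield; it is enough that they dominate these (\<open>simplest_cofinal\<close>). Sums,
  products, \<open>arctan\<close> and \<open>nlog\<close> thus lead to the same question about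
  reals: is every option of the result dominated by one that the recursion produces? The answer
  splits in the same way each time. A non-dyadic real is approached by its options from both sides.
  A nonzero dyadic real with exponent \<open>k\<close> in lowest terms has only multiples of
  \<open>1 / 2 ^ k\<close> as options, and one of them at distance exactly \<open>1 / 2 ^ k\<close>.
  For sums and products this neighbour is just close enough; for the two functions the Maclaurin
  sums converge at it, and that makes up for the lack of nearby options. Moreover an option of a
  real never has the opposite sign. This keeps the addition theorem of \<open>arctan\<close> free of
  jumps by \<open>pi\<close>, and keeps the options of a nonpositive real nonpositive, so that the
  induction for \<open>unlog\<close> applies to them.\<close>

unbundle cardinal_syntax

section \<open>Sign expansions: initial segments and order\<close>

lemma sgn_at_range: "sgn_at x \<beta> = -1 \<or> sgn_at x \<beta> = 0 \<or> sgn_at x \<beta> = 1"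
  using sgn_at[of x] by (auto simp: image_subset_iff)

lemma sgn_at_eq_0_iff: "sgn_at x \<beta> = 0 \<longleftrightarrow> birthday x \<le> \<beta>"
proof -
  obtain \<alpha> where \<alpha>: "\<And>\<beta>. sgn_at x \<beta> \<noteq> 0 \<longleftrightarrow> \<beta> < \<alpha>"
    using sgn_at[of x] by auto
  then have "birthday x = \<alpha>"
    unfolding birthday_def by (intro Least_equality) (auto simp: not_less[symmetric])
  with \<alpha> show ?thesis by (auto simp: not_less[symmetric])
qed

lemma surreal_eqI: "(\<And>\<beta>. sgn_at x \<beta> = sgn_at y \<beta>) \<Longrightarrow> x = y"
  by (metis ext sgn_at_inject)

definition options :: "'a surreal \<Rightarrow> 'a surreal set" where
  "options x = {y. simpler y x}"

lemma options_Un: "options x = left_opts x \<union> right_opts x"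
proof -
  have "y \<noteq> x" if "simpler y x" for y
    using that by (auto simp: simpler_def)
  then show ?thesis
    by (auto simp: options_def left_opts_def right_opts_def neq_iff)
qed

lemma left_opts_iff: "y \<in> left_opts x \<longleftrightarrow> y \<in> options x \<and> y < x"
  and right_opts_iff: "y \<in> right_opts x \<longleftrightarrow> y \<in> options x \<and> x < y"
  by (simp_all add: left_opts_def right_opts_def options_def)

lemma options_iff:
  "y \<in> options x \<longleftrightarrow> birthday y < birthday x \<and> (\<forall>\<beta><birthday y. sgn_at y \<beta> = sgn_at x \<beta>)"
  by (simp add: options_def simpler_def)

lemma options_trans: "y \<in> options x \<Longrightarrow> z \<in> options y \<Longrightarrow> z \<in> options x"
  unfolding options_iff by (metis order.strict_trans)

text \<open>Both numbers are restrictions of the sign sequence of \<open>x\<close>, so the shorter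
  one is an initial segment of the longer one.\<close>

lemma options_linear:
  assumes "u \<in> options x" "w \<in> options x"
  shows "u = w \<or> u \<in> options w \<or> w \<in> options u"
proof (cases "birthday u" "birthday w" rule: linorder_cases)
  case equal
  then have "u = w"
    using assms by (intro surreal_eqI) (metis options_iff not_le sgn_at_eq_0_iff)
  then show ?thesis by simp
qed (use assms in \<open>auto simp: options_iff\<close>)

text \<open>The first place where \<open>d\<close> and an extension of it differ is
  \<open>birthday d\<close>, where \<open>d\<close> has the sign 0. So the comparison depends only
  on the sign of the extension there, and \<open>w\<close>, being longer than \<open>d\<close>,
  already shares that sign with \<open>z\<close>.\<close>

lemma options_less_cong:
  assumes "d \<in> options w" "w \<in> options z"
  shows "d < z \<longleftrightarrow> d < w"
proof -
  from assms have d: "birthday d < birthday w" "\<And>\<beta>. \<beta> < birthday d \<Longrightarrow> sgn_at d \<beta> = sgn_at w \<beta>"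
    and w: "\<And>\<beta>. \<beta> < birthday w \<Longrightarrow> sgn_at w \<beta> = sgn_at z \<beta>"
    by (auto simp: options_iff)
  have *: "d < v \<longleftrightarrow> 0 < sgn_at v (birthday d)"
    if v: "\<And>\<beta>. \<beta> < birthday d \<Longrightarrow> sgn_at d \<beta> = sgn_at v \<beta>" "sgn_at v (birthday d) \<noteq> 0" for v
  proof
    assume "d < v"
    then obtain \<alpha> where a: "\<forall>\<beta><\<alpha>. sgn_at d \<beta> = sgn_at v \<beta>" "sgn_at d \<alpha> < sgn_at v \<alpha>"
      by (auto simp: less_surreal_def)
    have "\<not> \<alpha> < birthday d" using a v(1) by force
    moreover have "\<not> birthday d < \<alpha>" using a v(2) sgn_at_eq_0_iff[of d "birthday d"] by force
    ultimately show "0 < sgn_at v (birthday d)"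
      using a sgn_at_eq_0_iff[of d "birthday d"] by force
  next
    assume "0 < sgn_at v (birthday d)"
    then show "d < v"
      unfolding less_surreal_def using v(1) sgn_at_eq_0_iff[of d "birthday d"]
      by (intro exI[of _ "birthday d"]) auto
  qed
  have "sgn_at w (birthday d) = sgn_at z (birthday d)" "sgn_at w (birthday d) \<noteq> 0"
    using d(1) w[of "birthday d"] by (auto simp: sgn_at_eq_0_iff simp flip: w)
  moreover have "\<And>\<beta>. \<beta> < birthday d \<Longrightarrow> sgn_at d \<beta> = sgn_at z \<beta>"
    using d w by force
  ultimately show ?thesis
    using *[of w] *[of z] d(2) by simp
qed

lemma options_less_cong':
  assumes "d \<in> options w" "w \<in> options z"
  shows "z < d \<longleftrightarrow> w < d"
proof -
  have "d \<noteq> z" "d \<noteq> w"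
    using assms options_trans[OF assms(2,1)] by (auto simp: options_iff)
  then show ?thesis
    using options_less_cong[OF assms] by (auto simp: neq_iff)
qed

text \<open>The third case is the longest common initial segment of \<open>x\<close> and \<open>y\<close>.\<close>

lemma less_cases [consumes 1, case_names left right mid]:
  assumes "x < y"
  obtains "x \<in> left_opts y" | "y \<in> right_opts x"
  | u where "u \<in> right_opts x" "u \<in> left_opts y" "x < u" "u < y"
proof -
  obtain \<alpha> where a: "\<And>\<beta>. \<beta> < \<alpha> \<Longrightarrow> sgn_at x \<beta> = sgn_at y \<beta>" "sgn_at x \<alpha> < sgn_at y \<alpha>"
    using assms by (auto simp: less_surreal_def)
  have z: "sgn_at v \<beta> = 0 \<longleftrightarrow> birthday v \<le> \<beta>" for v :: "'a surreal" and \<beta>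
    by (rule sgn_at_eq_0_iff)
  \<comment> \<open>At the first difference either one expansion has ended, and that number is an
    initial segment of the other, or the signs are -1 and 1, and the common part before it separates
    \<open>x\<close> from \<open>y\<close>.\<close>
  consider "sgn_at x \<alpha> = 0" | "sgn_at y \<alpha> = 0" | "sgn_at x \<alpha> = -1" "sgn_at y \<alpha> = 1"
    using sgn_at_range[of x \<alpha>] sgn_at_range[of y \<alpha>] a(2) by force
  then show thesis
  proof cases
    case 1
    then have "birthday x \<le> \<alpha>" "\<alpha> < birthday y"
      using a(2) by (auto simp: z not_le[symmetric] simp flip: z)
    then have "x \<in> options y"
      using a(1) by (auto simp: options_iff)
    then show thesis using assms that(1) by (auto simp: left_opts_iff)
  next
    case 2
    then have "birthday y \<le> \<alpha>" "\<alpha> < birthday x"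
      using a(2) by (auto simp: z not_le[symmetric] simp flip: z)
    then have "y \<in> options x"
      using a(1) by (auto simp: options_iff)
    then show thesis using assms that(2) by (auto simp: right_opts_iff)
  next
    case 3
    define u where "u = Abs_surreal (\<lambda>\<beta>. if \<beta> < \<alpha> then sgn_at x \<beta> else 0)"
    have ax: "\<alpha> < birthday x" and ay: "\<alpha> < birthday y"
      using 3 by (auto simp: not_le[symmetric] simp flip: z)
    have "(\<lambda>\<beta>. if \<beta> < \<alpha> then sgn_at x \<beta> else 0) \<in>
        {s. range s \<subseteq> {-1, 0, 1} \<and> (\<exists>\<alpha>. \<forall>\<beta>. s \<beta> \<noteq> 0 \<longleftrightarrow> \<beta> < \<alpha>)}"
      using sgn_at[of x] ax by (auto intro!: exI[of _ \<alpha>] simp: z image_subset_iff)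
    then have u: "sgn_at u \<beta> = (if \<beta> < \<alpha> then sgn_at x \<beta> else 0)" for \<beta>
      unfolding u_def by (simp add: Abs_surreal_inverse)
    have bu: "birthday u = \<alpha>"
    proof (rule antisym)
      show "birthday u \<le> \<alpha>" using u[of \<alpha>] by (simp flip: z)
      show "\<alpha> \<le> birthday u"
        using u[of "birthday u"] ax z[of u "birthday u"] z[of x "birthday u"]
        by (metis leI order.refl order.strict_trans2 order_less_imp_not_less)
    qed
    have "x < u" "u < y"
      unfolding less_surreal_def using 3 u a(1) by (auto intro!: exI[of _ \<alpha>])
    moreover have "u \<in> options x" "u \<in> options y"
      using bu ax ay u a(1) by (auto simp: options_iff)
    ultimately show thesis using that(3) by (auto simp: left_opts_iff right_opts_iff)
  qed
qed

lemma options_wf_induct [case_names less]: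
  assumes "\<And>x. (\<And>y. y \<in> options x \<Longrightarrow> P y) \<Longrightarrow> P x"
  shows "P x"
  using wf_simpler_rel
  by (induction x rule: wf_induct_rule) (use assms in \<open>auto simp: simpler_rel_def options_def\<close>)


section \<open>The simplest number between two sets\<close>

lemma between_convex:
  "z \<in> strictly_between L R \<Longrightarrow> w \<in> strictly_between L R \<Longrightarrow> z \<le> u \<Longrightarrow> u \<le> w \<Longrightarrow>
    u \<in> strictly_between L R"
  unfolding strictly_between_def by fastforce

text \<open>If neither of two numbers is an initial segment of the other, their common initial
  segment lies between them, hence in the convex set. As no option of \<open>z\<close> lies in this
  set, only the case that \<open>z\<close> is an initial segment of \<open>w\<close> remains. So
  \<open>z\<close> is the unique element of least birthday.\<close>

lemma simpler_if_between:
  assumes z: "z \<in> strictly_between L R" and no: "options z \<inter> strictly_between L R = {}"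
    and w: "w \<in> strictly_between L R" "w \<noteq> z"
  shows "z \<in> options w"
proof (cases "z < w")
  case True
  then show ?thesis
  proof (cases rule: less_cases)
    case (mid u)
    then show ?thesis using between_convex[OF z w(1), of u] no by (auto simp: right_opts_iff)
  qed (use no w in \<open>auto simp: left_opts_iff right_opts_iff\<close>)
next
  case False
  then have "w < z" using w by auto
  then show ?thesis
  proof (cases rule: less_cases)
    case (mid u)
    then show ?thesis using between_convex[OF w(1) z, of u] no by (auto simp: left_opts_iff)
  qed (use no w in \<open>auto simp: left_opts_iff right_opts_iff\<close>)
qed

text \<open>Minimality has to be tested only against the options of \<open>z\<close>. Cuts are
  identified with known numbers through this criterion.\<close>

lemma simplestI:
  assumes z: "z \<in> strictly_between L R" and no: "options z \<inter> strictly_between L R = {}"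
  shows "simplest L R = z"
  unfolding simplest_def
proof (rule the_equality)
  show "z \<in> strictly_between L R \<and> (\<forall>w\<in>strictly_between L R. birthday z \<le> birthday w)"
    using z simpler_if_between[OF z no] by (force simp: options_iff)
  show "w = z" if "w \<in> strictly_between L R \<and> (\<forall>v\<in>strictly_between L R. birthday w \<le> birthday v)" for w
    using that z simpler_if_between[OF z no, of w] by (force simp: options_iff)
qed

section \<open>Small sets and the existence of a number in a cut\<close>

definition small :: "'a surreal set \<Rightarrow> bool" where
  "small A \<longleftrightarrow> |A| \<le>o |UNIV :: 'a set|"

lemma small_countable: "countable A \<Longrightarrow> small (A :: 'a::infinite surreal set)"
  unfolding small_def countable_def
  by (metis card_of_ordLeqI infinite_UNIV infinite_iff_card_of_nat ordLeq_transitive UNIV_I)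

lemma small_Un: "small A \<Longrightarrow> small B \<Longrightarrow> small (A \<union> B :: 'a::infinite surreal set)"
  unfolding small_def
  by (rule card_of_Un_ordLeq_infinite_Field) (auto simp: infinite_UNIV card_of_card_order_on Field_card_of)

lemma small_image: "small A \<Longrightarrow> small (f ` A)" for A :: "'a surreal set" and f :: "'a surreal \<Rightarrow> 'a surreal"
  unfolding small_def by (rule ordLeq_transitive[OF card_of_image])

lemma small_subset: "small A \<Longrightarrow> B \<subseteq> A \<Longrightarrow> small B"
  unfolding small_def by (rule ordLeq_transitive[OF card_of_mono1])

lemma small_UN:
  fixes B :: "'a surreal \<Rightarrow> 'a::infinite surreal set"
  shows "small A \<Longrightarrow> (\<And>a. a \<in> A \<Longrightarrow> small (B a)) \<Longrightarrow> small (\<Union>a\<in>A. B a)"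
  unfolding small_def by (intro card_of_UNION_ordLeq_infinite) (auto simp: infinite_UNIV)

text \<open>A proper initial segment of a cardinal order has strictly smaller cardinality, and what
  is smaller than the successor cardinal of \<open>'a\<close> is at most \<open>'a\<close>.\<close>

lemma card_lessThan_suc: "|{..<\<beta>}| \<le>o |UNIV :: 'a set|" for \<beta> :: "'a suc"
proof -
  let ?r = "card_of (UNIV :: 'a set)"
  have r: "card_order ?r" by (rule card_of_card_order_on)
  have "Order_Relation.underS (card_suc ?r) \<beta> = {..<\<beta>}"
    by (auto simp: Order_Relation.underS_def less_suc_def less_eq_suc_def)
  moreover have "\<beta> \<in> Field (card_suc ?r)"
    by (simp add: Field_card_suc)
  ultimately have "|{..<\<beta>}| <o card_suc ?r"
    using card_of_underS[OF Card_order_card_suc[OF r]] by metis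
  then show ?thesis
    by (rule card_suc_ordLess_imp_ordLeq[rotated -1]) (auto simp: r card_of_Card_order)
qed

text \<open>The options of \<open>x\<close> form a chain of initial segments, so their birthdays
  determine them.\<close>

lemma small_opts: "small (options (x :: 'a surreal))"
proof -
  have "inj_on birthday (options x)"
    by (intro inj_onI) (metis options_iff options_linear less_irrefl)
  moreover have "birthday ` options x \<subseteq> {..<birthday x}"
    by (auto simp: options_iff)
  ultimately have "|options x| \<le>o |{..<birthday x}|"
    by (meson card_of_ordLeqI image_subset_iff)
  then show ?thesis
    unfolding small_def using card_lessThan_suc ordLeq_transitive by blast
qed

lemma small_left_opts: "small (left_opts x)" and small_right_opts: "small (right_opts x)"
  by (rule small_subset[OF small_opts], auto simp: options_Un)+

text \<open>Regularity of the successor cardinal: otherwise \<open>'a suc\<close> would be a union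
  of at most \<open>|'a|\<close> sets of at most \<open>|'a|\<close> elements each, hence no larger
  than \<open>'a\<close>.\<close>

lemma small_bounded:
  fixes A :: "'a::infinite surreal set"
  assumes "small A"
  shows "\<exists>\<gamma>. \<forall>a\<in>A. birthday a < \<gamma>"
proof (rule ccontr)
  assume "\<not> ?thesis"
  then have "(\<Union>a\<in>A. {..<birthday a} \<union> {birthday a}) = UNIV"
    by (auto simp: not_less) (metis order_le_less)
  moreover have "|{..<birthday a} \<union> {birthday a}| \<le>o |UNIV :: 'a set|" for a :: "'a surreal"
    using card_lessThan_suc[of "birthday a"]
    by (intro card_of_Un_ordLeq_infinite_Field)
      (auto simp: infinite_UNIV card_of_singl_ordLeq card_of_card_order_on Field_card_of)
  ultimately have "|UNIV :: 'a suc set| \<le>o |UNIV :: 'a set|"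
    using card_of_UNION_ordLeq_infinite[of "UNIV :: 'a set" A "\<lambda>a. {..<birthday a} \<union> {birthday a}"]
      assms infinite_UNIV by (auto simp: small_def)
  moreover have "|UNIV :: 'a set| <o |UNIV :: 'a suc set|"
  proof -
    have r: "card_order |UNIV :: 'a set|" by (rule card_of_card_order_on)
    have "|UNIV :: 'a suc set| =o card_suc |UNIV :: 'a set|"
      using card_of_unique[OF card_order_card_suc[OF r]] ordIso_symmetric by blast
    then show ?thesis
      using card_suc_greater[OF r] ordIso_symmetric ordLess_ordIso_trans by blast
  qed
  ultimately show False
    using not_ordLess_ordLeq by blast
qed

text \<open>
  The sign expansion of \<open>{L | R}\<close>: as long as the initial segment built so far is not yet strictly
  between \<open>L\<close> and \<open>R\<close>, it is moved up if some left option is too large, down if some right option is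
  too small.
\<close>

function cut_sign :: "'a surreal set \<Rightarrow> 'a surreal set \<Rightarrow> 'a suc \<Rightarrow> int" where
  "cut_sign L R \<beta> =
    (if \<exists>l\<in>L. (\<forall>\<gamma>\<in>{..<\<beta>}. sgn_at l \<gamma> = cut_sign L R \<gamma>) \<and> sgn_at l \<beta> \<ge> 0 then 1
     else if \<exists>r\<in>R. (\<forall>\<gamma>\<in>{..<\<beta>}. sgn_at r \<gamma> = cut_sign L R \<gamma>) \<and> sgn_at r \<beta> \<le> 0 then -1
     else 0)"
  by pat_completeness auto
termination
  by (relation "inv_image {(a, b). a < b} (\<lambda>(_, _, \<beta>). \<beta>)") (auto intro: wf)

declare cut_sign.simps [simp del]

text \<open>\<open>cut_sign\<close> never follows an element of \<open>L\<close> or \<open>R\<close>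
  to its end without going on, so it differs from each of them somewhere. At the first such place
  its rule puts the expansion on the correct side.\<close>

lemma between_nonempty:
  fixes L R :: "'a::infinite surreal set"
  assumes LR: "\<And>l r. l \<in> L \<Longrightarrow> r \<in> R \<Longrightarrow> l < r" and small: "small L" "small R"
  shows "strictly_between L R \<noteq> {}"
proof -
  let ?s = "cut_sign L R"
  have s1: "?s \<beta> = 1" if "l \<in> L" "\<And>\<gamma>. \<gamma> < \<beta> \<Longrightarrow> sgn_at l \<gamma> = ?s \<gamma>" "sgn_at l \<beta> \<ge> 0" for l \<beta>
    using that by (subst cut_sign.simps) auto
  have s2: "?s \<beta> \<noteq> 0" if "r \<in> R" "\<And>\<gamma>. \<gamma> < \<beta> \<Longrightarrow> sgn_at r \<gamma> = ?s \<gamma>" "sgn_at r \<beta> \<le> 0" for r \<beta>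
    using that by (subst cut_sign.simps) auto
  have wit: "(\<exists>v\<in>L \<union> R. (\<forall>\<gamma><\<beta>. sgn_at v \<gamma> = ?s \<gamma>))" if "?s \<beta> \<noteq> 0" for \<beta>
    using that by (subst (asm) cut_sign.simps) (auto split: if_splits)
  have pos: "\<exists>l\<in>L. (\<forall>\<gamma><\<beta>. sgn_at l \<gamma> = ?s \<gamma>) \<and> sgn_at l \<beta> \<ge> 0" if "?s \<beta> = 1" for \<beta>
    using that by (subst (asm) cut_sign.simps) (auto split: if_splits)
  \<comment> \<open>Where a \<open>v\<close> followed so far ends, its sign 0 meets one of the two
    tests in the rule, so the expansion continues past the end of \<open>v\<close>.\<close>
  have agree0: "?s \<gamma> \<noteq> 0" if "v \<in> L \<union> R" "\<And>\<delta>. \<delta> < \<gamma> \<Longrightarrow> sgn_at v \<delta> = ?s \<delta>" "sgn_at v \<gamma> = 0" for v \<gamma>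
    using that s1[of v \<gamma>] s2[of v \<gamma>] by auto
  have down: "?s \<gamma> \<noteq> 0" if "\<gamma> < \<beta>" "?s \<beta> \<noteq> 0" for \<gamma> \<beta>
  proof
    assume 0: "?s \<gamma> = 0"
    obtain v where v: "v \<in> L \<union> R" "\<And>\<delta>. \<delta> < \<beta> \<Longrightarrow> sgn_at v \<delta> = ?s \<delta>"
      using wit[OF \<open>?s \<beta> \<noteq> 0\<close>] by blast
    have "?s \<gamma> \<noteq> 0"
      using v 0 that(1) by (intro agree0[OF v(1)]) (auto intro: v(2) order.strict_trans)
    with 0 show False by simp
  qed
  \<comment> \<open>This \<open>\<gamma>\<close> exceeds all birthdays. An element followed up to
    \<open>\<gamma>\<close> would have ended before, at a place where the expansion is nonzero.
    Hence the expansion stops, as membership in the type requires.\<close>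
  obtain \<gamma> where g: "\<And>v. v \<in> L \<union> R \<Longrightarrow> birthday v < \<gamma>"
    using small_bounded[OF small_Un[OF small]] by blast
  have "?s \<gamma> = 0"
  proof (rule ccontr)
    assume "?s \<gamma> \<noteq> 0"
    then obtain v where v: "v \<in> L \<union> R" "\<And>\<delta>. \<delta> < \<gamma> \<Longrightarrow> sgn_at v \<delta> = ?s \<delta>"
      using wit by blast
    have "sgn_at v (birthday v) = 0"
      by (simp add: sgn_at_eq_0_iff)
    then have "?s (birthday v) \<noteq> 0"
      using g[OF v(1)] by (intro agree0[OF v(1)]) (auto intro: v(2) order.strict_trans)
    then show False using v(2)[OF g[OF v(1)]] sgn_at_eq_0_iff[of v "birthday v"] by auto
  qed
  then have "?s (LEAST \<delta>. ?s \<delta> = 0) = 0"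
    by (rule LeastI)
  then have "?s \<beta> \<noteq> 0 \<longleftrightarrow> \<beta> < (LEAST \<delta>. ?s \<delta> = 0)" for \<beta>
    using down[of "LEAST \<delta>. ?s \<delta> = 0" \<beta>] not_less_Least[of \<beta> "\<lambda>\<delta>. ?s \<delta> = 0"]
    by (cases "\<beta>" "LEAST \<delta>. ?s \<delta> = 0" rule: linorder_cases) auto
  moreover have "range ?s \<subseteq> {-1, 0, 1}"
    by (intro image_subsetI, subst cut_sign.simps) auto
  ultimately have "?s \<in> {s. range s \<subseteq> {-1, 0, 1} \<and> (\<exists>\<alpha>. \<forall>\<beta>. s \<beta> \<noteq> 0 \<longleftrightarrow> \<beta> < \<alpha>)}"
    by blast
  then have z: "sgn_at (Abs_surreal ?s) \<beta> = ?s \<beta>" for \<beta>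
    by (simp add: Abs_surreal_inverse)
  let ?z = "Abs_surreal ?s"
  have diff: "\<exists>\<alpha>. (\<forall>\<beta><\<alpha>. sgn_at v \<beta> = ?s \<beta>) \<and> sgn_at v \<alpha> \<noteq> ?s \<alpha>" if v: "v \<in> L \<union> R" for v
  proof -
    have "sgn_at v (birthday v) = 0"
      by (simp add: sgn_at_eq_0_iff)
    then have "\<exists>\<alpha>. sgn_at v \<alpha> \<noteq> ?s \<alpha>"
      using agree0[OF v, of "birthday v"] by metis
    then show ?thesis
      by (intro exI[of _ "LEAST \<alpha>. sgn_at v \<alpha> \<noteq> ?s \<alpha>"])
         (metis (mono_tags, lifting) LeastI not_less_Least)
  qed
  have "l < ?z" if l: "l \<in> L" for l
  proof -
    obtain \<alpha> where a: "\<And>\<beta>. \<beta> < \<alpha> \<Longrightarrow> sgn_at l \<beta> = ?s \<beta>" "sgn_at l \<alpha> \<noteq> ?s \<alpha>"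
      using diff[of l] l by auto
    have "?s \<alpha> = 1" if "sgn_at l \<alpha> \<ge> 0"
      using s1[OF l _ that] a(1) by blast
    then have "sgn_at l \<alpha> < ?s \<alpha>"
      using a(2) sgn_at_range[of l \<alpha>] sgn_at_range[of ?z \<alpha>, unfolded z] by linarith
    with a(1) show ?thesis unfolding less_surreal_def z by blast
  qed
  moreover have "?z < r" if r: "r \<in> R" for r
  proof -
    obtain \<alpha> where a: "\<And>\<beta>. \<beta> < \<alpha> \<Longrightarrow> sgn_at r \<beta> = ?s \<beta>" "sgn_at r \<alpha> \<noteq> ?s \<alpha>"
      using diff[of r] r by auto
    \<comment> \<open>The test for \<open>L\<close> comes first, so \<open>r\<close> could be passed
      over in favour of some \<open>l\<close> that agrees with the expansion, hence with
      \<open>r\<close>, below \<open>\<alpha>\<close>. Then \<open>l\<close> and \<open>r\<close>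
      first differ beyond \<open>\<alpha>\<close>, yet both have the sign 0 at
      \<open>\<alpha>\<close>.\<close>
    have "?s \<alpha> \<noteq> 1"
    proof
      assume "?s \<alpha> = 1"
      then obtain l where l: "l \<in> L" "\<And>\<beta>. \<beta> < \<alpha> \<Longrightarrow> sgn_at l \<beta> = ?s \<beta>" "sgn_at l \<alpha> \<ge> 0"
        using pos by blast
      obtain \<delta> where d: "\<And>\<beta>. \<beta> < \<delta> \<Longrightarrow> sgn_at l \<beta> = sgn_at r \<beta>" "sgn_at l \<delta> < sgn_at r \<delta>"
        using LR[OF l(1) r] by (auto simp: less_surreal_def)
      have "\<not> \<delta> < \<alpha>" using d(2) l(2) a(1) by force
      moreover have "\<not> \<delta> = \<alpha>"
        using d(2) l(3) a(2) \<open>?s \<alpha> = 1\<close> sgn_at_range[of r \<alpha>] by force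
      ultimately have "\<alpha> < \<delta>" by simp
      then have "sgn_at r \<alpha> = 0" "sgn_at l \<alpha> = 0"
        using d(1) l(3) a(2) \<open>?s \<alpha> = 1\<close> sgn_at_range[of r \<alpha>] by force+
      then have "sgn_at r \<delta> = 0" "sgn_at l \<delta> = 0"
        using \<open>\<alpha> < \<delta>\<close> by (auto simp: sgn_at_eq_0_iff)
      with d(2) show False by simp
    qed
    moreover have "?s \<alpha> \<noteq> 0" if "sgn_at r \<alpha> \<le> 0"
      using s2[OF r _ that] a(1) by blast
    ultimately have "?s \<alpha> < sgn_at r \<alpha>"
      using a(2) sgn_at_range[of r \<alpha>] sgn_at_range[of ?z \<alpha>, unfolded z] by linarith
    with a(1) show ?thesis unfolding less_surreal_def z by metis
  qed
  ultimately have "?z \<in> strictly_between L R"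
    by (simp add: strictly_between_def)
  then show ?thesis by blast
qed

lemma simplestD:
  fixes L R :: "'a::infinite surreal set"
  assumes "\<And>l r. l \<in> L \<Longrightarrow> r \<in> R \<Longrightarrow> l < r" "small L" "small R"
  shows "simplest L R \<in> strictly_between L R" "options (simplest L R) \<inter> strictly_between L R = {}"
proof -
  obtain w where "w \<in> strictly_between L R"
    using between_nonempty[OF assms] by blast
  then obtain z where "z \<in> strictly_between L R" "\<And>y. y \<in> options z \<Longrightarrow> y \<notin> strictly_between L R"
    using wfE_min[OF wf_simpler_rel, of w "strictly_between L R"]
    by (auto simp: simpler_rel_def options_def)
  moreover from this have "simplest L R = z"
    by (intro simplestI) auto
  ultimately show "simplest L R \<in> strictly_between L R" "options (simplest L R) \<inter> strictly_between L R = {}"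
    by auto
qed

text \<open>Conway's cofinality principle: an option of \<open>x\<close> that is dominated from
  \<open>L\<close> or \<open>R\<close> is not strictly between them, so no number simpler than
  \<open>x\<close> competes with it.\<close>

lemma simplest_cofinal:
  assumes "\<And>l. l \<in> L \<Longrightarrow> l < x" "\<And>r. r \<in> R \<Longrightarrow> x < r"
    and "\<And>y. y \<in> left_opts x \<Longrightarrow> \<exists>l\<in>L. y \<le> l" "\<And>y. y \<in> right_opts x \<Longrightarrow> \<exists>r\<in>R. r \<le> y"
  shows "simplest L R = x"
proof (rule simplestI)
  show "x \<in> strictly_between L R" using assms(1,2) by (auto simp: strictly_between_def)
  show "options x \<inter> strictly_between L R = {}"
    using assms(3,4) unfolding options_Un strictly_between_def
    by (auto simp: not_le[symmetric])
qed

lemma simplest_opts: "simplest (left_opts x) (right_opts x) = x"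
  by (rule simplest_cofinal) (auto simp: left_opts_iff right_opts_iff)

section \<open>Addition\<close>

lemma add_rec:
  "x + y = simplest ((\<lambda>l. l + y) ` left_opts x \<union> (\<lambda>l. x + l) ` left_opts y)
     ((\<lambda>r. r + y) ` right_opts x \<union> (\<lambda>r. x + r) ` right_opts y)" for x y :: "'a surreal"
  unfolding plus_surreal_def
  by (subst surreal_add.simps) (auto simp: image_def intro!: arg_cong2[where f = simplest])

lemma uminus_rec: "- x = simplest (uminus ` right_opts x) (uminus ` left_opts x)" for x :: "'a surreal"
  unfolding uminus_surreal_def
  by (subst surreal_minus.simps) (auto simp: image_def intro!: arg_cong2[where f = simplest])

lemma opts_simpler_rel:
  "l \<in> left_opts x \<Longrightarrow> (l, x) \<in> simpler_rel" "r \<in> right_opts x \<Longrightarrow> (r, x) \<in> simpler_rel"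
  "y \<in> options x \<Longrightarrow> (y, x) \<in> simpler_rel"
  by (auto simp: left_opts_def right_opts_def options_def simpler_rel_def)

text \<open>Both are initial segments of \<open>x\<close>, hence comparable. An inequality between a
  left and a right option thereby becomes an instance of the induction hypothesis at the longer of
  the two.\<close>

lemma left_right_opts:
  assumes "l \<in> left_opts x" "r \<in> right_opts x"
  shows "l \<in> left_opts r \<or> r \<in> right_opts l"
  using assms options_linear[of l x r] by (fastforce simp: left_opts_iff right_opts_iff)

text \<open>Well-definedness and monotonicity are proved together: the sum lies between its defining
  sets once these are separated, and their separation is monotonicity at simpler pairs.\<close>

lemma add_between:
  fixes x y :: "'a::infinite surreal"
  shows "(\<forall>l\<in>left_opts x. l + y < x + y) \<and> (\<forall>l\<in>left_opts y. x + l < x + y) \<and>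
         (\<forall>r\<in>right_opts x. x + y < r + y) \<and> (\<forall>r\<in>right_opts y. x + y < x + r)"
proof -
  have "wf (simpler_rel <*lex*> simpler_rel :: (('a surreal \<times> 'a surreal) \<times> _) set)"
    by (intro wf_lex_prod wf_simpler_rel)
  then show ?thesis
  proof (induction "(x, y)" arbitrary: x y rule: wf_induct_rule)
    case less
    \<comment> \<open>Options coming from different summands are compared through a third sum:
      \<open>l + y < l + y' < x + y'\<close> for a right option \<open>y'\<close>, and
      \<open>x + y' < r + y' < r + y\<close> for a left option \<open>y'\<close>.\<close>
    have R1: "\<And>l y'. l \<in> left_opts x \<Longrightarrow> y' \<in> right_opts y \<Longrightarrow> l + y < l + y'"
      and L2: "\<And>r y'. r \<in> right_opts x \<Longrightarrow> y' \<in> left_opts y \<Longrightarrow> r + y' < r + y"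
      and R3: "\<And>y' l. l \<in> left_opts x \<Longrightarrow> y' \<in> right_opts y \<Longrightarrow> l + y' < x + y'"
      and R4: "\<And>y' r. r \<in> right_opts x \<Longrightarrow> y' \<in> left_opts y \<Longrightarrow> x + y' < r + y'"
      using less by (force simp: opts_simpler_rel)+
    have LR: "l + y < r + y" if "l \<in> left_opts x" "r \<in> right_opts x" for l r
      using left_right_opts[OF that] that less by (force simp: opts_simpler_rel)
    have LR': "x + l < x + r" if "l \<in> left_opts y" "r \<in> right_opts y" for l r
      using left_right_opts[OF that] that less by (force simp: opts_simpler_rel)
    let ?L = "(\<lambda>l. l + y) ` left_opts x \<union> (\<lambda>l. x + l) ` left_opts y"
    let ?R = "(\<lambda>r. r + y) ` right_opts x \<union> (\<lambda>r. x + r) ` right_opts y"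
    have "x + y \<in> strictly_between ?L ?R"
      unfolding add_rec[of x y]
    proof (rule simplestD)
      show "a < b" if "a \<in> ?L" "b \<in> ?R" for a b
        using that LR LR' order.strict_trans[OF R1 R3] order.strict_trans[OF R4 L2] by blast
    qed (intro small_Un small_image small_left_opts small_right_opts)+
    then show ?case by (auto simp: strictly_between_def)
  qed
qed

text \<open>Any \<open>y < z\<close> are linked by at most two option steps, through their common
  initial segment.\<close>

lemma add_strict_mono_surreal:
  fixes x y z :: "'a::infinite surreal"
  assumes "y < z"
  shows "x + y < x + z" "y + x < z + x"
  using assms add_between[of x] add_between[of _ x]
  by (cases rule: less_cases; meson order.strict_trans)+

lemma add_commute_surreal: "x + y = y + x" for x y :: "'a surreal"
proof -
  have "wf (simpler_rel <*lex*> simpler_rel :: (('a surreal \<times> 'a surreal) \<times> _) set)"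
    by (intro wf_lex_prod wf_simpler_rel)
  then show ?thesis
  proof (induction "(x, y)" arbitrary: x y rule: wf_induct_rule)
    case less
    have "\<And>u. u \<in> left_opts x \<union> right_opts x \<Longrightarrow> u + y = y + u"
      "\<And>u. u \<in> left_opts y \<union> right_opts y \<Longrightarrow> x + u = u + x"
      by (rule less, auto simp: opts_simpler_rel)+
    then show ?case
      unfolding add_rec[of x y] add_rec[of y x]
      by (simp add: image_Un Un_commute cong: image_cong)
  qed
qed

lemma options_0 [simp]: "options (0 :: 'a::infinite surreal) = {}"
proof -
  have "small ({} :: 'a surreal set)" by (rule small_countable) simp
  then show ?thesis
    unfolding zero_surreal_def using simplestD(2)[of "{}" "{}"] by (auto simp: strictly_between_def)
qed

lemma opts_0 [simp]: "left_opts (0 :: 'a::infinite surreal) = {}" "right_opts (0 :: 'a::infinite surreal) = {}"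
  using options_0 by (auto simp: options_Un)

lemma add_0_surreal: "x + 0 = x" for x :: "'a::infinite surreal"
proof (induction x rule: options_wf_induct)
  case (less x)
  then have "\<And>y. y \<in> left_opts x \<union> right_opts x \<Longrightarrow> y + 0 = y"
    by (simp add: options_Un)
  then show ?case
    by (subst add_rec) (simp add: simplest_opts cong: image_cong)
qed

lemma uminus_between:
  fixes x :: "'a::infinite surreal"
  shows "(\<forall>r\<in>right_opts x. - r < - x) \<and> (\<forall>l\<in>left_opts x. - x < - l)"
proof (induction x rule: options_wf_induct)
  case (less x)
  have "- x \<in> strictly_between (uminus ` right_opts x) (uminus ` left_opts x)"
    unfolding uminus_rec[of x]
  proof (rule simplestD)
    show "a < b" if "a \<in> uminus ` right_opts x" "b \<in> uminus ` left_opts x" for a b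
      using that left_right_opts less by (fastforce simp: options_Un)
  qed (intro small_image small_left_opts small_right_opts)+
  then show ?case by (auto simp: strictly_between_def)
qed

text \<open>A left option above all of \<open>A\<close> would itself be strictly between
  \<open>A\<close> and \<open>B\<close>, against the minimality of the cut.\<close>

lemma cofinal_simplest:
  fixes A B :: "'a::infinite surreal set"
  assumes "\<forall>l\<in>A. \<forall>r\<in>B. l < r" "small A" "small B"
  shows "l \<in> left_opts (simplest A B) \<Longrightarrow> \<exists>a\<in>A. l \<le> a"
    and "r \<in> right_opts (simplest A B) \<Longrightarrow> \<exists>b\<in>B. b \<le> r"
proof -
  have "simplest A B \<in> strictly_between A B" "options (simplest A B) \<inter> strictly_between A B = {}"
    using assms by (intro simplestD; blast)+
  then show "l \<in> left_opts (simplest A B) \<Longrightarrow> \<exists>a\<in>A. l \<le> a"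
    and "r \<in> right_opts (simplest A B) \<Longrightarrow> \<exists>b\<in>B. b \<le> r"
    using order.strict_trans
    by (fastforce simp: strictly_between_def left_opts_iff right_opts_iff not_le[symmetric])+
qed

text \<open>Uniformity of addition: the recursion may use any representation of \<open>y\<close>,
  since \<open>A\<close> and \<open>B\<close> dominate the canonical options and addition is
  monotone. Sums and negatives come with such representations, not with their canonical
  options.\<close>

lemma add_simplest:
  fixes A B :: "'a::infinite surreal set"
  assumes AB: "\<forall>l\<in>A. \<forall>r\<in>B. l < r" "small A" "small B" and y: "y = simplest A B"
  shows "x + y = simplest ((\<lambda>l. l + y) ` left_opts x \<union> (\<lambda>a. x + a) ` A)
     ((\<lambda>r. r + y) ` right_opts x \<union> (\<lambda>b. x + b) ` B)"
proof (rule simplestI[symmetric])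
  let ?L = "(\<lambda>l. l + y) ` left_opts x \<union> (\<lambda>a. x + a) ` A"
  let ?R = "(\<lambda>r. r + y) ` right_opts x \<union> (\<lambda>b. x + b) ` B"
  let ?L' = "(\<lambda>l. l + y) ` left_opts x \<union> (\<lambda>l. x + l) ` left_opts y"
  let ?R' = "(\<lambda>r. r + y) ` right_opts x \<union> (\<lambda>r. x + r) ` right_opts y"
  have btw: "y \<in> strictly_between A B"
    unfolding y by (rule simplestD) (use AB in blast)+
  then show "x + y \<in> strictly_between ?L ?R"
    by (auto simp: strictly_between_def left_opts_iff right_opts_iff intro: add_strict_mono_surreal)
  have "strictly_between ?L ?R \<subseteq> strictly_between ?L' ?R'"
  proof
    fix w assume w: "w \<in> strictly_between ?L ?R"
    have "x + l < w" if l: "l \<in> left_opts y" for l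
    proof -
      obtain a where "a \<in> A" "l \<le> a" using cofinal_simplest(1)[OF AB] l y by blast
      then have "x + l \<le> x + a" "x + a < w"
        using w add_strict_mono_surreal(1)[of l a x] by (auto simp: le_less strictly_between_def)
      then show ?thesis by simp
    qed
    moreover have "w < x + r" if r: "r \<in> right_opts y" for r
    proof -
      obtain b where "b \<in> B" "b \<le> r" using cofinal_simplest(2)[OF AB] r y by blast
      then have "x + b \<le> x + r" "w < x + b"
        using w add_strict_mono_surreal(1)[of b r x] by (auto simp: le_less strictly_between_def)
      then show ?thesis by simp
    qed
    ultimately show "w \<in> strictly_between ?L' ?R'"
      using w by (auto simp: strictly_between_def)
  qed
  moreover have "options (x + y) \<inter> strictly_between ?L' ?R' = {}"
    unfolding add_rec[of x y]
  proof (rule simplestD)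
    show "a < b" if "a \<in> ?L'" "b \<in> ?R'" for a b
    proof -
      have "a < x + y" "x + y < b"
        using that add_between[of x y] by auto
      then show ?thesis by simp
    qed
  qed (intro small_Un small_image small_left_opts small_right_opts)+
  ultimately show "options (x + y) \<inter> strictly_between ?L ?R = {}"
    by blast
qed

lemma uminus_sets_less:
  fixes x :: "'a::infinite surreal"
  shows "\<forall>a\<in>uminus ` right_opts x. \<forall>b\<in>uminus ` left_opts x. a < b"
  using uminus_between[of x] by (auto intro: order.strict_trans)

lemma add_uminus_surreal: "x + - x = 0" for x :: "'a::infinite surreal"
proof (induction x rule: options_wf_induct)
  case (less x)
  have "x + - x = simplest ((\<lambda>l. l + - x) ` left_opts x \<union> (\<lambda>a. x + a) ` uminus ` right_opts x)
     ((\<lambda>r. r + - x) ` right_opts x \<union> (\<lambda>b. x + b) ` uminus ` left_opts x)"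
    by (rule add_simplest[OF uminus_sets_less])
       (intro small_image small_left_opts small_right_opts uminus_rec | assumption)+
  \<comment> \<open>As 0 has no options, it only has to lie in the cut. That follows from
    \<open>y + - y = 0\<close> for the options \<open>y\<close> and strict monotonicity.\<close>
  also have "\<dots> = 0"
  proof (rule simplestI)
    have 0: "y + - y = 0" if "y \<in> left_opts x \<union> right_opts x" for y
      using less that by (simp add: options_Un)
    have "l + - x < 0" if "l \<in> left_opts x" for l
      using add_strict_mono_surreal(1)[of "- x" "- l" l] uminus_between[of x] 0[of l] that by simp
    moreover have "x + - r < 0" if "r \<in> right_opts x" for r
      using add_strict_mono_surreal(2)[of x r "- r"] 0[of r] that by (simp add: right_opts_iff)
    moreover have "0 < r + - x" if "r \<in> right_opts x" for r
      using add_strict_mono_surreal(1)[of "- r" "- x" r] uminus_between[of x] 0[of r] that by simp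
    moreover have "0 < x + - l" if "l \<in> left_opts x" for l
      using add_strict_mono_surreal(2)[of l x "- l"] 0[of l] that by (simp add: left_opts_iff)
    ultimately show "0 \<in> strictly_between ((\<lambda>l. l + - x) ` left_opts x \<union> (\<lambda>a. x + a) ` uminus ` right_opts x)
        ((\<lambda>r. r + - x) ` right_opts x \<union> (\<lambda>b. x + b) ` uminus ` left_opts x)"
      by (auto simp: strictly_between_def)
  qed simp
  finally show ?case .
qed

lemma add_sets_less:
  fixes x y :: "'a::infinite surreal"
  shows "\<forall>a\<in>(\<lambda>l. l + y) ` left_opts x \<union> (\<lambda>l. x + l) ` left_opts y.
    \<forall>b\<in>(\<lambda>r. r + y) ` right_opts x \<union> (\<lambda>r. x + r) ` right_opts y. a < b"
  using add_between[of x y] by (auto intro: order.strict_trans)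

lemma add_assoc_surreal: "x + y + z = x + (y + z)" for x y z :: "'a::infinite surreal"
proof -
  have "wf (simpler_rel <*lex*> simpler_rel <*lex*> simpler_rel :: (('a surreal \<times> 'a surreal \<times> 'a surreal) \<times> _) set)"
    by (intro wf_lex_prod wf_simpler_rel)
  then show ?thesis
  proof (induction "(x, y, z)" arbitrary: x y z rule: wf_induct_rule)
    case less
    have IH: "\<And>u. u \<in> left_opts x \<union> right_opts x \<Longrightarrow> u + y + z = u + (y + z)"
      "\<And>u. u \<in> left_opts y \<union> right_opts y \<Longrightarrow> x + u + z = x + (u + z)"
      "\<And>u. u \<in> left_opts z \<union> right_opts z \<Longrightarrow> x + y + u = x + (y + u)"
      using less by (force simp: opts_simpler_rel)+
    have "x + (y + z) = simplest
       ((\<lambda>l. l + (y + z)) ` left_opts x \<union>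
         (\<lambda>a. x + a) ` ((\<lambda>l. l + z) ` left_opts y \<union> (\<lambda>l. y + l) ` left_opts z))
       ((\<lambda>r. r + (y + z)) ` right_opts x \<union>
         (\<lambda>b. x + b) ` ((\<lambda>r. r + z) ` right_opts y \<union> (\<lambda>r. y + r) ` right_opts z))"
      by (rule add_simplest[OF add_sets_less])
         (intro small_Un small_image small_left_opts small_right_opts add_rec | assumption)+
    \<comment> \<open>\<open>add_simplest\<close> opens only the second summand, so
      \<open>(x + y) + z\<close> is treated as \<open>z + (x + y)\<close>.\<close>
    moreover have "z + (x + y) = simplest
       ((\<lambda>l. l + (x + y)) ` left_opts z \<union>
         (\<lambda>a. z + a) ` ((\<lambda>l. l + y) ` left_opts x \<union> (\<lambda>l. x + l) ` left_opts y))
       ((\<lambda>r. r + (x + y)) ` right_opts z \<union>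
         (\<lambda>b. z + b) ` ((\<lambda>r. r + y) ` right_opts x \<union> (\<lambda>r. x + r) ` right_opts y))"
      by (rule add_simplest[OF add_sets_less])
         (intro small_Un small_image small_left_opts small_right_opts add_rec | assumption)+
    ultimately show ?case
      unfolding add_commute_surreal[of _ "x + y"] add_commute_surreal[of z]
      by (simp add: image_Un image_image IH Un_ac cong: image_cong)
  qed
qed

instance surreal :: (infinite) linordered_ab_group_add
proof
  fix a b c :: "'a surreal"
  show "a + b + c = a + (b + c)" by (rule add_assoc_surreal)
  show "a + b = b + a" by (rule add_commute_surreal)
  show "0 + a = a" by (metis add_0_surreal add_commute_surreal)
  show "- a + a = 0" by (metis add_uminus_surreal add_commute_surreal)
  show "a - b = a + - b" by (rule minus_surreal_def)
  show "c + a \<le> c + b" if "a \<le> b"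
    using that add_strict_mono_surreal(1)[of a b c] by (auto simp: le_less)
qed

section \<open>Multiplication\<close>

definition mult_option :: "'a surreal \<Rightarrow> 'a surreal \<Rightarrow> 'a surreal \<Rightarrow> 'a surreal \<Rightarrow> 'a surreal" where
  "mult_option x y a b = a * y + x * b - a * b"

definition mult_left :: "'a surreal \<Rightarrow> 'a surreal \<Rightarrow> 'a surreal set" where
  "mult_left x y = (\<Union>a\<in>left_opts x. mult_option x y a ` left_opts y) \<union>
     (\<Union>a\<in>right_opts x. mult_option x y a ` right_opts y)"

definition mult_right :: "'a surreal \<Rightarrow> 'a surreal \<Rightarrow> 'a surreal set" where
  "mult_right x y = (\<Union>a\<in>left_opts x. mult_option x y a ` right_opts y) \<union>
     (\<Union>a\<in>right_opts x. mult_option x y a ` left_opts y)"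

lemma mult_rec: "x * y = simplest (mult_left x y) (mult_right x y)" for x y :: "'a surreal"
  unfolding times_surreal_def mult_left_def mult_right_def
  by (subst surreal_mult.simps)
    (auto simp: mult_option_def times_surreal_def intro!: arg_cong2[where f = simplest])

text \<open>\<open>0 < (x' - x) * (y' - y)\<close>, multiplied out.\<close>

definition supermodular :: "'a surreal \<Rightarrow> 'a surreal \<Rightarrow> 'a surreal \<Rightarrow> 'a surreal \<Rightarrow> bool" where
  "supermodular x x' y y' \<longleftrightarrow> x * y' + x' * y < x * y + x' * y'"

text \<open>\<open>min\<close> and \<open>max\<close> merge the four combinations of left and right
  options. Rearranged, the inequalities say that \<open>x * y\<close> lies strictly between
  \<open>mult_left x y\<close> and \<open>mult_right x y\<close>.\<close>

definition supermodular_opts :: "'a surreal \<Rightarrow> 'a surreal \<Rightarrow> bool" where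
  "supermodular_opts x y \<longleftrightarrow>
     (\<forall>a\<in>options x. \<forall>b\<in>options y. supermodular (min a x) (max a x) (min b y) (max b y))"

lemma supermodular_optsD:
  assumes "supermodular_opts x y" "x1 < x2" "y1 < y2"
    and "x1 = x \<and> x2 \<in> options x \<or> x2 = x \<and> x1 \<in> options x"
    and "y1 = y \<and> y2 \<in> options y \<or> y2 = y \<and> y1 \<in> options y"
  shows "supermodular x1 x2 y1 y2"
  using assms(4,5)
proof (elim disjE conjE)
  assume "x1 = x" "x2 \<in> options x" "y1 = y" "y2 \<in> options y"
  then show ?thesis using assms(1-3) unfolding supermodular_opts_def
    by (metis max.absorb3 min.absorb4)
next
  assume "x1 = x" "x2 \<in> options x" "y2 = y" "y1 \<in> options y"
  then show ?thesis using assms(1-3) unfolding supermodular_opts_def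
    by (metis max.absorb3 min.absorb4 max.absorb4 min.absorb3)
next
  assume "x2 = x" "x1 \<in> options x" "y1 = y" "y2 \<in> options y"
  then show ?thesis using assms(1-3) unfolding supermodular_opts_def
    by (metis max.absorb3 min.absorb4 max.absorb4 min.absorb3)
next
  assume "x2 = x" "x1 \<in> options x" "y2 = y" "y1 \<in> options y"
  then show ?thesis using assms(1-3) unfolding supermodular_opts_def
    by (metis max.absorb4 min.absorb3)
qed

text \<open>
  With two left factors, or two right factors, on the same side of \<open>x\<close> or \<open>y\<close>, the comparison passes
  through the nearer of them, and splits into two instances of the supermodular inequality.
\<close>

lemma mult_left_less_mult_right:
  fixes x y :: "'a::infinite surreal"
  assumes IH: "\<And>x' y'. x' = x \<or> x' \<in> options x \<Longrightarrow> y' = y \<or> y' \<in> options y \<Longrightarrow>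
      x' \<noteq> x \<or> y' \<noteq> y \<Longrightarrow> supermodular_opts x' y'"
    and lr: "l \<in> mult_left x y" "r \<in> mult_right x y"
  shows "l < r"
proof -
  \<comment> \<open>The inequalities needed below come from the hypothesis at simpler pairs; the
    last condition excludes the pair \<open>x\<close>, \<open>y\<close> itself.\<close>
  have S: "u * w' + u' * w < u * w + u' * w'"
    if uw: "u < u'" "w < w'" "u = x \<or> u \<in> options x" "u' = x \<or> u' \<in> options x"
      "w = y \<or> w \<in> options y" "w' = y \<or> w' \<in> options y" "u \<noteq> x \<and> u' \<noteq> x \<or> w \<noteq> y \<and> w' \<noteq> y"
    for u u' w w'
  proof -
    \<comment> \<open>Of two initial segments of \<open>x\<close> the longer one serves as the
      number, the shorter one as its option.\<close>
    obtain x' where x': "u = x' \<and> u' \<in> options x' \<or> u' = x' \<and> u \<in> options x'"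
      using uw options_linear[of u x u'] by auto
    obtain y' where y': "w = y' \<and> w' \<in> options y' \<or> w' = y' \<and> w \<in> options y'"
      using uw options_linear[of w y w'] by auto
    have "supermodular_opts x' y'"
      using x' y' that by (intro IH) auto
    then have "supermodular u u' w w'"
      using that(1,2) x' y' by (rule supermodular_optsD)
    then show ?thesis unfolding supermodular_def .
  qed
  obtain a b where ab: "l = a * y + x * b - a * b" "a \<in> options x" "b \<in> options y"
    and sab: "a < x \<and> b < y \<or> x < a \<and> y < b"
    using lr(1) by (auto simp: mult_left_def mult_option_def left_opts_iff right_opts_iff)
  obtain a' b' where ab': "r = a' * y + x * b' - a' * b'" "a' \<in> options x" "b' \<in> options y"
    and sab': "a' < x \<and> y < b' \<or> x < a' \<and> b' < y"
    using lr(2) by (auto simp: mult_right_def mult_option_def left_opts_iff right_opts_iff)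
  have "a * y + x * b - a * b < a' * y + x * b' - a' * b'"
    using sab sab'
  proof (elim disjE conjE)
    assume o: "a < x" "b < y" "a' < x" "y < b'"
    then have "b < b'" by simp
    show ?thesis
    proof (cases a a' rule: linorder_cases)
      case less
      have "a * y + a' * b < a * b + a' * y" "a' * b' + x * b < a' * b + x * b'"
        using S o less ab ab' \<open>b < b'\<close> by (metis order.strict_iff_not)+
      \<comment> \<open>The two inequalities add up to the claim plus terms common to both
        sides.\<close>
      then show ?thesis by (rule add_strict_mono[THEN iffD1[OF _ , rotated]]) (simp add: algebra_simps)
    next
      case equal
      have "a' * b' + x * b < a' * b + x * b'"
        using S o equal ab ab' \<open>b < b'\<close> by (metis order.strict_iff_not)
      then show ?thesis by (simp add: algebra_simps equal)
    next
      case greater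
      have "a' * b' + a * y < a' * y + a * b'" "a * b' + x * b < a * b + x * b'"
        using S o greater ab ab' \<open>b < b'\<close> by (metis order.strict_iff_not)+
      then show ?thesis by (rule add_strict_mono[THEN iffD1[OF _ , rotated]]) (simp add: algebra_simps)
    qed
  next
    assume o: "a < x" "b < y" "x < a'" "b' < y"
    then have "a < a'" by simp
    show ?thesis
    proof (cases b b' rule: linorder_cases)
      case less
      have "a * b' + x * b < a * b + x * b'" "a * y + a' * b' < a * b' + a' * y"
        using S o less ab ab' \<open>a < a'\<close> by (metis order.strict_iff_not)+
      then show ?thesis by (rule add_strict_mono[THEN iffD1[OF _ , rotated]]) (simp add: algebra_simps)
    next
      case equal
      have "a * y + a' * b < a * b + a' * y"
        using S o equal ab ab' \<open>a < a'\<close> by (metis order.strict_iff_not)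
      then show ?thesis by (simp add: algebra_simps equal)
    next
      case greater
      have "a * y + a' * b < a * b + a' * y" "x * b + a' * b' < x * b' + a' * b"
        using S o greater ab ab' \<open>a < a'\<close> by (metis order.strict_iff_not)+
      then show ?thesis by (rule add_strict_mono[THEN iffD1[OF _ , rotated]]) (simp add: algebra_simps)
    qed
  next
    assume o: "x < a" "y < b" "a' < x" "y < b'"
    then have "a' < a" by simp
    show ?thesis
    proof (cases b b' rule: linorder_cases)
      case less
      have "a' * b + a * y < a' * y + a * b" "a' * b' + x * b < a' * b + x * b'"
        using S o less ab ab' \<open>a' < a\<close> by (metis order.strict_iff_not)+
      then show ?thesis by (rule add_strict_mono[THEN iffD1[OF _ , rotated]]) (simp add: algebra_simps)
    next
      case equal
      have "a' * b + a * y < a' * y + a * b"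
        using S o equal ab ab' \<open>a' < a\<close> by (metis order.strict_iff_not)
      then show ?thesis by (simp add: algebra_simps equal)
    next
      case greater
      have "x * b + a * b' < x * b' + a * b" "a' * b' + a * y < a' * y + a * b'"
        using S o greater ab ab' \<open>a' < a\<close> by (metis order.strict_iff_not)+
      then show ?thesis by (rule add_strict_mono[THEN iffD1[OF _ , rotated]]) (simp add: algebra_simps)
    qed
  next
    assume o: "x < a" "y < b" "x < a'" "b' < y"
    then have "b' < b" by simp
    show ?thesis
    proof (cases a a' rule: linorder_cases)
      case less
      have "x * b + a * b' < x * b' + a * b" "a * y + a' * b' < a * b' + a' * y"
        using S o less ab ab' \<open>b' < b\<close> by (metis order.strict_iff_not)+
      then show ?thesis by (rule add_strict_mono[THEN iffD1[OF _ , rotated]]) (simp add: algebra_simps)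
    next
      case equal
      have "x * b + a * b' < x * b' + a * b"
        using S o equal ab ab' \<open>b' < b\<close> by (metis order.strict_iff_not)
      then show ?thesis by (simp add: algebra_simps equal)
    next
      case greater
      have "a' * b + a * y < a' * y + a * b" "x * b + a' * b' < x * b' + a' * b"
        using S o greater ab ab' \<open>b' < b\<close> by (metis order.strict_iff_not)+
      then show ?thesis by (rule add_strict_mono[THEN iffD1[OF _ , rotated]]) (simp add: algebra_simps)
    qed
  qed
  then show ?thesis using ab(1) ab'(1) by simp
qed

text \<open>The induction hypothesis separates the two sets of options, so the product lies between
  them, and its position there is the claim.\<close>

lemma supermodular_opts: "supermodular_opts x y" for x y :: "'a::infinite surreal"
proof -
  have "wf (simpler_rel <*lex*> simpler_rel :: (('a surreal \<times> 'a surreal) \<times> _) set)"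
    by (intro wf_lex_prod wf_simpler_rel)
  then show ?thesis
  proof (induction "(x, y)" arbitrary: x y rule: wf_induct_rule)
    case less
    have "x * y \<in> strictly_between (mult_left x y) (mult_right x y)"
      unfolding mult_rec[of x y]
    proof (rule simplestD)
      show "l < r" if "l \<in> mult_left x y" "r \<in> mult_right x y" for l r
        by (rule mult_left_less_mult_right[OF less that]) (auto simp: opts_simpler_rel)
    qed (unfold mult_left_def mult_right_def,
         (intro small_Un small_UN small_image small_left_opts small_right_opts)+)
    then have *: "\<And>l. l \<in> mult_left x y \<Longrightarrow> l < x * y" "\<And>r. r \<in> mult_right x y \<Longrightarrow> x * y < r"
      by (auto simp: strictly_between_def)
    show ?case
      unfolding supermodular_opts_def
    proof (intro ballI)
      fix a b assume "a \<in> options x" "b \<in> options y"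
      then consider "a \<in> left_opts x" "b \<in> left_opts y" | "a \<in> right_opts x" "b \<in> right_opts y"
        | "a \<in> left_opts x" "b \<in> right_opts y" | "a \<in> right_opts x" "b \<in> left_opts y"
        by (auto simp: options_Un)
      then show "supermodular (min a x) (max a x) (min b y) (max b y)"
      proof cases
        case 1
        then have "mult_option x y a b < x * y"
          by (intro *) (auto simp: mult_left_def)
        with 1 show ?thesis
          by (simp add: left_opts_iff right_opts_iff min.absorb3 min.absorb4 max.absorb3 max.absorb4
              supermodular_def mult_option_def algebra_simps)
      next
        case 2
        then have "mult_option x y a b < x * y"
          by (intro *) (auto simp: mult_left_def)
        with 2 show ?thesis
          by (simp add: left_opts_iff right_opts_iff min.absorb3 min.absorb4 max.absorb3 max.absorb4
              supermodular_def mult_option_def algebra_simps)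
      next
        case 3
        then have "x * y < mult_option x y a b"
          by (intro *) (auto simp: mult_right_def)
        with 3 show ?thesis
          by (simp add: left_opts_iff right_opts_iff min.absorb3 min.absorb4 max.absorb3 max.absorb4
              supermodular_def mult_option_def algebra_simps)
      next
        case 4
        then have "x * y < mult_option x y a b"
          by (intro *) (auto simp: mult_right_def)
        with 4 show ?thesis
          by (simp add: left_opts_iff right_opts_iff min.absorb3 min.absorb4 max.absorb3 max.absorb4
              supermodular_def mult_option_def algebra_simps)
      qed
    qed
  qed
qed

text \<open>The intervals from \<open>x\<close> to \<open>x'\<close> and from \<open>y\<close> to
  \<open>y'\<close> are split at the common initial segment of their ends, unless one end is an
  option of the other. The inequality concerns a mixed difference and is therefore additive under
  such splittings.\<close>

lemma supermodular:
  fixes x x' y y' :: "'a::infinite surreal"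
  assumes "x < x'" "y < y'"
  shows "supermodular x x' y y'"
proof -
  have base: "supermodular u u' w w'"
    if "u < u'" "w < w'" "u \<in> options u' \<or> u' \<in> options u" "w \<in> options w' \<or> w' \<in> options w"
    for u u' w w' :: "'a surreal"
    using that supermodular_optsD[OF supermodular_opts that(1,2)] by metis
  have fst: "supermodular u u' y y'" if "u < u'" "u \<in> options u' \<or> u' \<in> options u" for u u'
    using assms(2)
  proof (cases rule: less_cases)
    case (mid w)
    then have "supermodular u u' y w" "supermodular u u' w y'"
      using that by (auto simp: left_opts_iff right_opts_iff intro!: base)
    then show ?thesis
      unfolding supermodular_def by (rule add_strict_mono[THEN iffD1[OF _ , rotated]]) (simp add: algebra_simps)
  qed (use that assms(2) in \<open>auto simp: left_opts_iff right_opts_iff intro!: base\<close>)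
  show ?thesis
    using assms(1)
  proof (cases rule: less_cases)
    case (mid u)
    then have "supermodular x u y y'" "supermodular u x' y y'"
      by (auto simp: left_opts_iff right_opts_iff intro!: fst)
    then show ?thesis
      unfolding supermodular_def by (rule add_strict_mono[THEN iffD1[OF _ , rotated]]) (simp add: algebra_simps)
  qed (use assms(1) in \<open>auto simp: left_opts_iff right_opts_iff intro!: fst\<close>)
qed

lemma mult_0_left: "0 * y = 0" for y :: "'a::infinite surreal"
  by (subst mult_rec) (simp add: mult_left_def mult_right_def zero_surreal_def[symmetric])

text \<open>With 0 next to \<open>x\<close> as first factor, the supermodular inequality says that
  multiplication by \<open>x\<close> is strictly increasing or strictly decreasing. This gives the
  uniqueness that the definite description in \<open>inverse\<close> requires.\<close>

lemma mult_left_cancel_surreal: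
  fixes x y z :: "'a::infinite surreal"
  assumes "x \<noteq> 0"
  shows "x * y = x * z \<longleftrightarrow> y = z"
proof -
  have "x * y \<noteq> x * z" if "y < z" for y z
    using supermodular[of 0 x y z] supermodular[of x 0 y z] that assms
    by (cases x "0 :: 'a surreal" rule: linorder_cases) (auto simp: supermodular_def mult_0_left)
  then show ?thesis by (metis neq_iff)
qed

section \<open>Dyadic numbers\<close>

lemma small_finite: "finite A \<Longrightarrow> small (A :: 'a::infinite surreal set)"
  by (simp add: small_countable countable_finite)

text \<open>Otherwise \<open>w\<close> would have an option \<open>u\<close> with
  \<open>w < u\<close> and \<open>u \<le> d\<close>. As \<open>w\<close> is an initial segment of
  \<open>z\<close>, also \<open>z < u\<close>, against \<open>d < z\<close>.\<close>

lemma option_below: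
  assumes "w \<in> options z" "w \<le> d" "d < z"
  shows "w \<in> insert d (options d)"
proof (cases "w = d")
  case False
  then have "w < d" using assms by simp
  then show ?thesis
  proof (cases rule: less_cases)
    case right
    then show ?thesis
      using options_less_cong'[OF _ assms(1), of d] assms(3) \<open>w < d\<close> by (auto simp: right_opts_iff)
  next
    case (mid u)
    then show ?thesis
      using options_less_cong'[OF _ assms(1), of u] assms(3) by (auto simp: right_opts_iff)
  qed (simp add: left_opts_iff)
qed simp

lemma option_above:
  assumes "w \<in> options z" "d \<le> w" "z < d"
  shows "w \<in> insert d (options d)"
proof (cases "w = d")
  case False
  then have "d < w" using assms by simp
  then show ?thesis
  proof (cases rule: less_cases)
    case left
    then show ?thesis
      using options_less_cong[OF _ assms(1), of d] assms(3) \<open>d < w\<close> by (auto simp: left_opts_iff)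
  next
    case (mid u)
    then show ?thesis
      using options_less_cong[OF _ assms(1), of u] assms(3) by (auto simp: left_opts_iff)
  qed (simp add: right_opts_iff)
qed simp

text \<open>By minimality an option of the cut is not strictly between, so some element of
  \<open>A\<close> or \<open>B\<close> bounds it, and \<open>option_below\<close> or
  \<open>option_above\<close> applies. This is how options of dyadic numbers and of reals are seen
  to be dyadic.\<close>

lemma options_simplest_subset:
  fixes A B :: "'a::infinite surreal set"
  assumes AB: "\<forall>l\<in>A. \<forall>r\<in>B. l < r" "small A" "small B"
  shows "options (simplest A B) \<subseteq> (\<Union>d\<in>A \<union> B. insert d (options d))"
proof
  fix w assume w: "w \<in> options (simplest A B)"
  have s: "simplest A B \<in> strictly_between A B" "options (simplest A B) \<inter> strictly_between A B = {}"
    using AB by (intro simplestD; blast)+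
  with w have "w \<notin> strictly_between A B" by blast
  then consider a where "a \<in> A" "w \<le> a" | b where "b \<in> B" "b \<le> w"
    by (auto simp: strictly_between_def not_less)
  then show "w \<in> (\<Union>d\<in>A \<union> B. insert d (options d))"
  proof cases
    case (1 a)
    then show ?thesis using option_below[OF w, of a] s(1) by (auto simp: strictly_between_def)
  next
    case (2 b)
    then show ?thesis using option_above[OF w, of b] s(1) by (auto simp: strictly_between_def)
  qed
qed

text \<open>A common initial segment strictly between \<open>d\<close> and the cut would be a
  simpler element of the same cut. So one of the two numbers is an option of the other, and the last
  assumption decides which.\<close>

lemma left_mem_options_simplest:
  fixes B :: "'a::infinite surreal set"
  assumes AB: "\<forall>r\<in>B. d < r" "small B" and "simplest {d} B \<notin> options d"
  shows "d \<in> options (simplest {d} B)"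
proof -
  let ?z = "simplest {d} B"
  have s: "?z \<in> strictly_between {d} B" "options ?z \<inter> strictly_between {d} B = {}"
    using AB by (intro simplestD; force intro: small_finite)+
  then have "d < ?z" by (simp add: strictly_between_def)
  then show ?thesis
  proof (cases rule: less_cases)
    case (mid u)
    then have "u \<in> strictly_between {d} B" "u \<in> options ?z"
      using s(1) by (auto simp: strictly_between_def left_opts_iff)
    with s(2) show ?thesis by blast
  qed (use assms(3) in \<open>auto simp: left_opts_iff right_opts_iff\<close>)
qed

lemma right_mem_options_simplest:
  fixes A :: "'a::infinite surreal set"
  assumes AB: "\<forall>l\<in>A. l < d" "small A" and "simplest A {d} \<notin> options d"
  shows "d \<in> options (simplest A {d})"
proof -
  let ?z = "simplest A {d}"
  have s: "?z \<in> strictly_between A {d}" "options ?z \<inter> strictly_between A {d} = {}"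
    using AB by (intro simplestD; force intro: small_finite)+
  then have "?z < d" by (simp add: strictly_between_def)
  then show ?thesis
  proof (cases rule: less_cases)
    case (mid u)
    then have "u \<in> strictly_between A {d}" "u \<in> options ?z"
      using s(1) by (auto simp: strictly_between_def right_opts_iff)
    with s(2) show ?thesis by blast
  qed (use assms(3) in \<open>auto simp: left_opts_iff right_opts_iff\<close>)
qed

lemma dyadic_0_0: "dyadic 0 0 = 0"
  by (simp add: dyadic.simps)

lemma dyadic_0_pos: "m \<ge> 0 \<Longrightarrow> dyadic 0 (m + 1) = simplest {dyadic 0 m} {}"
  by (subst dyadic.simps) simp

lemma dyadic_0_neg: "m \<le> 0 \<Longrightarrow> dyadic 0 (m - 1) = simplest {} {dyadic 0 m}"
  by (subst dyadic.simps) simp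

lemma dyadic_even: "dyadic (Suc k) (2 * m) = dyadic k m"
  by (simp add: dyadic.simps)

lemma dyadic_odd: "dyadic (Suc k) (2 * m + 1) = simplest {dyadic k m} {dyadic k (m + 1)}"
  by (simp add: dyadic.simps)

text \<open>\<open>dyadic\<close> accepts unreduced fractions, so comparisons can be made at a
  common denominator.\<close>

lemma dyadic_scale: "dyadic (k + j) (m * 2 ^ j) = (dyadic k m :: 'a surreal)"
proof (induction j)
  case (Suc j)
  then show ?case using dyadic_even[of "k + j" "m * 2 ^ j", where 'a = 'a] by (simp add: mult_ac)
qed simp

lemma simplest_between_finite:
  fixes A B :: "'a::infinite surreal set"
  shows "finite A \<Longrightarrow> finite B \<Longrightarrow> \<forall>l\<in>A. \<forall>r\<in>B. l < r \<Longrightarrow> simplest A B \<in> strictly_between A B"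
  by (rule simplestD) (auto intro: small_finite)

lemma dyadic_step: "dyadic k m < (dyadic k (m + 1) :: 'a::infinite surreal)"
proof (induction k arbitrary: m)
  case 0
  show ?case
  proof (cases "m \<ge> 0")
    case True
    then show ?thesis
      using simplest_between_finite[of "{dyadic 0 m :: 'a surreal}" "{}"]
      by (simp add: dyadic_0_pos strictly_between_def)
  next
    case False
    then show ?thesis
      using simplest_between_finite[of "{}" "{dyadic 0 (m + 1) :: 'a surreal}"] dyadic_0_neg[of "m + 1", where 'a = 'a]
      by (simp add: strictly_between_def)
  qed
next
  case (Suc k)
  define j where "j = m div 2"
  have btw: "dyadic k j < (dyadic (Suc k) (2 * j + 1) :: 'a surreal)"
    "(dyadic (Suc k) (2 * j + 1) :: 'a surreal) < dyadic k (j + 1)"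
    using simplest_between_finite[of "{dyadic k j :: 'a surreal}" "{dyadic k (j + 1)}"] Suc[of j]
    by (auto simp: dyadic_odd strictly_between_def)
  have "m = 2 * j \<or> m = 2 * j + 1 \<and> m + 1 = 2 * (j + 1)"
    unfolding j_def by presburger
  then consider "m = 2 * j" | "m = 2 * j + 1" "m + 1 = 2 * (j + 1)"
    by blast
  then show ?case
    by cases (use btw dyadic_even[of k j, where 'a = 'a] dyadic_even[of k "j + 1", where 'a = 'a]
      in \<open>auto simp: add.commute\<close>)
qed

lemma dyadic_strict_mono: "m < n \<Longrightarrow> dyadic k m < (dyadic k n :: 'a::infinite surreal)"
proof (induction n rule: int_gr_induct)
  case base
  show ?case by (rule dyadic_step)
next
  case (step n)
  then show ?case using dyadic_step[of k n, where 'a = 'a] by auto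
qed

lemma dyadic_less_same: "dyadic k m < (dyadic k n :: 'a::infinite surreal) \<longleftrightarrow> m < n"
  by (metis dyadic_strict_mono linorder_neqE not_less_iff_gr_or_eq)

lemma dyadic_eq_same: "dyadic k m = (dyadic k n :: 'a::infinite surreal) \<longleftrightarrow> m = n"
  by (metis dyadic_strict_mono linorder_neqE less_irrefl)

lemma dyadic_less_iff:
  "dyadic k m < (dyadic l n :: 'a::infinite surreal) \<longleftrightarrow> (of_int m / 2 ^ k :: real) < of_int n / 2 ^ l"
proof -
  have "dyadic k m < (dyadic l n :: 'a surreal) \<longleftrightarrow> m * 2 ^ l < n * 2 ^ k"
    using dyadic_less_same[of "k + l" "m * 2 ^ l" "n * 2 ^ k", where 'a = 'a]
      dyadic_scale[of k l m, where 'a = 'a] dyadic_scale[of l k n, where 'a = 'a]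
    by (simp add: add.commute)
  also have "\<dots> \<longleftrightarrow> (of_int (m * 2 ^ l) :: real) < of_int (n * 2 ^ k)"
    by (simp only: of_int_less_iff)
  also have "\<dots> \<longleftrightarrow> (of_int m / 2 ^ k :: real) < of_int n / 2 ^ l"
    by (simp add: field_simps)
  finally show ?thesis .
qed

lemma options_dyadic_0_pos:
  "options (dyadic 0 (int n) :: 'a::infinite surreal) = dyadic 0 ` {0..<int n}"
proof (induction n)
  case 0
  then show ?case by (simp add: dyadic_0_0)
next
  case (Suc n)
  let ?d = "dyadic 0 (int n) :: 'a surreal"
  have z: "dyadic 0 (int (Suc n)) = simplest {?d} {}"
    using dyadic_0_pos[of "int n", where 'a = 'a] by (simp add: add.commute)
  have "simplest {?d} {} \<notin> options ?d"
    unfolding Suc z[symmetric] by (auto simp: dyadic_eq_same)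
  then have "?d \<in> options (simplest {?d} {})"
    by (intro left_mem_options_simplest) (auto intro: small_finite)
  then have "options (simplest {?d} {}) = insert ?d (options ?d)"
    using options_simplest_subset[of "{?d}" "{}"] options_trans[of ?d "simplest {?d} {}"]
    by (auto intro: small_finite)
  also have "\<dots> = dyadic 0 ` {0..<int (Suc n)}"
  proof -
    have "{0..<int (Suc n)} = insert (int n) {0..<int n}" by auto
    then show ?thesis unfolding Suc by simp
  qed
  finally show ?case unfolding z .
qed

lemma options_dyadic_0_neg:
  "options (dyadic 0 (- int n) :: 'a::infinite surreal) = dyadic 0 ` {- int n<..0}"
proof (induction n)
  case 0
  then show ?case by (simp add: dyadic_0_0)
next
  case (Suc n)
  let ?d = "dyadic 0 (- int n) :: 'a surreal"
  have z: "dyadic 0 (- int (Suc n)) = simplest {} {?d}"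
  proof -
    have "- int (Suc n) = - int n - 1" by simp
    then show ?thesis by (simp only: dyadic_0_neg neg_le_0_iff_le of_nat_0_le_iff)
  qed
  have "simplest {} {?d} \<notin> options ?d"
    unfolding Suc z[symmetric] by (auto simp: dyadic_eq_same)
  then have "?d \<in> options (simplest {} {?d})"
    by (intro right_mem_options_simplest) (auto intro: small_finite)
  then have "options (simplest {} {?d}) = insert ?d (options ?d)"
    using options_simplest_subset[of "{}" "{?d}"] options_trans[of ?d "simplest {} {?d}"]
    by (auto intro: small_finite)
  also have "\<dots> = dyadic 0 ` {- int (Suc n)<..0}"
  proof -
    have "{- int (Suc n)<..0} = insert (- int n) {- int n<..0}" by auto
    then show ?thesis unfolding Suc by simp
  qed
  finally show ?case unfolding z .
qed

text \<open>At level \<open>k + 1\<close> an odd numerator denotes the cut between two adjacent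
  numbers of level \<open>k\<close>. The cut is not of level \<open>k\<close>, hence no option of
  these neighbours, so they are options of it; its other options are options of the neighbours. The
  first claim will bound the distance to options from below, the other two supply options that
  attain the bound.\<close>

lemma options_dyadic:
  "options (dyadic k m :: 'a::infinite surreal) \<subseteq> range (dyadic k)"
  "dyadic k m \<in> options (dyadic (Suc k) (2 * m + 1) :: 'a surreal)"
  "dyadic k (m + 1) \<in> options (dyadic (Suc k) (2 * m + 1) :: 'a surreal)"
proof -
  have odd: "options (dyadic (Suc k) (2 * j + 1) :: 'a surreal) \<subseteq> range (dyadic k) \<and>
      dyadic k j \<in> options (dyadic (Suc k) (2 * j + 1) :: 'a surreal) \<and>
      dyadic k (j + 1) \<in> options (dyadic (Suc k) (2 * j + 1) :: 'a surreal)"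
    if IH: "\<And>m. options (dyadic k m :: 'a surreal) \<subseteq> range (dyadic k)" for k j
  proof -
    let ?u = "dyadic k j :: 'a surreal" and ?v = "dyadic k (j + 1) :: 'a surreal"
    let ?z = "simplest {?u} {?v}"
    have uv: "?u < ?v" by (rule dyadic_step)
    have "?z \<in> strictly_between {?u} {?v}"
      using uv by (intro simplest_between_finite) auto
    then have "?z \<notin> range (dyadic k)"
      by (auto simp: strictly_between_def dyadic_less_same)
    then have "?z \<notin> options ?u" "?z \<notin> options ?v"
      using IH by blast+
    then have "?u \<in> options ?z" "?v \<in> options ?z"
      using uv by (intro left_mem_options_simplest right_mem_options_simplest; simp add: small_finite)+
    moreover have "options ?z \<subseteq> (\<Union>d\<in>{?u} \<union> {?v}. insert d (options d))"
      using uv by (intro options_simplest_subset) (auto intro: small_finite)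
    then have "options ?z \<subseteq> range (dyadic k)"
      using IH by blast
    ultimately show ?thesis unfolding dyadic_odd by blast
  qed
  have sub: "options (dyadic k m :: 'a surreal) \<subseteq> range (dyadic k)" for k m
  proof (induction k arbitrary: m)
    case 0
    show ?case
    proof (cases "m \<ge> 0")
      case True
      then obtain n where "m = int n" by (metis nat_0_le)
      then show ?thesis by (auto simp: options_dyadic_0_pos)
    next
      case False
      then obtain n where "m = - int n" by (metis int_cases2 of_nat_0_le_iff)
      then show ?thesis by (auto simp: options_dyadic_0_neg)
    qed
  next
    case (Suc k)
    have "range (dyadic k :: _ \<Rightarrow> 'a surreal) \<subseteq> range (dyadic (Suc k))"
      by (metis dyadic_even image_subsetI rangeI)
    moreover obtain j where "m = 2 * j \<or> m = 2 * j + 1"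
      by (metis evenE oddE)
    ultimately show ?case
      using odd[OF Suc, of j] Suc[of j] dyadic_even[of k j, where 'a = 'a] by (metis order.trans)
  qed
  show "options (dyadic k m :: 'a surreal) \<subseteq> range (dyadic k)"
    by (rule sub)
  show "dyadic k m \<in> options (dyadic (Suc k) (2 * m + 1) :: 'a surreal)"
    "dyadic k (m + 1) \<in> options (dyadic (Suc k) (2 * m + 1) :: 'a surreal)"
    using odd[OF sub] by auto
qed


section \<open>The embedding of the reals\<close>

definition is_dyadic :: "nat \<Rightarrow> real \<Rightarrow> bool" where
  "is_dyadic k r \<longleftrightarrow> (\<exists>m. r = of_int m / 2 ^ k)"

lemma dyadic_dense:
  fixes r s :: real
  assumes "r < s"
  obtains k m where "r < of_int m / 2 ^ k" "of_int m / 2 ^ k < s"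
proof -
  obtain k where k: "(1 / 2) ^ k < s - r"
    using real_arch_pow_inv[of "s - r" "1 / 2"] assms by auto
  define m where "m = \<lfloor>r * 2 ^ k\<rfloor> + 1"
  have "r * 2 ^ k < of_int m" "of_int m \<le> r * 2 ^ k + 1"
    unfolding m_def by linarith+
  moreover have "1 < (s - r) * 2 ^ k"
    using k by (simp add: field_simps power_one_over)
  ultimately have "r * 2 ^ k < of_int m" "of_int m < s * 2 ^ k"
    by (auto simp: algebra_simps)
  then show thesis by (intro that[of m k]) (auto simp: field_simps)
qed

lemma surreal_of_real_between:
  "(of_int m / 2 ^ k < r \<longrightarrow> dyadic k m < (surreal_of_real r :: 'a::infinite surreal)) \<and>
   (r < of_int m / 2 ^ k \<longrightarrow> (surreal_of_real r :: 'a surreal) < dyadic k m)"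
proof -
  let ?L = "{z :: 'a surreal. \<exists>k m. z = dyadic k m \<and> of_int m / 2 ^ k < r}"
  let ?R = "{z :: 'a surreal. \<exists>k m. z = dyadic k m \<and> r < of_int m / 2 ^ k}"
  have c: "countable (range (\<lambda>(k, m). dyadic k m :: 'a surreal))"
    by simp
  have "small ?L" "small ?R"
    by (rule small_countable, rule countable_subset[OF _ c], auto)+
  then have "surreal_of_real r \<in> strictly_between ?L ?R"
    unfolding surreal_of_real_def by (intro simplestD) (auto simp: dyadic_less_iff)
  then show ?thesis unfolding strictly_between_def by blast
qed

text \<open>An option of \<open>m / 2 ^ k\<close> is a dyadic number different from it, hence
  belongs to one of the two defining sets.\<close>

lemma surreal_of_real_dyadic:
  "surreal_of_real (of_int m / 2 ^ k) = (dyadic k m :: 'a::infinite surreal)"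
  unfolding surreal_of_real_def
proof (rule simplestI)
  let ?L = "{z :: 'a surreal. \<exists>l n. z = dyadic l n \<and> of_int n / 2 ^ l < (of_int m / 2 ^ k :: real)}"
  let ?R = "{z :: 'a surreal. \<exists>l n. z = dyadic l n \<and> (of_int m / 2 ^ k :: real) < of_int n / 2 ^ l}"
  show "dyadic k m \<in> strictly_between ?L ?R"
    by (auto simp: strictly_between_def dyadic_less_iff)
  show "options (dyadic k m) \<inter> strictly_between ?L ?R = {}"
  proof -
    have False if w: "w \<in> options (dyadic k m)" "w \<in> strictly_between ?L ?R" for w
    proof -
      obtain n where n: "w = dyadic k n" using w(1) options_dyadic(1) by blast
      have "w \<noteq> dyadic k m" using w(1) by (auto simp: options_iff)
      then have "w < dyadic k m \<or> dyadic k m < w" by auto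
      then have "w \<in> ?L \<union> ?R" unfolding n dyadic_less_iff by auto
      with w(2) show False by (fastforce simp: strictly_between_def)
    qed
    then show ?thesis by blast
  qed
qed

lemma surreal_of_real_less_iff:
  "surreal_of_real r < (surreal_of_real s :: 'a::infinite surreal) \<longleftrightarrow> r < s"
proof -
  have "surreal_of_real r < (surreal_of_real s :: 'a surreal)" if rs: "r < s" for r s
  proof -
    obtain k m where "r < of_int m / 2 ^ k" "of_int m / 2 ^ k < s"
      using dyadic_dense[OF rs] .
    then show ?thesis
      using surreal_of_real_between[of m k r, where 'a = 'a] surreal_of_real_between[of m k s, where 'a = 'a]
      by auto
  qed
  then show ?thesis by (metis linorder_neqE not_less_iff_gr_or_eq)
qed

lemma surreal_of_real_le_iff:
  "surreal_of_real r \<le> (surreal_of_real s :: 'a::infinite surreal) \<longleftrightarrow> r \<le> s"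
  by (simp add: surreal_of_real_less_iff not_less[symmetric])

lemma surreal_of_real_inject:
  "surreal_of_real r = (surreal_of_real s :: 'a::infinite surreal) \<longleftrightarrow> r = s"
  by (metis surreal_of_real_less_iff linorder_neqE less_irrefl)

lemma surreal_of_real_eq_dyadic_imp:
  "surreal_of_real r = (dyadic k m :: 'a::infinite surreal) \<Longrightarrow> r = of_int m / 2 ^ k"
  by (metis surreal_of_real_dyadic surreal_of_real_inject)

lemma not_is_dyadic_opts:
  assumes r: "\<And>k. \<not> is_dyadic k r" and w: "w \<in> options (surreal_of_real r :: 'a::infinite surreal)"
  shows "\<exists>k m. w = dyadic k m"
proof -
  let ?L = "{z :: 'a surreal. \<exists>k m. z = dyadic k m \<and> of_int m / 2 ^ k < r}"
  let ?R = "{z :: 'a surreal. \<exists>k m. z = dyadic k m \<and> r < of_int m / 2 ^ k}"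
  have c: "countable (range (\<lambda>(k, m). dyadic k m :: 'a surreal))"
    by simp
  have "small ?L" "small ?R"
    by (rule small_countable, rule countable_subset[OF _ c], auto)+
  then have "options (surreal_of_real r) \<subseteq> (\<Union>d\<in>?L \<union> ?R. insert d (options d))"
    unfolding surreal_of_real_def by (intro options_simplest_subset) (auto simp: dyadic_less_iff)
  then obtain k m where "w \<in> insert (dyadic k m) (options (dyadic k m))"
    using w by blast
  then show ?thesis using options_dyadic(1)[of k m, where 'a = 'a] by blast
qed

text \<open>Take a dyadic number between \<open>s\<close> and \<open>r\<close>. Either it is an
  option of \<open>r\<close>, or its common initial segment with \<open>r\<close> is one and lies
  even closer; \<open>r\<close> cannot be an option of it, since options of dyadic numbers are
  dyadic.\<close>

lemma not_is_dyadic_approx: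
  assumes r: "\<And>k. \<not> is_dyadic k r"
  shows "s < r \<Longrightarrow> \<exists>p. s < p \<and> p < r \<and> surreal_of_real p \<in> options (surreal_of_real r :: 'a::infinite surreal)"
    and "r < s \<Longrightarrow> \<exists>p. r < p \<and> p < s \<and> surreal_of_real p \<in> options (surreal_of_real r :: 'a surreal)"
proof -
  let ?z = "surreal_of_real r :: 'a surreal"
  have z: "?z \<notin> options (dyadic k m)" for k m
    using options_dyadic(1)[of k m, where 'a = 'a] r
    by (auto simp: is_dyadic_def dest!: subsetD surreal_of_real_eq_dyadic_imp)
  have opt: "\<exists>p. w = surreal_of_real p" if "w \<in> options ?z" for w
    using not_is_dyadic_opts[OF r that] surreal_of_real_dyadic by metis
  show "\<exists>p. s < p \<and> p < r \<and> surreal_of_real p \<in> options ?z" if sr: "s < r"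
  proof -
    obtain k m where km: "s < of_int m / 2 ^ k" "of_int m / 2 ^ k < r"
      using dyadic_dense[OF sr] .
    let ?p = "of_int m / 2 ^ k :: real"
    have "surreal_of_real ?p < ?z"
      using km by (simp add: surreal_of_real_less_iff)
    then show ?thesis
    proof (cases rule: less_cases)
      case left
      then show ?thesis using km by (auto simp: left_opts_iff)
    next
      case right
      then show ?thesis using z[of k m] by (simp add: right_opts_iff surreal_of_real_dyadic)
    next
      case (mid u)
      then obtain p where "u = surreal_of_real p" using opt by (auto simp: left_opts_iff)
      with mid km show ?thesis
        by (auto simp: left_opts_iff surreal_of_real_less_iff intro!: exI[of _ p])
    qed
  qed
  show "\<exists>p. r < p \<and> p < s \<and> surreal_of_real p \<in> options ?z" if sr: "r < s"
  proof -
    obtain k m where km: "r < of_int m / 2 ^ k" "of_int m / 2 ^ k < s"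
      using dyadic_dense[OF sr] .
    let ?p = "of_int m / 2 ^ k :: real"
    have "?z < surreal_of_real ?p"
      using km by (simp add: surreal_of_real_less_iff)
    then show ?thesis
    proof (cases rule: less_cases)
      case right
      then show ?thesis using km by (auto simp: right_opts_iff)
    next
      case left
      then show ?thesis using z[of k m] by (simp add: left_opts_iff surreal_of_real_dyadic)
    next
      case (mid u)
      then obtain p where "u = surreal_of_real p" using opt by (auto simp: right_opts_iff)
      with mid km show ?thesis
        by (auto simp: right_opts_iff surreal_of_real_less_iff intro!: exI[of _ p])
    qed
  qed
qed

text \<open>The type argument records the cut-off \<open>'a\<close>, which a set of reals does not
  show.\<close>

definition real_opts :: "'a::infinite itself \<Rightarrow> real \<Rightarrow> real set" where
  "real_opts _ r = {p. (surreal_of_real p :: 'a surreal) \<in> options (surreal_of_real r)}"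

text \<open>Lowest terms, whereas \<open>is_dyadic\<close> only bounds the exponent. The exact
  exponent is what locates the neighbours that are options.\<close>

definition exact_dyadic :: "nat \<Rightarrow> real \<Rightarrow> bool" where
  "exact_dyadic k r \<longleftrightarrow> (\<exists>m. r = of_int m / 2 ^ k \<and> (k = 0 \<or> odd m))"

lemma is_dyadic_exact: "is_dyadic k r \<Longrightarrow> \<exists>j\<le>k. exact_dyadic j r"
proof (induction k)
  case 0
  then show ?case by (auto simp: is_dyadic_def exact_dyadic_def)
next
  case (Suc k)
  then obtain m where m: "r = of_int m / 2 ^ Suc k" by (auto simp: is_dyadic_def)
  show ?case
  proof (cases "even m")
    case True
    then obtain j where "m = 2 * j" by (rule evenE)
    then have "is_dyadic k r" by (auto simp: is_dyadic_def m)
    then show ?thesis using Suc.IH le_SucI by blast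
  qed (use m in \<open>auto simp: exact_dyadic_def\<close>)
qed

lemma exact_is_dyadic: "exact_dyadic k r \<Longrightarrow> is_dyadic k r"
  by (auto simp: exact_dyadic_def is_dyadic_def)

lemma is_dyadic_mono: "is_dyadic k r \<Longrightarrow> k \<le> l \<Longrightarrow> is_dyadic l r"
proof -
  assume "is_dyadic k r" "k \<le> l"
  then obtain m d where "r = of_int m / 2 ^ k" "l = k + d"
    by (auto simp: is_dyadic_def le_iff_add)
  then have "r = of_int (m * 2 ^ d) / 2 ^ l"
    by (simp add: power_add)
  then show ?thesis unfolding is_dyadic_def by blast
qed

lemma is_dyadic_add: "is_dyadic k r \<Longrightarrow> is_dyadic k s \<Longrightarrow> is_dyadic k (r + s)"
  by (auto simp: is_dyadic_def add_divide_distrib[symmetric]) (metis of_int_add)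

lemma is_dyadic_mult: "is_dyadic k r \<Longrightarrow> is_dyadic l s \<Longrightarrow> is_dyadic (k + l) (r * s)"
  by (auto simp: is_dyadic_def power_add) (metis of_int_mult)

lemma options_surreal_of_real:
  "options (surreal_of_real r) = (surreal_of_real ` real_opts TYPE('a) r :: 'a::infinite surreal set)"
proof -
  have "\<exists>p. w = surreal_of_real p" if "w \<in> options (surreal_of_real r)" for w :: "'a surreal"
  proof (cases "\<exists>k. is_dyadic k r")
    case True
    then obtain k m where "r = of_int m / 2 ^ k" by (auto simp: is_dyadic_def)
    then have "w \<in> range (dyadic k)"
      using that options_dyadic(1)[of k m, where 'a = 'a] by (auto simp: surreal_of_real_dyadic)
    then show ?thesis by (metis rangeE surreal_of_real_dyadic)
  next
    case False
    then show ?thesis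
      using not_is_dyadic_opts[of r w] that by (metis surreal_of_real_dyadic)
  qed
  then show ?thesis by (auto simp: real_opts_def)
qed

lemma left_opts_surreal_of_real:
  "left_opts (surreal_of_real r) =
    (surreal_of_real ` {p \<in> real_opts TYPE('a) r. p < r} :: 'a::infinite surreal set)"
  using options_surreal_of_real[of r, where 'a = 'a]
  by (auto simp: left_opts_iff surreal_of_real_less_iff)

lemma right_opts_surreal_of_real:
  "right_opts (surreal_of_real r) =
    (surreal_of_real ` {p \<in> real_opts TYPE('a) r. r < p} :: 'a::infinite surreal set)"
  using options_surreal_of_real[of r, where 'a = 'a]
  by (auto simp: right_opts_iff surreal_of_real_less_iff)

lemma real_opts_irrefl: "r \<notin> real_opts TYPE('a::infinite) r"
  by (auto simp: real_opts_def options_iff)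

lemma surreal_of_real_0 [simp]: "surreal_of_real 0 = (0 :: 'a::infinite surreal)"
  using surreal_of_real_dyadic[of 0 0, where 'a = 'a] by (simp add: dyadic_0_0)

lemma surreal_of_real_1 [simp]: "surreal_of_real 1 = (1 :: 'a::infinite surreal)"
  using surreal_of_real_dyadic[of 1 0, where 'a = 'a] dyadic_0_pos[of 0, where 'a = 'a]
  by (simp add: dyadic_0_0 one_surreal_def)

text \<open>Here and below, \<open>\<sigma> = 1\<close> treats left options and \<open>\<sigma> = -1\<close> right options.\<close>

lemma real_opts_approx:
  assumes "\<And>k. \<not> is_dyadic k r" "\<sigma> \<in> {1, -1}" "e > 0"
  shows "\<exists>p\<in>real_opts TYPE('a::infinite) r. 0 < \<sigma> * (r - p) \<and> \<sigma> * (r - p) < e"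
proof (cases "\<sigma> = 1")
  case True
  then show ?thesis
    using not_is_dyadic_approx(1)[OF assms(1), of "r - e", where 'a = 'a] assms(3)
    by (force simp: real_opts_def)
next
  case False
  then have "\<sigma> = -1" using assms(2) by simp
  then show ?thesis
    using not_is_dyadic_approx(2)[OF assms(1), of "r + e", where 'a = 'a] assms(3)
    by (force simp: real_opts_def)
qed

lemma real_opts_int:
  "real_opts TYPE('a::infinite) (of_int i) = (if i \<ge> 0 then of_int ` {0..<i} else of_int ` {i<..0})"
proof -
  have i: "surreal_of_real (of_int j) = (dyadic 0 j :: 'a surreal)" for j
    using surreal_of_real_dyadic[of j 0] by simp
  have *: "real_opts TYPE('a) (of_int i) = of_int ` J"
    if "options (dyadic 0 i :: 'a surreal) = dyadic 0 ` J" for J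
  proof -
    have "surreal_of_real ` real_opts TYPE('a) (of_int i) = (surreal_of_real ` of_int ` J :: 'a surreal set)"
      using that options_surreal_of_real[of "of_int i", where 'a = 'a] by (simp add: i image_image)
    then show ?thesis
      by (subst (asm) inj_image_eq_iff) (auto simp: inj_def surreal_of_real_inject)
  qed
  show ?thesis
  proof (cases "i \<ge> 0")
    case True
    then obtain n where "i = int n" by (metis nat_0_le)
    then show ?thesis using *[of "{0..<i}"] True by (simp add: options_dyadic_0_pos)
  next
    case False
    then obtain n where "i = - int n" by (metis int_cases2 of_nat_0_le_iff)
    then show ?thesis using *[of "{i<..0}"] False by (simp add: options_dyadic_0_neg)
  qed
qed

lemma real_opts_0: "real_opts TYPE('a::infinite) 0 = {}"
  using real_opts_int[of 0, where 'a = 'a] by simp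

text \<open>For \<open>k > 0\<close> the numbers at distance \<open>1 / 2 ^ k\<close> on either side
  form the defining cut, and both are options. An integer has options only towards 0; hence the sign
  condition for \<open>k = 0\<close>.\<close>

lemma real_opts_neighbour:
  assumes "exact_dyadic k r" "\<sigma> \<in> {1, -1}" "k = 0 \<Longrightarrow> sgn r = \<sigma>"
  shows "r - \<sigma> / 2 ^ k \<in> real_opts TYPE('a::infinite) r"
proof (cases k)
  case 0
  then obtain i where i: "r = of_int i" using assms(1) by (auto simp: exact_dyadic_def)
  have "r - \<sigma> / 2 ^ k = of_int (i - sgn i)" using assms(3) 0 i by (auto simp: sgn_if split: if_splits)
  moreover have "i \<noteq> 0" using assms(2,3) 0 i by auto
  then have "(of_int (i - sgn i) :: real) \<in> real_opts TYPE('a) (of_int i)"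
    unfolding real_opts_int by (auto simp: sgn_if simp del: of_int_diff of_int_add intro!: imageI)
  ultimately show ?thesis
    by (simp add: i)
next
  case (Suc l)
  obtain m where m: "r = of_int m / 2 ^ k" "odd m"
    using assms(1) Suc by (auto simp: exact_dyadic_def)
  obtain j where j: "m = 2 * j + 1" using m(2) by (rule oddE)
  have "\<sigma> = 1 \<and> r - \<sigma> / 2 ^ k = of_int j / 2 ^ l \<or> \<sigma> = -1 \<and> r - \<sigma> / 2 ^ k = of_int (j + 1) / 2 ^ l"
    using assms(2) by (auto simp: m(1) j Suc field_simps)
  moreover have "surreal_of_real r = (dyadic (Suc l) (2 * j + 1) :: 'a surreal)"
    using surreal_of_real_dyadic[of m k] by (simp add: m(1) j Suc)
  ultimately show ?thesis
    using options_dyadic(2,3)[where k = l and m = j and 'a = 'a]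
    by (auto simp: real_opts_def surreal_of_real_dyadic simp del: of_int_add)
qed

lemma real_opts_is_dyadic:
  assumes "is_dyadic k r" "p \<in> real_opts TYPE('a::infinite) r"
  shows "is_dyadic k p"
proof -
  obtain m where m: "r = of_int m / 2 ^ k" using assms(1) by (auto simp: is_dyadic_def)
  have "surreal_of_real p \<in> options (dyadic k m :: 'a surreal)"
    using assms(2) by (simp add: real_opts_def m surreal_of_real_dyadic)
  then obtain n where "surreal_of_real p = (dyadic k n :: 'a surreal)"
    using options_dyadic(1) by blast
  then show ?thesis
    using surreal_of_real_eq_dyadic_imp by (auto simp: is_dyadic_def)
qed

lemma is_dyadic_dist:
  assumes "is_dyadic k x" "is_dyadic k y" "\<sigma> \<in> {1, -1}" "0 < \<sigma> * (x - y)"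
  shows "1 / 2 ^ k \<le> \<sigma> * (x - y)"
proof -
  obtain m n where mn: "x = of_int m / 2 ^ k" "y = of_int n / 2 ^ k"
    using assms(1,2) by (auto simp: is_dyadic_def)
  have "\<sigma> = 1 \<and> n < m \<or> \<sigma> = -1 \<and> m < n"
    using assms(3,4) by (auto simp: mn field_simps)
  then show ?thesis
  proof (elim disjE conjE)
    assume *: "\<sigma> = 1" "n < m"
    then have "real_of_int n + 1 \<le> of_int m" by linarith
    with * show ?thesis by (simp add: mn field_simps)
  next
    assume *: "\<sigma> = -1" "m < n"
    then have "real_of_int m + 1 \<le> of_int n" by linarith
    with * show ?thesis by (simp add: mn field_simps)
  qed
qed

lemma real_opts_int_sgn:
  assumes "exact_dyadic 0 r" "p \<in> real_opts TYPE('a::infinite) r" "\<sigma> \<in> {1, -1}" "0 < \<sigma> * (r - p)"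
  shows "sgn r = \<sigma>"
proof -
  obtain i where i: "r = of_int i" using assms(1) by (auto simp: exact_dyadic_def)
  show ?thesis
    using assms(2-4) unfolding i real_opts_int by (auto simp: sgn_if split: if_splits)
qed

text \<open>The real form of \<open>simplest_cofinal\<close>, by which identities of surreal numbers
  become inequalities between reals.\<close>

lemma simplest_surreal_of_real:
  assumes "\<And>l. l \<in> L \<Longrightarrow> l < c" "\<And>r. r \<in> R \<Longrightarrow> c < r"
    and "\<And>p. p \<in> real_opts TYPE('a::infinite) c \<Longrightarrow> p < c \<Longrightarrow> \<exists>l\<in>L. p \<le> l"
    and "\<And>p. p \<in> real_opts TYPE('a) c \<Longrightarrow> c < p \<Longrightarrow> \<exists>r\<in>R. r \<le> p"
  shows "simplest (surreal_of_real ` L) (surreal_of_real ` R) = (surreal_of_real c :: 'a surreal)"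
  by (rule simplest_cofinal)
    (use assms in \<open>auto simp: left_opts_surreal_of_real right_opts_surreal_of_real
       surreal_of_real_less_iff surreal_of_real_le_iff\<close>)

text \<open>A non-dyadic summand has options arbitrarily near. If both are dyadic,
  \<open>a + b\<close> and its options are multiples of \<open>1 / 2 ^ max k l\<close>, so
  \<open>p\<close> is at least that far from \<open>a + b\<close>, and the summand with the larger
  exponent has a neighbour at just this distance.\<close>

lemma real_opts_add:
  assumes p: "p \<in> real_opts TYPE('a::infinite) (a + b)" and \<sigma>: "\<sigma> \<in> {1, -1}"
    and pos: "0 < \<sigma> * (a + b - p)"
  shows "(\<exists>q\<in>real_opts TYPE('a) a. 0 < \<sigma> * (a - q) \<and> \<sigma> * (a - q) \<le> \<sigma> * (a + b - p)) \<or>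
         (\<exists>q\<in>real_opts TYPE('a) b. 0 < \<sigma> * (b - q) \<and> \<sigma> * (b - q) \<le> \<sigma> * (a + b - p))"
proof (cases "(\<exists>k. is_dyadic k a) \<and> (\<exists>k. is_dyadic k b)")
  case False
  then consider "\<And>k. \<not> is_dyadic k a" | "\<And>k. \<not> is_dyadic k b" by blast
  then show ?thesis
    using real_opts_approx[OF _ \<sigma> pos, of a, where 'a = 'a]
      real_opts_approx[OF _ \<sigma> pos, of b, where 'a = 'a]
    by cases (meson less_imp_le)+
next
  case True
  then obtain k l where kl: "exact_dyadic k a" "exact_dyadic l b"
    using is_dyadic_exact by blast
  have \<sigma>2: "\<sigma> * \<sigma> = 1" using \<sigma> by auto
  have main: "r - \<sigma> / 2 ^ i \<in> real_opts TYPE('a) r \<Longrightarrow> is_dyadic i (a + b) \<Longrightarrow>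
      \<exists>q\<in>real_opts TYPE('a) r. 0 < \<sigma> * (r - q) \<and> \<sigma> * (r - q) \<le> \<sigma> * (a + b - p)" for r i
    using is_dyadic_dist[OF _ real_opts_is_dyadic[OF _ p] \<sigma> pos, of i] \<sigma>2
    by (intro bexI[of _ "r - \<sigma> / 2 ^ i"]) (auto simp: algebra_simps)
  have sum: "is_dyadic (max k l) (a + b)"
    by (intro is_dyadic_add is_dyadic_mono[OF exact_is_dyadic[OF kl(1)]] is_dyadic_mono[OF exact_is_dyadic[OF kl(2)]]) auto
  consider "k = 0" "l = 0" | "l \<le> k" "k \<noteq> 0" | "k \<le> l" "l \<noteq> 0" by linarith
  then show ?thesis
  proof cases
    case 1
    \<comment> \<open>Integers have options towards 0 only, so \<open>p\<close> forces
      \<open>sgn (a + b) = \<sigma>\<close>. Then one summand has this sign and a neighbour on the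
      required side.\<close>
    have "exact_dyadic 0 (a + b)"
      using sum 1 by (auto simp: is_dyadic_def exact_dyadic_def)
    then have "sgn (a + b) = \<sigma>"
      using real_opts_int_sgn[OF _ p \<sigma> pos] by simp
    then have "sgn a = \<sigma> \<or> sgn b = \<sigma>"
      using \<sigma> by (auto simp: sgn_if split: if_splits)
    then show ?thesis
      using real_opts_neighbour[OF kl(1) \<sigma>, where 'a = 'a] real_opts_neighbour[OF kl(2) \<sigma>, where 'a = 'a]
        main[of a 0] main[of b 0] sum 1 by auto
  next
    case 2
    then show ?thesis
      using real_opts_neighbour[OF kl(1) \<sigma>, where 'a = 'a] main[of a k] sum by (simp add: max_absorb1)
  next
    case 3
    then show ?thesis
      using real_opts_neighbour[OF kl(2) \<sigma>, where 'a = 'a] main[of b l] sum by (simp add: max_absorb2)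
  qed
qed

lemma real_opts_exact_nonempty:
  assumes "exact_dyadic k r" "r \<noteq> 0"
  obtains \<tau> where "\<tau> \<in> {1, -1}" "r - \<tau> / 2 ^ k \<in> real_opts TYPE('a::infinite) r" "k = 0 \<Longrightarrow> sgn r = \<tau>"
proof
  show "sgn r \<in> {1, -1}" using assms(2) by (auto simp: sgn_if)
  then show "r - sgn r / 2 ^ k \<in> real_opts TYPE('a) r"
    by (rule real_opts_neighbour[OF assms(1)]) simp
qed simp

lemma real_opts_nonempty:
  assumes "r \<noteq> 0"
  shows "real_opts TYPE('a::infinite) r \<noteq> {}"
proof (cases "\<exists>k. is_dyadic k r")
  case True
  then show ?thesis
    using is_dyadic_exact real_opts_exact_nonempty[OF _ assms, where 'a = 'a] by (metis empty_iff)
next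
  case False
  then show ?thesis using real_opts_approx[of r 1 1, where 'a = 'a] by auto
qed

text \<open>The option from \<open>q\<close> and \<open>s\<close> is
  \<open>a * b - (a - q) * (b - s)\<close>, so a product of gaps has to be small and of the right
  sign. A non-dyadic factor makes it arbitrarily small; for dyadic factors the neighbours give
  exactly \<open>1 / 2 ^ (k + l)\<close>, and no option of \<open>a * b\<close> is nearer to
  it.\<close>

lemma real_opts_mult:
  assumes p: "p \<in> real_opts TYPE('a::infinite) (a * b)" and \<sigma>: "\<sigma> \<in> {1, -1}"
    and pos: "0 < \<sigma> * (a * b - p)"
  shows "\<exists>q\<in>real_opts TYPE('a) a. \<exists>s\<in>real_opts TYPE('a) b.
      0 < \<sigma> * ((a - q) * (b - s)) \<and> \<sigma> * ((a - q) * (b - s)) \<le> \<sigma> * (a * b - p)"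
proof -
  have nz: "a \<noteq> 0" "b \<noteq> 0" using p real_opts_0[where 'a = 'a] by auto
  have nondyadic: "\<exists>q\<in>real_opts TYPE('a) a. \<exists>s\<in>real_opts TYPE('a) b.
      0 < \<sigma> * ((a - q) * (b - s)) \<and> \<sigma> * ((a - q) * (b - s)) \<le> \<sigma> * (a * b - p)"
    if a: "\<And>k. \<not> is_dyadic k a" and "b \<noteq> 0" "0 < \<sigma> * (a * b - p)" for a b
  proof -
    obtain s where s: "s \<in> real_opts TYPE('a) b" using real_opts_nonempty[OF \<open>b \<noteq> 0\<close>] by blast
    then have "b - s \<noteq> 0" using real_opts_irrefl[of b, where 'a = 'a] by auto
    \<comment> \<open>The side of \<open>a\<close> on which \<open>q\<close> must lie, given the
      side of \<open>b\<close> on which \<open>s\<close> was found.\<close>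
    define \<tau> where "\<tau> = \<sigma> * sgn (b - s)"
    have \<tau>: "\<tau> \<in> {1, -1}" "0 < \<sigma> * (a * b - p) / \<bar>b - s\<bar>"
      using \<sigma> \<open>b - s \<noteq> 0\<close> that(3) by (auto simp: \<tau>_def sgn_if)
    obtain q where q: "q \<in> real_opts TYPE('a) a" "0 < \<tau> * (a - q)" "\<tau> * (a - q) < \<sigma> * (a * b - p) / \<bar>b - s\<bar>"
      using real_opts_approx[OF a \<tau>, where 'a = 'a] by blast
    have "\<sigma> * ((a - q) * (b - s)) = \<tau> * (a - q) * \<bar>b - s\<bar>"
      by (simp add: \<tau>_def abs_sgn mult_ac)
    moreover have "0 < \<tau> * (a - q) * \<bar>b - s\<bar>" "\<tau> * (a - q) * \<bar>b - s\<bar> \<le> \<sigma> * (a * b - p)"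
      using q \<open>b - s \<noteq> 0\<close> by (auto simp: pos_less_divide_eq less_imp_le)
    ultimately show ?thesis using s q(1) by (intro bexI[OF _ q(1)] bexI[OF _ s]) metis
  qed
  show ?thesis
  proof (cases "(\<exists>k. is_dyadic k a) \<and> (\<exists>k. is_dyadic k b)")
    case False
    then consider "\<And>k. \<not> is_dyadic k a" | "\<And>k. \<not> is_dyadic k b" by blast
    then show ?thesis
    proof cases
      case 1
      then show ?thesis using nondyadic[of a b] nz pos by blast
    next
      case 2
      then show ?thesis using nondyadic[of b a] nz pos by (simp add: mult.commute) blast
    qed
  next
    case True
    then obtain k l where kl: "exact_dyadic k a" "exact_dyadic l b"
      using is_dyadic_exact by blast
    have prod: "is_dyadic (k + l) (a * b)"
      by (intro is_dyadic_mult exact_is_dyadic kl)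
    have d: "1 / 2 ^ (k + l) \<le> \<sigma> * (a * b - p)"
      by (rule is_dyadic_dist[OF prod real_opts_is_dyadic[OF prod p] \<sigma> pos])
    obtain \<alpha> where \<alpha>: "\<alpha> \<in> {1, -1}" "a - \<alpha> / 2 ^ k \<in> real_opts TYPE('a) a" "k = 0 \<Longrightarrow> sgn a = \<alpha>"
      using real_opts_exact_nonempty[OF kl(1) nz(1), where 'a = 'a] by metis
    obtain \<beta> where \<beta>: "\<beta> \<in> {1, -1}" "b - \<beta> / 2 ^ l \<in> real_opts TYPE('a) b" "l = 0 \<Longrightarrow> sgn b = \<beta>"
      using real_opts_exact_nonempty[OF kl(2) nz(2), where 'a = 'a] by metis
    have main: ?thesis if "a - \<alpha>' / 2 ^ k \<in> real_opts TYPE('a) a" "b - \<beta>' / 2 ^ l \<in> real_opts TYPE('a) b"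
      "\<sigma> * (\<alpha>' * \<beta>') = 1" for \<alpha>' \<beta>'
    proof -
      have "\<sigma> * ((a - (a - \<alpha>' / 2 ^ k)) * (b - (b - \<beta>' / 2 ^ l))) = \<sigma> * (\<alpha>' * \<beta>') / 2 ^ (k + l)"
        by (simp add: power_add)
      then show ?thesis using that d by (intro bexI[OF _ that(1)] bexI[OF _ that(2)]) simp
    qed
    have s: "\<sigma> * \<beta> \<in> {1, -1}" "\<sigma> * \<alpha> \<in> {1, -1}" "\<sigma> * \<sigma> = 1" "\<alpha> * \<alpha> = 1" "\<beta> * \<beta> = 1"
      using \<sigma> \<alpha>(1) \<beta>(1) by auto
    \<comment> \<open>Two integers have one neighbour each, and the sign of \<open>a * b\<close>
      makes these fit. Otherwise a non-integral factor has neighbours on both sides and adapts its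
      sign to the other factor.\<close>
    consider "k = 0" "l = 0" | "k \<noteq> 0" | "l \<noteq> 0" by blast
    then show ?thesis
    proof cases
      case 1
      have "exact_dyadic 0 (a * b)"
        using prod 1 by (auto simp: is_dyadic_def exact_dyadic_def)
      then have "sgn (a * b) = \<sigma>"
        using real_opts_int_sgn[OF _ p \<sigma> pos] by simp
      then have "\<alpha> * \<beta> = \<sigma>" using \<alpha>(3) \<beta>(3) 1 by (simp add: sgn_mult)
      then show ?thesis using main[OF \<alpha>(2) \<beta>(2)] s(3) by simp
    next
      case 2
      then have "a - \<sigma> * \<beta> / 2 ^ k \<in> real_opts TYPE('a) a"
        by (intro real_opts_neighbour[OF kl(1)] s) simp
      then show ?thesis using main[OF _ \<beta>(2)] s by (simp add: mult_ac)
    next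
      case 3
      then have "b - \<sigma> * \<alpha> / 2 ^ l \<in> real_opts TYPE('a) b"
        by (intro real_opts_neighbour[OF kl(2)] s) simp
      then show ?thesis using main[OF \<alpha>(2)] s by (simp add: mult_ac)
    qed
  qed
qed

section \<open>The embedding preserves the field operations and the absolute value\<close>

lemma real_opts_simpler_rel:
  "p \<in> real_opts TYPE('a::infinite) r \<Longrightarrow> (surreal_of_real p :: 'a surreal, surreal_of_real r) \<in> simpler_rel"
  by (simp add: real_opts_def opts_simpler_rel)

lemma surreal_of_real_add:
  "surreal_of_real (a + b) = (surreal_of_real a + surreal_of_real b :: 'a::infinite surreal)"
proof -
  have "wf (inv_image (simpler_rel <*lex*> simpler_rel)
      (\<lambda>(a, b). (surreal_of_real a :: 'a surreal, surreal_of_real b :: 'a surreal)))"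
    by (intro wf_inv_image wf_lex_prod wf_simpler_rel)
  then show ?thesis
  proof (induction "(a, b)" arbitrary: a b rule: wf_induct_rule)
    case less
    let ?i = "surreal_of_real :: real \<Rightarrow> 'a surreal"
    have IH: "\<And>q. q \<in> real_opts TYPE('a) a \<Longrightarrow> ?i q + ?i b = ?i (q + b)"
      "\<And>q. q \<in> real_opts TYPE('a) b \<Longrightarrow> ?i a + ?i q = ?i (a + q)"
      by (rule less[symmetric], simp add: real_opts_simpler_rel)+
    let ?L = "(\<lambda>q. q + b) ` {q \<in> real_opts TYPE('a) a. q < a} \<union> (\<lambda>q. a + q) ` {q \<in> real_opts TYPE('a) b. q < b}"
    let ?R = "(\<lambda>q. q + b) ` {q \<in> real_opts TYPE('a) a. a < q} \<union> (\<lambda>q. a + q) ` {q \<in> real_opts TYPE('a) b. b < q}"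
    have "?i a + ?i b = simplest (?i ` ?L) (?i ` ?R)"
      unfolding add_rec[of "?i a" "?i b"] left_opts_surreal_of_real right_opts_surreal_of_real image_Un image_image
      by (intro arg_cong2[where f = simplest] arg_cong2[where f = "(\<union>)"] image_cong refl)
        (simp_all add: IH)
    also have "\<dots> = ?i (a + b)"
    proof (rule simplest_surreal_of_real)
      show "\<exists>l\<in>?L. p \<le> l" if "p \<in> real_opts TYPE('a) (a + b)" "p < a + b" for p
        using real_opts_add[of p a b 1, where 'a = 'a] that by (fastforce simp: bex_Un)
      show "\<exists>r\<in>?R. r \<le> p" if "p \<in> real_opts TYPE('a) (a + b)" "a + b < p" for p
        using real_opts_add[of p a b "-1", where 'a = 'a] that by (fastforce simp: bex_Un)
    qed auto
    finally show ?case ..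
  qed
qed

lemma surreal_of_real_minus: "surreal_of_real (- a) = (- surreal_of_real a :: 'a::infinite surreal)"
  by (rule minus_unique[symmetric]) (simp flip: surreal_of_real_add)

lemma surreal_of_real_diff:
  "surreal_of_real (a - b) = (surreal_of_real a - surreal_of_real b :: 'a::infinite surreal)"
  using surreal_of_real_add[of a "- b", where 'a = 'a] by (simp add: surreal_of_real_minus)

lemma surreal_of_real_mult:
  "surreal_of_real (a * b) = (surreal_of_real a * surreal_of_real b :: 'a::infinite surreal)"
proof -
  have "wf (inv_image (simpler_rel <*lex*> simpler_rel)
      (\<lambda>(a, b). (surreal_of_real a :: 'a surreal, surreal_of_real b :: 'a surreal)))"
    by (intro wf_inv_image wf_lex_prod wf_simpler_rel)
  then show ?thesis
  proof (induction "(a, b)" arbitrary: a b rule: wf_induct_rule)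
    case less
    let ?i = "surreal_of_real :: real \<Rightarrow> 'a surreal"
    let ?f = "\<lambda>q s. q * b + a * s - q * s"
    let ?A = "real_opts TYPE('a) a" and ?B = "real_opts TYPE('a) b"
    have IH: "mult_option (?i a) (?i b) (?i q) (?i s) = ?i (?f q s)" if "q \<in> ?A" "s \<in> ?B" for q s
    proof -
      have "?i (q * b) = ?i q * ?i b" "?i (a * s) = ?i a * ?i s" "?i (q * s) = ?i q * ?i s"
        by (rule less, simp add: real_opts_simpler_rel that)+
      then show ?thesis
        by (simp add: mult_option_def surreal_of_real_add surreal_of_real_diff)
    qed
    let ?L = "(\<Union>q\<in>{q \<in> ?A. q < a}. ?f q ` {s \<in> ?B. s < b}) \<union> (\<Union>q\<in>{q \<in> ?A. a < q}. ?f q ` {s \<in> ?B. b < s})"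
    let ?R = "(\<Union>q\<in>{q \<in> ?A. q < a}. ?f q ` {s \<in> ?B. b < s}) \<union> (\<Union>q\<in>{q \<in> ?A. a < q}. ?f q ` {s \<in> ?B. s < b})"
    have "?i a * ?i b = simplest (?i ` ?L) (?i ` ?R)"
      unfolding mult_rec[of "?i a" "?i b"] mult_left_def mult_right_def left_opts_surreal_of_real
        right_opts_surreal_of_real image_Un image_UN image_image
      by (intro arg_cong2[where f = simplest] arg_cong2[where f = "(\<union>)"] SUP_cong image_cong refl)
        (simp_all add: IH)
    also have "\<dots> = ?i (a * b)"
    proof (rule simplest_surreal_of_real)
      \<comment> \<open>So the side of \<open>a * b\<close> on which an option lies depends only on
        whether \<open>a - q\<close> and \<open>b - s\<close> have the same sign.\<close>
      have f: "?f q s = a * b - (a - q) * (b - s)" for q s by (simp add: algebra_simps)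
      show "l < a * b" if "l \<in> ?L" for l
        using that unfolding f by (auto simp: mult_pos_pos mult_neg_neg)
      show "a * b < r" if "r \<in> ?R" for r
        using that unfolding f by (auto simp: mult_pos_neg mult_neg_pos)
      show "\<exists>l\<in>?L. p \<le> l" if p: "p \<in> real_opts TYPE('a) (a * b)" "p < a * b" for p
      proof -
        obtain q s where "q \<in> ?A" "s \<in> ?B" and *: "0 < (a - q) * (b - s)" "(a - q) * (b - s) \<le> a * b - p"
          using real_opts_mult[of p a b 1, where 'a = 'a] p by auto
        moreover have "q < a \<and> s < b \<or> a < q \<and> b < s"
          using *(1) by (auto simp: zero_less_mult_iff)
        ultimately have "?f q s \<in> ?L" "p \<le> ?f q s" unfolding f by auto
        then show ?thesis by blast
      qed
      show "\<exists>r\<in>?R. r \<le> p" if p: "p \<in> real_opts TYPE('a) (a * b)" "a * b < p" for p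
      proof -
        obtain q s where "q \<in> ?A" "s \<in> ?B" and *: "(a - q) * (b - s) < 0" "a * b - p \<le> (a - q) * (b - s)"
          using real_opts_mult[of p a b "-1", where 'a = 'a] p by auto
        moreover have "q < a \<and> b < s \<or> a < q \<and> s < b"
          using *(1) by (auto simp: mult_less_0_iff)
        ultimately have "?f q s \<in> ?R" "?f q s \<le> p" unfolding f by auto
        then show ?thesis by blast
      qed
    qed
    finally show ?case ..
  qed
qed

lemma surreal_of_real_inverse:
  "surreal_of_real (inverse a) = (inverse (surreal_of_real a) :: 'a::infinite surreal)"
proof (cases "a = 0")
  case True
  \<comment> \<open>Both inverses take the default value 0 at 0.\<close>
  then show ?thesis by (simp add: inverse_surreal_def)
next
  case False
  have nz: "surreal_of_real a \<noteq> (0 :: 'a surreal)"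
    using False surreal_of_real_inject[of a 0, where 'a = 'a] by simp
  have *: "surreal_of_real a * surreal_of_real (inverse a) = (1 :: 'a surreal)"
    using False by (simp flip: surreal_of_real_mult)
  have "(THE y :: 'a surreal. surreal_of_real a * y = 1) = surreal_of_real (inverse a)"
    using * mult_left_cancel_surreal[OF nz] by (intro the_equality) metis+
  then show ?thesis using nz by (simp add: inverse_surreal_def)
qed

lemma surreal_of_real_divide:
  "surreal_of_real (a / b) = (surreal_of_real a div surreal_of_real b :: 'a::infinite surreal)"
  by (simp add: divide_surreal_def divide_inverse surreal_of_real_mult surreal_of_real_inverse)

lemma surreal_of_real_power: "surreal_of_real (a ^ n) = (surreal_of_real a ^ n :: 'a::infinite surreal)"
  by (induction n) (simp_all add: surreal_of_real_mult)

lemma surreal_of_real_abs: "surreal_of_real \<bar>a\<bar> = \<bar>surreal_of_real a :: 'a::infinite surreal\<bar>"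
  using surreal_of_real_less_iff[of a 0, where 'a = 'a]
  by (auto simp: abs_surreal_def abs_if surreal_of_real_minus)

text \<open>If \<open>p\<close> is nonzero, then 0, the empty expansion, is an initial segment of
  it, and \<open>r\<close> extends \<open>p\<close>, so \<open>p\<close> and \<open>r\<close> lie on
  the same side of 0.\<close>

lemma real_opts_same_sign:
  assumes "p \<in> real_opts TYPE('a::infinite) r"
  shows "0 \<le> r * p"
proof (rule ccontr)
  let ?i = "surreal_of_real :: real \<Rightarrow> 'a surreal"
  assume "\<not> ?thesis"
  then consider "p < 0" "0 < r" | "0 < p" "r < 0"
    by (auto simp: not_le mult_less_0_iff)
  then show False
  proof cases
    case 1
    then have "?i p < 0" "0 < ?i r"
      using surreal_of_real_less_iff[of p 0, where 'a = 'a] surreal_of_real_less_iff[of 0 r, where 'a = 'a] by auto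
    from this(1) show False
    proof (cases rule: less_cases)
      case right
      then show False
        using options_less_cong[of 0 "?i p" "?i r"] assms \<open>?i p < 0\<close> \<open>0 < ?i r\<close>
        by (auto simp: real_opts_def right_opts_iff)
    qed simp_all
  next
    case 2
    then have "0 < ?i p" "?i r < 0"
      using surreal_of_real_less_iff[of r 0, where 'a = 'a] surreal_of_real_less_iff[of 0 p, where 'a = 'a] by auto
    from this(1) show False
    proof (cases rule: less_cases)
      case left
      then show False
        using options_less_cong'[of 0 "?i p" "?i r"] assms \<open>0 < ?i p\<close> \<open>?i r < 0\<close>
        by (auto simp: real_opts_def left_opts_iff)
    qed simp_all
  qed
qed

section \<open>Maclaurin sums of \<open>arctan\<close> and \<open>nlog\<close>\<close>

lemma higher_deriv_0:
  fixes f :: "real \<Rightarrow> real"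
  assumes "f has_fps_expansion F"
  shows "(deriv ^^ n) f 0 = fact n * fps_nth F n"
proof -
  have "(deriv ^^ n) f has_fps_expansion (fps_deriv ^^ n) F"
    by (induction n) (auto intro: assms has_fps_expansion_deriv)
  then have "eval_fps ((fps_deriv ^^ n) F) 0 = (deriv ^^ n) f 0"
    unfolding has_fps_expansion_def using eventually_nhds_x_imp_x by blast
  then show ?thesis
    by (simp add: eval_fps_at_0 fps_0th_higher_deriv)
qed

text \<open>The derivatives of \<open>arctan\<close> and \<open>nlog\<close> are rational near 0, so
  their series come from inverting a polynomial; the function itself enters only through the index
  shift.\<close>

lemma higher_deriv_Suc_0:
  fixes f :: "real \<Rightarrow> real"
  assumes "deriv f has_fps_expansion F"
  shows "(deriv ^^ Suc n) f 0 / fact (Suc n) = fps_nth F n / real (Suc n)"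
  using higher_deriv_0[OF assms, of n] by (simp add: funpow_Suc_right del: funpow.simps)

lemma deriv_arctan_expansion: "deriv arctan has_fps_expansion inverse (1 + fps_X ^ 2 :: real fps)"
proof -
  have "deriv arctan = (\<lambda>x::real. inverse (1 + x ^ 2))"
    by (intro ext DERIV_imp_deriv DERIV_arctan)
  then show ?thesis
    by (simp only:) (intro fps_expansion_intros, simp)
qed

text \<open>Coefficients of the derivative \<open>1 / (1 + x ^ 2)\<close>, not of
  \<open>arctan\<close> itself.\<close>

definition arctan_coeff :: "nat \<Rightarrow> real" where
  "arctan_coeff n = (if even n then (-1) ^ (n div 2) else 0)"

lemma fps_nth_inverse_1_plus_X2: "fps_nth (inverse (1 + fps_X ^ 2 :: real fps)) n = arctan_coeff n"
proof -
  have "(1 + fps_X ^ 2) * Abs_fps arctan_coeff = 1"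
  proof (rule fps_ext)
    fix n
    have "arctan_coeff n + (if n < 2 then 0 else arctan_coeff (n - 2)) = (if n = 0 then 1 else 0)"
    proof (cases "n < 2")
      case True
      then have "n = 0 \<or> n = 1" by auto
      then show ?thesis by (auto simp: arctan_coeff_def)
    next
      case False
      then obtain m where "n = m + 2" by (metis add.commute le_Suc_ex not_less)
      then show ?thesis by (simp add: arctan_coeff_def)
    qed
    then show "fps_nth ((1 + fps_X ^ 2) * Abs_fps arctan_coeff) n = fps_nth 1 n"
      by (simp only: distrib_right fps_add_nth fps_X_power_mult_nth fps_nth_Abs_fps fps_one_nth mult_1)
  qed
  then have "Abs_fps arctan_coeff = inverse (1 + fps_X ^ 2)"
    by (intro fps_inverse_unique[symmetric]) (simp add: mult.commute)
  then show ?thesis by (metis fps_nth_Abs_fps)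
qed

lemma deriv_nlog_expansion: "deriv nlog has_fps_expansion inverse (1 - fps_X :: real fps)"
proof -
  \<comment> \<open>For \<open>x < 1\<close> the logarithm is taken at a positive argument; an
    expansion at 0 asks for agreement only near 0.\<close>
  have "deriv nlog x = inverse (1 - x)" if "x < 1" for x
    unfolding nlog_def using that by (intro DERIV_imp_deriv) (auto intro!: derivative_eq_intros simp: field_simps)
  moreover have "eventually (\<lambda>x::real. x < 1) (nhds 0)"
    by (intro eventually_nhds_in_open[of "{..<1}", simplified]) auto
  ultimately have "\<forall>\<^sub>F x in nhds 0. inverse (1 - x) = deriv nlog x"
    by (auto elim!: eventually_mono)
  moreover have "(\<lambda>x. inverse (1 - x)) has_fps_expansion inverse (1 - fps_X :: real fps)"
    by (intro fps_expansion_intros) simp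
  ultimately show ?thesis
    unfolding has_fps_expansion_def by (auto elim: eventually_elim2)
qed

text \<open>\<open>N\<close> counts terms, so the truncation at degree \<open>m\<close> has
  \<open>N = m + 1\<close>, and degree -1 is the empty sum.\<close>

definition real_trunc :: "(real \<Rightarrow> real) \<Rightarrow> nat \<Rightarrow> real \<Rightarrow> real" where
  "real_trunc f N u = (\<Sum>i<N. (deriv ^^ i) f 0 / fact i * u ^ i)"

lemma trunc_surreal_of_real:
  "trunc f m (surreal_of_real u) = (surreal_of_real (real_trunc f (nat (m + 1)) u) :: 'a::infinite surreal)"
proof -
  have "maclaurin_sum f N (surreal_of_real u) = (surreal_of_real (real_trunc f N u) :: 'a surreal)" for N
    by (induction N)
      (simp_all add: real_trunc_def surreal_of_real_add surreal_of_real_mult surreal_of_real_power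
        del: times_divide_eq_left)
  then show ?thesis by (simp add: trunc_def)
qed

text \<open>\<open>m\<close> counts the terms of odd degree: degree \<open>4 * n - 1\<close> means
  \<open>2 * n\<close> terms, degree \<open>4 * n + 1\<close> means \<open>2 * n + 1\<close> terms.
  So the parity of \<open>m\<close> distinguishes lower from upper bounds.\<close>

definition arctan_sum :: "nat \<Rightarrow> real \<Rightarrow> real" where
  "arctan_sum m u = (\<Sum>j<m. (-1) ^ j / real (2 * j + 1) * u ^ (2 * j + 1))"

lemma real_trunc_arctan: "real_trunc arctan (2 * m) u = arctan_sum m u"
proof (induction m)
  case (Suc m)
  have c: "(deriv ^^ Suc n) arctan 0 / fact (Suc n) = arctan_coeff n / real (Suc n)" for n
    using higher_deriv_Suc_0[OF deriv_arctan_expansion] by (simp only: fps_nth_inverse_1_plus_X2)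
  have "(deriv ^^ (2 * m)) arctan 0 / fact (2 * m) = 0"
  proof (cases m)
    case (Suc l)
    then have "2 * m = Suc (2 * l + 1)" by simp
    then show ?thesis using c[of "2 * l + 1"] by (simp only:) (simp add: arctan_coeff_def)
  qed simp
  moreover have "(deriv ^^ Suc (2 * m)) arctan 0 / fact (Suc (2 * m)) = (-1) ^ m / real (2 * m + 1)"
    unfolding c by (simp add: arctan_coeff_def)
  ultimately have "real_trunc arctan (2 * Suc m) u = real_trunc arctan (2 * m) u + (-1) ^ m / real (2 * m + 1) * u ^ Suc (2 * m)"
    by (simp add: real_trunc_def del: funpow.simps fact_Suc times_divide_eq_left)
  then show ?case by (simp add: Suc arctan_sum_def)
qed (simp add: real_trunc_def arctan_sum_def)

text \<open>The constant term vanishes, so \<open>N\<close> is both the number of terms and the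
  degree.\<close>

definition nlog_sum :: "nat \<Rightarrow> real \<Rightarrow> real" where
  "nlog_sum N u = (\<Sum>i<N. 1 / real (Suc i) * u ^ Suc i)"

lemma real_trunc_nlog: "real_trunc nlog (Suc N) u = nlog_sum N u"
proof (induction N)
  case 0
  show ?case by (simp add: real_trunc_def nlog_sum_def nlog_def)
next
  case (Suc N)
  have "fps_nth (inverse (1 - fps_X :: real fps)) N = 1"
    by (metis fps_inverse_gp' fps_inverse_idempotent fps_nth_Abs_fps zero_neq_one)
  then have "(deriv ^^ Suc N) nlog 0 / fact (Suc N) = 1 / real (Suc N)"
    using higher_deriv_Suc_0[OF deriv_nlog_expansion, of N] by simp
  then show ?case
    using Suc by (simp add: real_trunc_def nlog_sum_def del: funpow.simps fact_Suc times_divide_eq_left)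
qed

lemma arctan_sum_minus: "arctan_sum m (- u) = - arctan_sum m u"
  by (simp add: arctan_sum_def sum_negf)

text \<open>The partial sum has a geometric sum as derivative, so the derivative of the error has
  the constant sign \<open>(-1) ^ m\<close> away from 0. The strict bounds derived from it hold for
  all \<open>u > 0\<close>, also where the series diverges.\<close>

lemma arctan_sum_deriv:
  "((\<lambda>u. arctan u - arctan_sum m u) has_real_derivative (-1) ^ m * u ^ (2 * m) / (1 + u\<^sup>2)) (at u)"
proof -
  have nz: "1 + u\<^sup>2 \<noteq> 0" by (metis add_pos_nonneg less_irrefl zero_le_power2 zero_less_one)
  have "((\<lambda>u. arctan_sum m u) has_real_derivative (\<Sum>j<m. (-1) ^ j * u ^ (2 * j))) (at u)"
    unfolding arctan_sum_def
  proof (rule DERIV_sum)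
    fix j
    have "c / r * (r * x) = c * x" if "r \<noteq> 0" for c r x :: real
      using that by simp
    from this[of "real (2 * j + 1)"]
    show "((\<lambda>u. (-1) ^ j / real (2 * j + 1) * u ^ (2 * j + 1)) has_real_derivative (-1) ^ j * u ^ (2 * j)) (at u)"
      by (intro DERIV_cong[OF DERIV_cmult[OF DERIV_pow]]) simp
  qed
  moreover have "(\<Sum>j<m. (-1) ^ j * u ^ (2 * j)) = (1 - (-1) ^ m * u ^ (2 * m)) / (1 + u\<^sup>2)"
  proof -
    have "(1 + u\<^sup>2) * (\<Sum>j<m. (-1) ^ j * u ^ (2 * j)) = 1 - (-1) ^ m * u ^ (2 * m)"
      by (induction m) (auto simp: algebra_simps power2_eq_square)
    then show ?thesis using nz by (simp add: field_simps)
  qed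
  ultimately show ?thesis
    using nz by (auto intro!: derivative_eq_intros simp: field_simps)
qed

lemma arctan_sum_bounds:
  assumes "0 < u"
  shows "even m \<Longrightarrow> arctan_sum m u < arctan u" "odd m \<Longrightarrow> arctan u < arctan_sum m u"
proof -
  have 0: "arctan_sum m 0 = 0" by (simp add: arctan_sum_def)
  have cont: "continuous_on {0..u} (\<lambda>u. arctan u - arctan_sum m u)"
    using DERIV_continuous[OF arctan_sum_deriv] by (intro continuous_at_imp_continuous_on) blast
  have pos: "0 < x ^ (2 * m) / (1 + x\<^sup>2)" if "0 < x" for x :: real
    using that by (intro divide_pos_pos) (auto intro: add_pos_nonneg)
  show "arctan_sum m u < arctan u" if "even m"
  proof -
    have "arctan 0 - arctan_sum m 0 < arctan u - arctan_sum m u"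
      by (rule DERIV_pos_imp_increasing_open[OF assms _ cont])
        (use arctan_sum_deriv[of m] pos that in fastforce)
    then show ?thesis by (simp add: 0)
  qed
  show "arctan u < arctan_sum m u" if "odd m"
  proof -
    have "arctan 0 - arctan_sum m 0 > arctan u - arctan_sum m u"
      by (rule DERIV_neg_imp_decreasing_open[OF assms _ cont])
        (use arctan_sum_deriv[of m] pos that in fastforce)
    then show ?thesis by (simp add: 0)
  qed
qed

text \<open>Consecutive partial sums enclose \<open>arctan u\<close>.\<close>

lemma arctan_sum_tendsto:
  assumes "\<bar>u\<bar> \<le> 1"
  shows "(\<lambda>m. arctan_sum m u) \<longlonglongrightarrow> arctan u"
proof -
  have *: "(\<lambda>m. arctan_sum m u) \<longlonglongrightarrow> arctan u" if "0 < u" "u \<le> 1" for u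
  proof (rule metric_LIMSEQ_I)
    fix e :: real assume "0 < e"
    then obtain N where N: "1 / real (Suc N) < e"
      using reals_Archimedean by (auto simp: inverse_eq_divide)
    have "dist (arctan_sum m u) (arctan u) < e" if "m \<ge> N" for m
    proof -
      have "arctan_sum (Suc m) u - arctan_sum m u = (-1) ^ m * u ^ (2 * m + 1) / real (2 * m + 1)"
        by (simp add: arctan_sum_def)
      then have "\<bar>arctan_sum (Suc m) u - arctan_sum m u\<bar> = u ^ (2 * m + 1) / real (2 * m + 1)"
        using \<open>0 < u\<close> by (simp add: abs_mult power_abs)
      also have "\<dots> \<le> 1 / real (2 * m + 1)"
        using \<open>0 < u\<close> \<open>u \<le> 1\<close> by (intro divide_right_mono power_le_one) auto
      also have "\<dots> \<le> 1 / real (Suc N)"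
        using that by (intro divide_left_mono) auto
      finally have "\<bar>arctan_sum (Suc m) u - arctan_sum m u\<bar> < e" using N by simp
      then show ?thesis
        using arctan_sum_bounds[OF \<open>0 < u\<close>, of m] arctan_sum_bounds[OF \<open>0 < u\<close>, of "Suc m"]
        by (cases "even m") (auto simp: dist_real_def abs_real_def split: if_splits)
    qed
    then show "\<exists>N. \<forall>m\<ge>N. dist (arctan_sum m u) (arctan u) < e" by blast
  qed
  consider "u = 0" | "0 < u" | "0 < - u" by linarith
  then show ?thesis
  proof cases
    case 1
    then show ?thesis by (simp add: arctan_sum_def)
  next
    case 2
    then show ?thesis using assms by (intro *) auto
  next
    case 3
    then have "(\<lambda>m. arctan_sum m (- u)) \<longlonglongrightarrow> arctan (- u)" using assms by (intro *) auto
    then show ?thesis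
      using tendsto_minus_cancel by (simp add: arctan_sum_minus arctan_minus tendsto_minus_cancel_left)
  qed
qed

text \<open>Again a geometric sum. The sign of \<open>u ^ N\<close> makes every partial sum a lower
  bound for \<open>0 < u\<close>, whereas for \<open>u < 0\<close> the bounds alternate with
  \<open>N\<close>.\<close>

lemma nlog_sum_deriv:
  assumes "u < 1"
  shows "((\<lambda>u. nlog u - nlog_sum N u) has_real_derivative u ^ N / (1 - u)) (at u)"
proof -
  have "((\<lambda>u. nlog_sum N u) has_real_derivative (\<Sum>j<N. u ^ j)) (at u)"
    unfolding nlog_sum_def
  proof (rule DERIV_sum)
    show "((\<lambda>u. 1 / real (Suc j) * u ^ Suc j) has_real_derivative u ^ j) (at u)" for j
      using DERIV_cmult[OF DERIV_pow[of "Suc j" u], of "1 / real (Suc j)"]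
      by (simp del: power_Suc)
  qed
  moreover have "(\<Sum>j<N. u ^ j) = (1 - u ^ N) / (1 - u)"
    using assms sum_gp_strict[of u N] by simp
  moreover have "(nlog has_real_derivative 1 / (1 - u)) (at u)"
    unfolding nlog_def using assms by (auto intro!: derivative_eq_intros)
  ultimately have "((\<lambda>u. nlog u - nlog_sum N u) has_real_derivative 1 / (1 - u) - (1 - u ^ N) / (1 - u)) (at u)"
    by (auto intro!: derivative_intros)
  then show ?thesis by (simp add: diff_divide_distrib)
qed

lemma nlog_sum_less:
  assumes "0 < u" "u < 1"
  shows "nlog_sum N u < nlog u"
proof -
  have "nlog 0 - nlog_sum N 0 < nlog u - nlog_sum N u"
  proof (rule DERIV_pos_imp_increasing_open[OF assms(1)])
    show "\<exists>y. ((\<lambda>u. nlog u - nlog_sum N u) has_real_derivative y) (at x) \<and> 0 < y" if "0 < x" "x < u" for x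
      using that assms nlog_sum_deriv[of x N] by (intro exI[of _ "x ^ N / (1 - x)"]) auto
    show "continuous_on {0..u} (\<lambda>u. nlog u - nlog_sum N u)"
      using assms DERIV_continuous[OF nlog_sum_deriv] by (intro continuous_at_imp_continuous_on) auto
  qed
  then show ?thesis by (simp add: nlog_def nlog_sum_def)
qed

lemma nlog_sum_bounds_neg:
  assumes "u < 0"
  shows "odd N \<Longrightarrow> nlog_sum N u < nlog u" "even N \<Longrightarrow> nlog u < nlog_sum N u"
proof -
  have cont: "continuous_on {u..0} (\<lambda>u. nlog u - nlog_sum N u)"
    using DERIV_continuous[OF nlog_sum_deriv] by (intro continuous_at_imp_continuous_on) auto
  have 0: "nlog 0 - nlog_sum N 0 = 0" by (simp add: nlog_def nlog_sum_def)
  show "nlog_sum N u < nlog u" if "odd N"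
  proof -
    have "nlog u - nlog_sum N u > nlog 0 - nlog_sum N 0"
    proof (rule DERIV_neg_imp_decreasing_open[OF assms _ cont])
      show "\<exists>y. ((\<lambda>u. nlog u - nlog_sum N u) has_real_derivative y) (at x) \<and> y < 0" if "u < x" "x < 0" for x
        using that \<open>odd N\<close> nlog_sum_deriv[of x N]
        by (intro exI[of _ "x ^ N / (1 - x)"]) (auto simp: divide_less_0_iff power_less_zero_eq)
    qed
    then show ?thesis by (simp add: 0)
  qed
  show "nlog u < nlog_sum N u" if "even N"
  proof -
    have "nlog u - nlog_sum N u < nlog 0 - nlog_sum N 0"
    proof (rule DERIV_pos_imp_increasing_open[OF assms _ cont])
      show "\<exists>y. ((\<lambda>u. nlog u - nlog_sum N u) has_real_derivative y) (at x) \<and> y > 0" if "u < x" "x < 0" for x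
        using that \<open>even N\<close> nlog_sum_deriv[of x N]
        by (intro exI[of _ "x ^ N / (1 - x)"]) (auto simp: zero_less_divide_iff zero_less_power_eq)
    qed
    then show ?thesis by (simp add: 0)
  qed
qed

text \<open>For \<open>u < 0\<close> consecutive sums enclose the limit, which covers the endpoint
  \<open>u = -1\<close>; it occurs for \<open>x = -1\<close> and \<open>y = 0\<close>. For
  \<open>u \<ge> 0\<close> there is no such enclosure, and the logarithmic series is used.\<close>

lemma nlog_sum_tendsto:
  assumes "-1 \<le> u" "u < 1"
  shows "(\<lambda>N. nlog_sum N u) \<longlonglongrightarrow> nlog u"
proof (cases "u < 0")
  case True
  show ?thesis
  proof (rule metric_LIMSEQ_I)
    fix e :: real assume "0 < e"
    then obtain M where M: "1 / real (Suc M) < e"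
      using reals_Archimedean by (auto simp: inverse_eq_divide)
    have "dist (nlog_sum N u) (nlog u) < e" if "N \<ge> M" for N
    proof -
      have "nlog_sum (Suc N) u - nlog_sum N u = u ^ Suc N / real (Suc N)"
        by (simp add: nlog_sum_def)
      then have "\<bar>nlog_sum (Suc N) u - nlog_sum N u\<bar> = \<bar>u\<bar> ^ Suc N / real (Suc N)"
        by (simp add: power_abs abs_mult)
      also have "\<dots> \<le> 1 / real (Suc N)"
        using assms True by (intro divide_right_mono power_le_one) auto
      also have "\<dots> \<le> 1 / real (Suc M)"
        using that by (intro divide_left_mono) auto
      finally have "\<bar>nlog_sum (Suc N) u - nlog_sum N u\<bar> < e" using M by simp
      then show ?thesis
        using nlog_sum_bounds_neg[OF True, of N] nlog_sum_bounds_neg[OF True, of "Suc N"]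
        by (cases "even N") (auto simp: dist_real_def abs_real_def split: if_splits)
    qed
    then show "\<exists>M. \<forall>N\<ge>M. dist (nlog_sum N u) (nlog u) < e" by blast
  qed
next
  case False
  have u: "\<bar>u\<bar> < 1" using False assms by auto
  have "(\<lambda>n. u ^ Suc n / real (Suc n)) sums nlog u"
  proof -
    have "summable (\<lambda>n. u ^ n / real n)"
      using u by (intro summable_norm_cancel[OF norm_summable_ln_series]) simp
    then have "summable (\<lambda>n. u ^ Suc n / real (Suc n))"
      using summable_Suc_iff[of "\<lambda>n. u ^ n / real n"] by simp
    then have "(\<lambda>n. u ^ Suc n / real (Suc n)) sums (\<Sum>n. u ^ Suc n / real (Suc n))"
      by (rule summable_sums)
    moreover have "ln (1 - u) = (\<Sum>n. - (u ^ Suc n / real (Suc n)))"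
      using ln_series[of "1 - u"] u by (simp add: power_minus[of u] field_simps)
    ultimately show ?thesis
      unfolding nlog_def using suminf_minus[of "\<lambda>n. u ^ Suc n / real (Suc n)"] by (simp add: sums_iff)
  qed
  then show ?thesis by (simp add: sums_def nlog_sum_def)
qed

section \<open>The genetic functions on the reals\<close>

text \<open>The bound \<open>\<bar>x - y\<bar> < 1\<close> serves the admissibility tests of both
  recursions.\<close>

lemma real_opts_approx_cont:
  assumes "\<And>k. \<not> is_dyadic k x" "\<sigma> \<in> {1, -1}" "isCont f x" "0 < e"
  shows "\<exists>y\<in>real_opts TYPE('a::infinite) x. 0 < \<sigma> * (x - y) \<and> \<bar>x - y\<bar> < 1 \<and> \<bar>f y - f x :: real\<bar> < e"
proof -
  obtain d where d: "d > 0" "\<And>y. \<bar>y - x\<bar> < d \<Longrightarrow> \<bar>f y - f x\<bar> < e"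
    using assms(3,4) unfolding continuous_at_eps_delta by (auto simp: dist_real_def)
  obtain y where "y \<in> real_opts TYPE('a) x" "0 < \<sigma> * (x - y)" "\<sigma> * (x - y) < min d 1"
    using real_opts_approx[OF assms(1,2), of "min d 1", where 'a = 'a] d(1) by auto
  moreover have "\<sigma> * (x - y) = \<bar>x - y\<bar>"
    using \<open>0 < \<sigma> * (x - y)\<close> assms(2) by auto
  ultimately show ?thesis
    using d(2)[of y] by (intro bexI[of _ y]) (auto simp: abs_minus_commute)
qed

text \<open>As \<open>x\<close> and \<open>y\<close> do not have opposite signs, both arctangents
  lie in the same half of the interval from \<open>- pi / 2\<close> to \<open>pi / 2\<close>, and
  their difference stays in the range where \<open>arctan\<close> inverts
  \<open>tan\<close>.\<close>

lemma arctan_diff: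
  fixes x y :: real
  assumes "0 \<le> x * y"
  shows "arctan x = arctan y + arctan ((x - y) / (1 + x * y))"
proof -
  have b: "- (pi / 2) < arctan z" "arctan z < pi / 2" for z
    using arctan_bounded by auto
  have "0 \<le> x \<and> 0 \<le> y \<or> x \<le> 0 \<and> y \<le> 0"
    using assms by (simp add: zero_le_mult_iff)
  then have "0 \<le> arctan x \<and> 0 \<le> arctan y \<or> arctan x \<le> 0 \<and> arctan y \<le> 0"
    by simp
  then have r: "- (pi / 2) < arctan x - arctan y" "arctan x - arctan y < pi / 2"
    using b[of x] b[of y] by linarith+
  have "tan (arctan x - arctan y) = (x - y) / (1 + x * y)"
    using tan_diff[of "arctan x" "arctan y"] cos_gt_zero_pi[OF r] by (simp add: tan_arctan)
  then have "arctan ((x - y) / (1 + x * y)) = arctan x - arctan y"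
    by (rule arctan_unique[OF r])
  then show ?thesis by simp
qed

text \<open>One formula for all four kinds of options: the sums are odd, so subtracting the sum at
  \<open>(y - x) / (1 + x * y)\<close> gives the same number. It is a left option for
  \<open>y < x\<close> with even \<open>m\<close> or \<open>x < y\<close> with odd \<open>m\<close>,
  and a right option in the two other cases.\<close>

definition arctan_approx :: "real \<Rightarrow> real \<Rightarrow> nat \<Rightarrow> real" where
  "arctan_approx x y m = arctan y + arctan_sum m ((x - y) / (1 + x * y))"

lemma arctan_approx_less:
  assumes "0 \<le> x * y" "y < x \<and> even m \<or> x < y \<and> odd m"
  shows "arctan_approx x y m < arctan x"
proof -
  let ?u = "(x - y) / (1 + x * y)"
  have "arctan_sum m ?u < arctan ?u"
  proof (cases "y < x")
    case True
    then have "0 < ?u" using assms(1) by (intro divide_pos_pos) auto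
    then show ?thesis using True assms(2) arctan_sum_bounds(1) by auto
  next
    case False
    then have "0 < (y - x) / (1 + x * y)" using assms by (intro divide_pos_pos) auto
    then have "0 < - ?u" by (simp only: minus_divide_left minus_diff_eq)
    from arctan_sum_bounds(2)[OF this, of m] show ?thesis
      using False assms(2) by (simp add: arctan_sum_minus arctan_minus)
  qed
  then show ?thesis using arctan_diff[OF assms(1)] by (simp add: arctan_approx_def)
qed

lemma arctan_approx_greater:
  assumes "0 \<le> x * y" "x < y \<and> even m \<or> y < x \<and> odd m"
  shows "arctan x < arctan_approx x y m"
proof -
  let ?u = "(x - y) / (1 + x * y)"
  have "arctan ?u < arctan_sum m ?u"
  proof (cases "y < x")
    case True
    then have "0 < ?u" using assms(1) by (intro divide_pos_pos) auto
    then show ?thesis using True assms(2) arctan_sum_bounds(2) by auto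
  next
    case False
    then have "0 < (y - x) / (1 + x * y)" using assms by (intro divide_pos_pos) auto
    then have "0 < - ?u" by (simp only: minus_divide_left minus_diff_eq)
    from arctan_sum_bounds(1)[OF this, of m] show ?thesis
      using False assms(2) by (simp add: arctan_sum_minus arctan_minus)
  qed
  then show ?thesis using arctan_diff[OF assms(1)] by (simp add: arctan_approx_def)
qed

lemma arctan_approx_tendsto:
  assumes "0 \<le> x * y" "\<bar>(x - y) / (1 + x * y)\<bar> \<le> 1"
  shows "arctan_approx x y \<longlonglongrightarrow> arctan x"
  unfolding arctan_approx_def arctan_diff[OF assms(1)]
  by (intro tendsto_intros arctan_sum_tendsto assms)

lemma arctan_option_le_1:
  fixes x y :: real
  assumes "0 \<le> x * y" "\<bar>x - y\<bar> \<le> 1"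
  shows "\<bar>(x - y) / (1 + x * y)\<bar> \<le> 1"
proof -
  have "\<bar>1 + x * y\<bar> = 1 + x * y" using assms(1) by linarith
  then show ?thesis using assms by (simp add: abs_divide)
qed

text \<open>
  A dyadic \<open>x\<close> has finitely many options, but its neighbour at distance \<open>1 / 2 ^ k\<close> already gives a
  convergent sequence of options; a non-dyadic \<open>x\<close> is a limit of its options, and there the empty
  Maclaurin sum suffices.
\<close>

lemma arctan_options_dense:
  assumes "x \<noteq> 0" "\<sigma> \<in> {1, -1}" "0 < e"
  shows "\<exists>y\<in>real_opts TYPE('a::infinite) x. \<exists>m. (if even m then 0 < \<sigma> * (x - y) else \<sigma> * (x - y) < 0) \<and>
      \<bar>(x - y) / (1 + x * y)\<bar> \<le> 1 \<and> \<bar>arctan_approx x y m\<bar> \<le> pi / 2 \<and>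
      \<bar>arctan_approx x y m - arctan x\<bar> < e"
proof (cases "\<exists>k. is_dyadic k x")
  case False
  then obtain y where y: "y \<in> real_opts TYPE('a) x" "0 < \<sigma> * (x - y)" "\<bar>x - y\<bar> < 1" "\<bar>arctan y - arctan x\<bar> < e"
    using real_opts_approx_cont[of x \<sigma> arctan e, where 'a = 'a] assms by (auto intro: isCont_arctan)
  have "\<bar>(x - y) / (1 + x * y)\<bar> \<le> 1"
    using real_opts_same_sign[OF y(1)] y(3) by (intro arctan_option_le_1) auto
  moreover have "arctan_approx x y 0 = arctan y"
    by (simp add: arctan_approx_def arctan_sum_def)
  moreover have "\<bar>arctan y\<bar> \<le> pi / 2"
    using arctan_bounded[of y] by auto
  ultimately show ?thesis
    using y by (intro bexI[OF _ y(1)] exI[of _ 0]) auto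
next
  case True
  then obtain k where k: "exact_dyadic k x" using is_dyadic_exact by blast
  obtain \<tau> where \<tau>: "\<tau> \<in> {1, -1}" "x - \<tau> / 2 ^ k \<in> real_opts TYPE('a) x"
    using real_opts_exact_nonempty[OF k assms(1), where 'a = 'a] by metis
  define y where "y = x - \<tau> / 2 ^ k"
  have xy: "0 \<le> x * y" using real_opts_same_sign[OF \<tau>(2)] by (simp add: y_def)
  have "\<bar>x - y\<bar> \<le> 1" using \<tau>(1) by (auto simp: y_def abs_divide)
  then have u: "\<bar>(x - y) / (1 + x * y)\<bar> \<le> 1" using xy by (intro arctan_option_le_1)
  have lim: "arctan_approx x y \<longlonglongrightarrow> arctan x"
    by (rule arctan_approx_tendsto[OF xy u])
  have "eventually (\<lambda>m. dist (arctan_approx x y m) (arctan x) < e) sequentially"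
    by (rule tendstoD[OF lim assms(3)])
  moreover have "eventually (\<lambda>m. arctan_approx x y m < pi / 2) sequentially"
    using arctan_bounded[of x] by (intro order_tendstoD(2)[OF lim]) auto
  moreover have "eventually (\<lambda>m. - (pi / 2) < arctan_approx x y m) sequentially"
    using arctan_bounded[of x] by (intro order_tendstoD(1)[OF lim]) auto
  ultimately have "eventually (\<lambda>m. \<bar>arctan_approx x y m\<bar> \<le> pi / 2 \<and> \<bar>arctan_approx x y m - arctan x\<bar> < e) sequentially"
    by eventually_elim (auto simp: dist_real_def)
  then obtain M where M: "\<And>m. m \<ge> M \<Longrightarrow> \<bar>arctan_approx x y m\<bar> \<le> pi / 2 \<and> \<bar>arctan_approx x y m - arctan x\<bar> < e"
    by (auto simp: eventually_sequentially)
  \<comment> \<open>A single neighbour serves both sides of the cut: the parity of \<open>m\<close>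
    is chosen by the side on which it lies.\<close>
  define m where "m = (if \<sigma> = \<tau> then 2 * M else 2 * M + 1)"
  have "m \<ge> M" by (simp add: m_def)
  moreover have "if even m then 0 < \<sigma> * (x - y) else \<sigma> * (x - y) < 0"
    using \<tau>(1) assms(2) by (auto simp: m_def y_def)
  ultimately show ?thesis
    using M[of m] u \<tau>(2) by (intro bexI[of _ y] exI[of _ m]) (auto simp: y_def)
qed

lemma uarctan_surreal_of_real:
  "uarctan (surreal_of_real x) = (surreal_of_real (arctan x) :: 'a::infinite surreal)"
proof (induction x rule: wf_induct_rule[OF wf_inv_image[OF wf_simpler_rel, of "surreal_of_real :: real \<Rightarrow> 'a surreal"]])
  case (1 x)
  let ?i = "surreal_of_real :: real \<Rightarrow> 'a surreal"
  let ?A = "real_opts TYPE('a) x"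
  have IH: "uarctan (?i y) = ?i (arctan y)" if "y \<in> ?A" for y
    using 1[of y] that by (simp add: real_opts_simpler_rel)
  have same: "0 \<le> x * y" if "y \<in> ?A" for y using that by (rule real_opts_same_sign)
  have u: "(?i x - ?i y) / (1 + ?i x * ?i y) = ?i ((x - y) / (1 + x * y))" for y
    by (simp only: surreal_of_real_divide surreal_of_real_diff surreal_of_real_add surreal_of_real_mult
        surreal_of_real_1)
  have u': "(?i y - ?i x) / (1 + ?i x * ?i y) = ?i (- ((x - y) / (1 + x * y)))" for y
    by (simp only: surreal_of_real_divide surreal_of_real_diff surreal_of_real_add surreal_of_real_mult
        surreal_of_real_1 minus_diff_eq minus_divide_left)
  have less1: "\<not> \<bar>?i r\<bar> > 1 \<longleftrightarrow> \<bar>r\<bar> \<le> 1" for r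
    by (simp add: surreal_of_real_less_iff not_less flip: surreal_of_real_abs surreal_of_real_1)
  have lessp: "\<not> \<bar>?i r\<bar> > ?i (pi / 2) \<longleftrightarrow> \<bar>r\<bar> \<le> pi / 2" for r
    by (simp only: surreal_of_real_less_iff not_less flip: surreal_of_real_abs)
  have even: "trunc arctan (4 * int n - 1) (?i r) = ?i (arctan_sum (2 * n) r)" for n r
    using real_trunc_arctan[of "2 * n" r] by (simp add: trunc_surreal_of_real nat_mult_distrib)
  have odd: "trunc arctan (4 * int n + 1) (?i r) = ?i (arctan_sum (2 * n + 1) r)" for n r
  proof -
    have "nat (4 * int n + 1 + 1) = 2 * (2 * n + 1)" by simp
    then show ?thesis using real_trunc_arctan[of "2 * n + 1" r] by (simp only: trunc_surreal_of_real)
  qed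
  let ?ok = "\<lambda>y m. \<bar>(x - y) / (1 + x * y)\<bar> \<le> 1 \<and> \<bar>arctan_approx x y m\<bar> \<le> pi / 2"
  let ?S = "\<lambda>P Q. {arctan_approx x y m |y m. y \<in> ?A \<and> P y \<and> Q m \<and> ?ok y m}"
  let ?L = "{- pi / 2} \<union> ?S (\<lambda>y. y < x) even \<union> ?S (\<lambda>y. x < y) odd"
  let ?R = "?S (\<lambda>y. x < y) even \<union> ?S (\<lambda>y. y < x) odd \<union> {pi / 2}"
  \<comment> \<open>This treats the four families of options at once, with \<open>h n\<close> being
    \<open>2 * n\<close> or \<open>2 * n + 1\<close>.\<close>
  have set: "{v. \<not> \<bar>v\<bar> > ?i (pi / 2) \<and> (\<exists>y\<in>?i ` {y \<in> ?A. P y}. \<not> \<bar>(?i x - y) / (1 + ?i x * y)\<bar> > 1 \<and> (\<exists>n::nat. v = F y n))} =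
      ?i ` ?S P Q"
    if F: "\<And>y n. y \<in> ?A \<Longrightarrow> F (?i y) n = ?i (arctan_approx x y (h n))" and Q: "\<And>m. Q m \<longleftrightarrow> (\<exists>n. m = h n)"
    for P Q and F :: "'a surreal \<Rightarrow> nat \<Rightarrow> 'a surreal" and h
  proof (intro equalityI subsetI)
    fix v assume "v \<in> {v. \<not> \<bar>v\<bar> > ?i (pi / 2) \<and> (\<exists>y\<in>?i ` {y \<in> ?A. P y}. \<not> \<bar>(?i x - y) / (1 + ?i x * y)\<bar> > 1 \<and> (\<exists>n::nat. v = F y n))}"
    then obtain y n where "y \<in> ?A" "P y" "v = F (?i y) n" "\<not> \<bar>v\<bar> > ?i (pi / 2)" "\<not> \<bar>(?i x - ?i y) / (1 + ?i x * ?i y)\<bar> > 1"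
      by blast
    then have "v = ?i (arctan_approx x y (h n))" "?ok y (h n)"
      unfolding u less1 using F lessp by metis+
    then show "v \<in> ?i ` ?S P Q" using \<open>y \<in> ?A\<close> \<open>P y\<close> Q by blast
  next
    fix v assume "v \<in> ?i ` ?S P Q"
    then obtain y m where "y \<in> ?A" "P y" "Q m" "?ok y m" "v = ?i (arctan_approx x y m)"
      by blast
    moreover from this obtain n where "m = h n" using Q by blast
    ultimately have "y \<in> ?A" "P y" "?ok y (h n)" "v = ?i (arctan_approx x y (h n))"
      by simp_all
    moreover from this have "\<not> \<bar>v\<bar> > ?i (pi / 2)" "v = F (?i y) n" "\<not> \<bar>(?i x - ?i y) / (1 + ?i x * ?i y)\<bar> > 1"
      unfolding u less1 using F lessp by metis+
    ultimately show "v \<in> {v. \<not> \<bar>v\<bar> > ?i (pi / 2) \<and> (\<exists>y\<in>?i ` {y \<in> ?A. P y}. \<not> \<bar>(?i x - y) / (1 + ?i x * y)\<bar> > 1 \<and> (\<exists>n::nat. v = F y n))}"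
      by blast
  qed
  have ev: "even m \<longleftrightarrow> (\<exists>n. m = 2 * n)" and od: "odd m \<longleftrightarrow> (\<exists>n. m = 2 * n + 1)" for m :: nat
    by (auto elim: evenE oddE)
  have "uarctan (?i x) = simplest (?i ` ?L) (?i ` ?R)"
    unfolding image_Un image_insert image_empty
    by (subst uarctan.simps, unfold left_opts_surreal_of_real right_opts_surreal_of_real,
        intro arg_cong2[where f = simplest] arg_cong2[where f = "(\<union>)"] refl
          set[OF _ ev] set[OF _ od],
        simp_all only: IH u u' even odd arctan_sum_minus arctan_approx_def)
      (simp_all only: surreal_of_real_add[symmetric] surreal_of_real_diff[symmetric] diff_minus_eq_add)
  also have "\<dots> = ?i (arctan x)"
  proof (rule simplest_surreal_of_real)
    show "l < arctan x" if "l \<in> ?L" for l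
      using that arctan_bounded[of x] same by (auto intro: arctan_approx_less)
    show "arctan x < r" if "r \<in> ?R" for r
      using that arctan_bounded[of x] same by (auto intro: arctan_approx_greater)
    show "\<exists>l\<in>?L. p \<le> l" if p: "p \<in> real_opts TYPE('a) (arctan x)" "p < arctan x" for p
    proof -
      \<comment> \<open>\<open>arctan 0 = 0\<close> has no options, so at \<open>x = 0\<close> there
        is nothing to dominate.\<close>
      have "x \<noteq> 0" using p(1) by (auto simp: real_opts_0)
      then have "\<exists>y\<in>?A. \<exists>m. (if even m then 0 < 1 * (x - y) else 1 * (x - y) < 0) \<and>
          \<bar>(x - y) / (1 + x * y)\<bar> \<le> 1 \<and> \<bar>arctan_approx x y m\<bar> \<le> pi / 2 \<and>
          \<bar>arctan_approx x y m - arctan x\<bar> < arctan x - p"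
        using p(2) by (intro arctan_options_dense) auto
      then obtain y m where y: "y \<in> ?A" "if even m then 0 < 1 * (x - y) else 1 * (x - y) < 0" "?ok y m"
        "\<bar>arctan_approx x y m - arctan x\<bar> < arctan x - p"
        by blast
      from y(2) have "y < x \<and> even m \<or> x < y \<and> odd m" by (simp split: if_splits)
      then have "arctan_approx x y m \<in> ?L" using y(1,3) by blast
      moreover have "p \<le> arctan_approx x y m" using y(4) by linarith
      ultimately show ?thesis by blast
    qed
    show "\<exists>r\<in>?R. r \<le> p" if p: "p \<in> real_opts TYPE('a) (arctan x)" "arctan x < p" for p
    proof -
      have "x \<noteq> 0" using p(1) by (auto simp: real_opts_0)
      then have "\<exists>y\<in>?A. \<exists>m. (if even m then 0 < (-1) * (x - y) else (-1) * (x - y) < 0) \<and>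
          \<bar>(x - y) / (1 + x * y)\<bar> \<le> 1 \<and> \<bar>arctan_approx x y m\<bar> \<le> pi / 2 \<and>
          \<bar>arctan_approx x y m - arctan x\<bar> < p - arctan x"
        using p(2) by (intro arctan_options_dense) auto
      then obtain y m where y: "y \<in> ?A" "if even m then 0 < (-1) * (x - y) else (-1) * (x - y) < 0" "?ok y m"
        "\<bar>arctan_approx x y m - arctan x\<bar> < p - arctan x"
        by blast
      from y(2) have "x < y \<and> even m \<or> y < x \<and> odd m" by (simp split: if_splits)
      then have "arctan_approx x y m \<in> ?R" using y(1,3) by blast
      moreover have "arctan_approx x y m \<le> p" using y(4) by linarith
      ultimately show ?thesis by blast
    qed
  qed
  finally show ?case .
qed

section \<open>Real options in the recursion for \<open>unlog\<close>\<close>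

lemma nlog_sum_less_nlog:
  assumes "u < 1" "0 < u \<or> u < 0 \<and> odd m"
  shows "nlog_sum m u < nlog u"
  using assms nlog_sum_less nlog_sum_bounds_neg(1) by blast

lemma nlog_diff:
  assumes "x < 1" "y < 1"
  shows "nlog x = nlog y + nlog ((x - y) / (1 - y))" "(x - y) / (1 - y) < 1"
proof -
  have "1 - (x - y) / (1 - y) = (1 - x) / (1 - y)"
    using assms by (simp add: field_simps)
  then show "nlog x = nlog y + nlog ((x - y) / (1 - y))" "(x - y) / (1 - y) < 1"
    using assms by (simp_all add: nlog_def ln_div divide_less_eq)
qed

text \<open>\<open>nlog\<close> is not odd, so left and right options need two formulas. The
  addition theorem is used once from \<open>y\<close> to \<open>x\<close> and once from
  \<open>x\<close> to \<open>y\<close>; in both cases the sum is a lower bound of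
  \<open>nlog\<close>, and subtracting it in \<open>nlog_upper\<close> yields an upper bound of
  \<open>nlog x\<close>.\<close>

definition nlog_lower :: "real \<Rightarrow> real \<Rightarrow> nat \<Rightarrow> real" where
  "nlog_lower x y m = nlog y + nlog_sum m ((x - y) / (1 - y))"

definition nlog_upper :: "real \<Rightarrow> real \<Rightarrow> nat \<Rightarrow> real" where
  "nlog_upper x y m = nlog y - nlog_sum m ((y - x) / (1 - x))"

lemma nlog_lower_less:
  assumes "x < 1" "y < 1" "y < x \<or> x < y \<and> odd m"
  shows "nlog_lower x y m < nlog x"
  using assms nlog_diff[of x y] nlog_sum_less_nlog[of "(x - y) / (1 - y)" m]
  by (auto simp: nlog_lower_def zero_less_divide_iff divide_less_0_iff)

lemma nlog_upper_greater:
  assumes "x < 1" "y < 1" "x < y \<or> y < x \<and> odd m"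
  shows "nlog x < nlog_upper x y m"
  using assms nlog_diff[of y x] nlog_sum_less_nlog[of "(y - x) / (1 - x)" m]
  by (auto simp: nlog_upper_def zero_less_divide_iff divide_less_0_iff)

lemma isCont_nlog: "x < 1 \<Longrightarrow> isCont nlog x"
  unfolding nlog_def by (intro continuous_intros) auto

text \<open>The denominators satisfy \<open>1 - y \<ge> 1\<close> and \<open>1 - x > 1\<close>.
  Equality in the first claim occurs exactly for \<open>x = -1\<close> and
  \<open>y = 0\<close>.\<close>

lemma nlog_option_abs:
  fixes x y :: real
  assumes "x < 0" "y \<le> 0" "\<bar>x - y\<bar> \<le> 1"
  shows "\<bar>(x - y) / (1 - y)\<bar> \<le> 1" "\<bar>(x - y) / (1 - x)\<bar> < 1"
  using assms by (auto simp: abs_divide divide_le_eq)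

text \<open>For dyadic \<open>x\<close> the neighbour at distance \<open>1 / 2 ^ k\<close> yields
  left and right options whichever side it lies on, because odd \<open>m\<close> is allowed on both.
  For other \<open>x\<close> the empty sum at a nearby option on the required side suffices.\<close>

lemma nlog_options_dense:
  assumes x: "x < 0" and e: "0 < e"
  shows "\<exists>y\<in>real_opts TYPE('a::infinite) x. \<exists>m. (y < x \<or> odd m) \<and>
      \<bar>(x - y) / (1 - y)\<bar> \<le> 1 \<and> \<bar>(x - y) / (1 - x)\<bar> < 1 \<and> \<bar>nlog_lower x y m - nlog x\<bar> < e" (is ?lower)
    and "\<exists>y\<in>real_opts TYPE('a) x. \<exists>m. (x < y \<or> odd m) \<and>
      \<bar>(x - y) / (1 - y)\<bar> \<le> 1 \<and> \<bar>(x - y) / (1 - x)\<bar> < 1 \<and> \<bar>nlog_upper x y m - nlog x\<bar> < e" (is ?upper)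
proof -
  have neg: "y \<le> 0" if "y \<in> real_opts TYPE('a) x" for y
    using real_opts_same_sign[OF that] x by (auto simp: zero_le_mult_iff)
  have "?lower \<and> ?upper"
  proof (cases "\<exists>k. is_dyadic k x")
    case False
    then have *: "\<exists>y\<in>real_opts TYPE('a) x. 0 < \<sigma> * (x - y) \<and> \<bar>x - y\<bar> < 1 \<and> \<bar>nlog y - nlog x\<bar> < e"
      if "\<sigma> \<in> {1, -1}" for \<sigma>
      using that real_opts_approx_cont[OF _ that isCont_nlog e, where 'a = 'a] x by auto
    have 0: "nlog_lower x y 0 = nlog y" "nlog_upper x y 0 = nlog y" for y
      by (simp_all add: nlog_lower_def nlog_upper_def nlog_sum_def)
    obtain y where "y \<in> real_opts TYPE('a) x" "y < x" "\<bar>x - y\<bar> < 1" "\<bar>nlog y - nlog x\<bar> < e"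
      using *[of 1] by auto
    then have ?lower
      using nlog_option_abs[OF x neg, of y] by (intro bexI[of _ y] exI[of _ 0]) (auto simp: 0)
    moreover obtain y where "y \<in> real_opts TYPE('a) x" "x < y" "\<bar>x - y\<bar> < 1" "\<bar>nlog y - nlog x\<bar> < e"
      using *[of "-1"] by auto
    then have ?upper
      using nlog_option_abs[OF x neg, of y] by (intro bexI[of _ y] exI[of _ 0]) (auto simp: 0)
    ultimately show ?thesis ..
  next
    case True
    then obtain k where k: "exact_dyadic k x" using is_dyadic_exact by blast
    obtain \<tau> where \<tau>: "\<tau> \<in> {1, -1}" "x - \<tau> / 2 ^ k \<in> real_opts TYPE('a) x"
      using real_opts_exact_nonempty[OF k, where 'a = 'a] x by (metis less_irrefl)
    define y where "y = x - \<tau> / 2 ^ k"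
    have y: "y \<in> real_opts TYPE('a) x" "y \<le> 0" using \<tau>(2) neg[OF \<tau>(2)] by (simp_all add: y_def)
    have "\<bar>x - y\<bar> \<le> 1" using \<tau>(1) by (auto simp: y_def abs_divide)
    then have u: "\<bar>(x - y) / (1 - y)\<bar> \<le> 1" "\<bar>(x - y) / (1 - x)\<bar> < 1"
      using nlog_option_abs[OF x y(2)] by auto
    then have w: "\<bar>(y - x) / (1 - x)\<bar> < 1"
      by (simp add: abs_minus_commute)
    have d: "nlog x = nlog y + nlog ((x - y) / (1 - y))" "(x - y) / (1 - y) < 1"
      "nlog x = nlog y - nlog ((y - x) / (1 - x))"
      using nlog_diff[of x y] nlog_diff[of y x] x y(2) by auto
    have b: "- 1 \<le> (x - y) / (1 - y)" "- 1 \<le> (y - x) / (1 - x)" "(y - x) / (1 - x) < 1"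
      using u(1) w by linarith+
    have "nlog_lower x y \<longlonglongrightarrow> nlog x"
      unfolding nlog_lower_def d(1) by (intro tendsto_intros nlog_sum_tendsto b d)
    then have "eventually (\<lambda>m. dist (nlog_lower x y m) (nlog x) < e) sequentially"
      using e by (rule tendstoD)
    moreover have "nlog_upper x y \<longlonglongrightarrow> nlog x"
      unfolding nlog_upper_def d(3) by (intro tendsto_intros nlog_sum_tendsto b)
    then have "eventually (\<lambda>m. dist (nlog_upper x y m) (nlog x) < e) sequentially"
      using e by (rule tendstoD)
    ultimately have "eventually (\<lambda>m. \<bar>nlog_lower x y m - nlog x\<bar> < e \<and> \<bar>nlog_upper x y m - nlog x\<bar> < e) sequentially"
      by eventually_elim (auto simp: dist_real_def)
    then obtain M where "\<And>m. m \<ge> M \<Longrightarrow> \<bar>nlog_lower x y m - nlog x\<bar> < e \<and> \<bar>nlog_upper x y m - nlog x\<bar> < e"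
      by (auto simp: eventually_sequentially)
    from this[of "2 * M + 1"] show ?thesis
      using u by (intro conjI bexI[OF _ y(1)] exI[of _ "2 * M + 1"]) auto
  qed
  then show ?lower ?upper by auto
qed

lemma unlog_surreal_of_real:
  "x \<le> 0 \<Longrightarrow> unlog (surreal_of_real x) = (surreal_of_real (nlog x) :: 'a::infinite surreal)"
proof (induction x rule: wf_induct_rule[OF wf_inv_image[OF wf_simpler_rel, of "surreal_of_real :: real \<Rightarrow> 'a surreal"]])
  case (1 x)
  let ?i = "surreal_of_real :: real \<Rightarrow> 'a surreal"
  let ?A = "real_opts TYPE('a) x"
  have neg: "x < 0 \<and> y \<le> 0" if "y \<in> ?A" for y
  proof -
    have "x \<noteq> 0" using that by (auto simp: real_opts_0)
    then show ?thesis
      using real_opts_same_sign[OF that] 1(2) by (auto simp: zero_le_mult_iff)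
  qed
  have IH: "unlog (?i y) = ?i (nlog y)" if "y \<in> ?A" for y
    using 1(1)[of y] neg that by (simp add: real_opts_simpler_rel)
  have u: "(?i x - ?i y) / (1 - ?i y) = ?i ((x - y) / (1 - y))"
    "(?i x - ?i y) / (1 - ?i x) = ?i ((x - y) / (1 - x))"
    "(?i y - ?i x) / (1 - ?i x) = ?i ((y - x) / (1 - x))" for y
    by (simp_all only: surreal_of_real_divide surreal_of_real_diff surreal_of_real_1)
  let ?ok = "\<lambda>y. \<bar>(x - y) / (1 - y)\<bar> \<le> 1 \<and> \<bar>(x - y) / (1 - x)\<bar> < 1"
  have adm: "nlog_admissible (?i x) (?i y) \<longleftrightarrow> ?ok y" for y
    unfolding nlog_admissible_def u
    by (simp add: surreal_of_real_less_iff surreal_of_real_le_iff not_less not_le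
        flip: surreal_of_real_abs surreal_of_real_1)
  have all: "trunc nlog (int n) (?i r) = ?i (nlog_sum n r)" for n r
    using real_trunc_nlog[of n r] by (simp add: trunc_surreal_of_real nat_add_distrib)
  have odd: "trunc nlog (2 * int n + 1) (?i r) = ?i (nlog_sum (2 * n + 1) r)" for n r
  proof -
    have "nat (2 * int n + 1 + 1) = Suc (2 * n + 1)" by simp
    then show ?thesis using real_trunc_nlog[of "2 * n + 1" r] by (simp only: trunc_surreal_of_real)
  qed
  let ?S = "\<lambda>G P Q. {G y m |y m. y \<in> ?A \<and> P y \<and> Q m \<and> ?ok y} :: real set"
  let ?T = "\<lambda>_::nat. True"
  let ?L = "?S (nlog_lower x) (\<lambda>y. y < x) ?T \<union> ?S (nlog_lower x) (\<lambda>y. x < y) odd"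
  let ?R = "?S (nlog_upper x) (\<lambda>y. x < y) ?T \<union> ?S (nlog_upper x) (\<lambda>y. y < x) odd"
  have set: "{v. \<exists>y\<in>?i ` {y \<in> ?A. P y}. nlog_admissible (?i x) y \<and> (\<exists>n::nat. v = F y n)} = ?i ` ?S G P Q"
    if F: "\<And>y n. y \<in> ?A \<Longrightarrow> F (?i y) n = ?i (G y (h n))" and Q: "\<And>m. Q m \<longleftrightarrow> (\<exists>n. m = h n)"
    for P Q G and F :: "'a surreal \<Rightarrow> nat \<Rightarrow> 'a surreal" and h
  proof (intro equalityI subsetI)
    fix v assume "v \<in> {v. \<exists>y\<in>?i ` {y \<in> ?A. P y}. nlog_admissible (?i x) y \<and> (\<exists>n::nat. v = F y n)}"
    then obtain y n where "y \<in> ?A" "P y" "v = F (?i y) n" "nlog_admissible (?i x) (?i y)"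
      by blast
    then have "v = ?i (G y (h n))" "?ok y"
      using F adm by metis+
    then show "v \<in> ?i ` ?S G P Q" using \<open>y \<in> ?A\<close> \<open>P y\<close> Q by blast
  next
    fix v assume "v \<in> ?i ` ?S G P Q"
    then obtain y m where "y \<in> ?A" "P y" "Q m" "?ok y" "v = ?i (G y m)"
      by blast
    moreover from this obtain n where "m = h n" using Q by blast
    ultimately have "y \<in> ?A" "P y" "nlog_admissible (?i x) (?i y)" "v = F (?i y) n"
      using F adm by simp_all
    then show "v \<in> {v. \<exists>y\<in>?i ` {y \<in> ?A. P y}. nlog_admissible (?i x) y \<and> (\<exists>n::nat. v = F y n)}"
      by blast
  qed
  have tr: "True \<longleftrightarrow> (\<exists>n. m = n)" and od: "odd m \<longleftrightarrow> (\<exists>n. m = 2 * n + 1)" for m :: nat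
    by (auto elim: oddE)
  \<comment> \<open>Reals are finite, so the recursion is entered and not its default
    \<open>undefined\<close>.\<close>
  obtain n where "- x < real n" using reals_Archimedean2 by blast
  then have "?i x \<in> nlog_domain"
    using 1(2) surreal_of_real_le_iff[of x 0, where 'a = 'a]
    by (auto simp: nlog_domain_def surreal_of_real_less_iff intro!: exI[of _ n])
  then have "unlog (?i x) = simplest (?i ` ?L) (?i ` ?R)"
    unfolding image_Un
    by (subst unlog.simps, simp only: if_True, unfold left_opts_surreal_of_real right_opts_surreal_of_real,
        intro arg_cong2[where f = simplest] arg_cong2[where f = "(\<union>)"] refl
          set[OF _ tr] set[OF _ od])
      (simp_all only: IH u all odd nlog_lower_def nlog_upper_def surreal_of_real_add surreal_of_real_diff)
  also have "\<dots> = ?i (nlog x)"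
  proof (rule simplest_surreal_of_real)
    have lt1: "x < 1" "y < 1" if "y \<in> ?A" for y using neg[OF that] by auto
    show "l < nlog x" if "l \<in> ?L" for l
      using that lt1 by (auto intro: nlog_lower_less)
    show "nlog x < r" if "r \<in> ?R" for r
      using that lt1 by (auto intro: nlog_upper_greater)
    \<comment> \<open>At \<open>x = 0\<close> the value is 0, which has no options to
      dominate.\<close>
    have x: "x < 0" if "p \<in> real_opts TYPE('a) (nlog x)" for p
      using that 1(2) by (cases "x = 0") (auto simp: nlog_def real_opts_0)
    show "\<exists>l\<in>?L. p \<le> l" if p: "p \<in> real_opts TYPE('a) (nlog x)" "p < nlog x" for p
    proof -
      obtain y m where y: "y \<in> ?A" "y < x \<or> odd m" "?ok y" "\<bar>nlog_lower x y m - nlog x\<bar> < nlog x - p"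
        using nlog_options_dense(1)[OF x[OF p(1)], of "nlog x - p", where 'a = 'a] p(2) by auto
      have "y \<noteq> x" using y(1) real_opts_irrefl by blast
      then have "y < x \<or> x < y \<and> odd m" using y(2) by auto
      then have "nlog_lower x y m \<in> ?L" using y(1,3) by blast
      moreover have "p \<le> nlog_lower x y m" using y(4) by linarith
      ultimately show ?thesis by blast
    qed
    show "\<exists>r\<in>?R. r \<le> p" if p: "p \<in> real_opts TYPE('a) (nlog x)" "nlog x < p" for p
    proof -
      obtain y m where y: "y \<in> ?A" "x < y \<or> odd m" "?ok y" "\<bar>nlog_upper x y m - nlog x\<bar> < p - nlog x"
        using nlog_options_dense(2)[OF x[OF p(1)], of "p - nlog x", where 'a = 'a] p(2) by auto
      have "y \<noteq> x" using y(1) real_opts_irrefl by blast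
      then have "x < y \<or> y < x \<and> odd m" using y(2) by auto
      then have "nlog_upper x y m \<in> ?R" using y(1,3) by blast
      moreover have "nlog_upper x y m \<le> p" using y(4) by linarith
      ultimately show ?thesis by blast
    qed
  qed
  finally show ?case .
qed

theorem theorem13:
  shows "(\<forall>x::real.
            surreal_of_real (arctan x) = (uarctan (surreal_of_real x) :: 'a::infinite surreal)) \<and>
         (\<forall>x::real. x \<le> 0 \<longrightarrow>
            surreal_of_real (nlog x) = (unlog (surreal_of_real x) :: 'a surreal))"
  by (simp add: uarctan_surreal_of_real unlog_surreal_of_real)

end
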